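(* There exists $M$, depending only on the representation $\mathfrak r$ of $H$, such that for all sufficiently small $\epsilon>0$ and all $\delta>0$ sufficiently small depending on $\epsilon$ the following holds. For every $A\subseteq B_1^{\mathfrak r}(0)$, the exceptional set $$\mathcal E(A)=\left\{u\in\mathsf B_1^U:\ \exists A'\subseteq A\text{ with }|A'|_\delta\ge\delta^\epsilon|A|_\delta\text{ and }|\pi_u^{(0)}(A')|_\delta<\delta^{M\epsilon}|A|_\delta^{\frac69}\right\}$$ satisfies $m_U(\mathcal E(A))\le\delta^\epsilon$.
   Context: $Q$ is either $x_2x_3-x_1x_4$ or $x_2^2+x_3^2-2x_1x_4$ on $\mathbb R^4$, $H=\mathrm{SO}(Q)^\circ\subset\mathrm{SL}_4(\mathbb R)$ (identity component), $\mathfrak h=\mathrm{Lie}(H)$; the result is asserted for each choice. Writing $Q$ also for the symmetric matrix of the form, $\mathfrak r=\{x\in\mathfrak{sl}_4(\mathbb R):Qx^tQ^{-1}=x\}$ is the $\mathrm{Ad}(H)$-invariant complement of $\mathfrak h$ in $\mathfrak{sl}_4(\mathbb R)$, an irreducible representation of $H$ with $\dim\mathfrak r=9$. $U=\{u_{r,s}:r,s\in\mathbb R\}$ with $u_{r,s}=\begin{pmatrix}1&r&s&sr\\&1&&s\\&&1&r\\&&&1\end{pmatrix}$ for the first form and $u_{r,s}=\begin{pmatrix}1&r&s&(r^2+s^2)/2\\&1&&r\\&&1&s\\&&&1\end{pmatrix}$ for the second; $\mathsf B_1^U=\{u_{r,s}:|r|,|s|\le1\}$ and $m_U$ is the Haar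 measure on $U$ with $m_U(\mathsf B_1^U)=1$. $B_1^{\mathfrak r}(0)$ is the unit ball for the max norm of $\mathrm{Mat}_4(\mathbb R)$; $|\cdot|_\delta$ is the $\delta$-covering number. Let $\mathbf a=\mathrm{diag}(1,0,0,-1)$; $\mathrm{ad}\,\mathbf a$ acts on $\mathfrak r$ with eigenvalues $-2,-1,0,1,2$ and eigenspaces $\mathfrak r_\lambda$ of dimensions $1,2,3,2,1$. $\mathfrak r^{(\lambda)}=\bigoplus_{\mu\ge\lambda}\mathfrak r_\mu$, $\pi^{(\lambda)}:\mathfrak r\to\mathfrak r^{(\lambda)}$ is the orthogonal projection for the standard inner product of $\mathrm{Mat}_4(\mathbb R)$, and $\pi_u^{(\lambda)}=\pi^{(\lambda)}\circ\mathrm{Ad}(u)$. Thus $\dim\mathfrak r^{(0)}=6$. *)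

theory Defs
  imports "HOL-Analysis.Analysis"
begin

section \<open>The two quadratic forms\<close>

text \<open>\<open>Split\<close> is $x_2 x_3 - x_1 x_4$ (signature $(2,2)$) and
  \<open>Lorentz\<close> is $x_2^2 + x_3^2 - 2 x_1 x_4$ (signature $(3,1)$).\<close>

datatype form = Split | Lorentz

fun quad_form :: "form \<Rightarrow> real^4 \<Rightarrow> real" where
  "quad_form Split x = x$2 * x$3 - x$1 * x$4"
| "quad_form Lorentz x = (x$2)\<^sup>2 + (x$3)\<^sup>2 - 2 * x$1 * x$4"

definition form_mat :: "form \<Rightarrow> real^4^4" where
  "form_mat q = (\<chi> i j. (quad_form q (axis i 1 + axis j 1)
      - quad_form q (axis i 1) - quad_form q (axis j 1)) / 2)"

lemma vector_4 [simp]: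
  "(vector [a,b,c,d] :: 'a::zero^4) $ 1 = a"
  "(vector [a,b,c,d] :: 'a::zero^4) $ 2 = b"
  "(vector [a,b,c,d] :: 'a::zero^4) $ 3 = c"
  "(vector [a,b,c,d] :: 'a::zero^4) $ 4 = d"
  unfolding vector_def by auto

lemma form_mat_Split:
  "form_mat Split = vector
    [vector [   0,   0,   0, -1/2],
     vector [   0,   0, 1/2,    0],
     vector [   0, 1/2,   0,    0],
     vector [-1/2,   0,   0,    0]]"
  by (simp add: form_mat_def vec_eq_iff forall_4 axis_def)

lemma form_mat_Lorentz:
  "form_mat Lorentz = vector
    [vector [ 0, 0, 0, -1],
     vector [ 0, 1, 0,  0],
     vector [ 0, 0, 1,  0],
     vector [-1, 0, 0,  0]]"
  by (simp add: form_mat_def vec_eq_iff forall_4 axis_def power2_eq_square)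

lemma quad_form_eq_inner: "quad_form q x = x \<bullet> (form_mat q *v x)"
  by (cases q) (simp_all add: form_mat_Split form_mat_Lorentz inner_vec_def sum_4
      matrix_vector_mult_def power2_eq_square field_simps)

lemma invertible_form_mat: "invertible (form_mat q)"
proof (cases q)
  case Split
  have "form_mat q ** (4 *\<^sub>R form_mat q) = mat 1" "(4 *\<^sub>R form_mat q) ** form_mat q = mat 1"
    by (simp_all add: Split form_mat_Split vec_eq_iff forall_4 matrix_matrix_mult_def sum_4 mat_def)
  then show ?thesis unfolding invertible_def by blast
next
  case Lorentz
  have "form_mat q ** form_mat q = mat 1"
    by (simp add: Lorentz form_mat_Lorentz vec_eq_iff forall_4 matrix_matrix_mult_def sum_4 mat_def)
  then show ?thesis unfolding invertible_def by blast
qed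


section \<open>The representation and its weight filtration\<close>

definition rep :: "form \<Rightarrow> (real^4^4) set" where
  "rep q = {x. trace x = 0 \<and> form_mat q ** transpose x ** matrix_inv (form_mat q) = x}"

definition Ad :: "real^4^4 \<Rightarrow> real^4^4 \<Rightarrow> real^4^4" where
  "Ad g x = g ** x ** matrix_inv g"

definition diag_elt :: "real^4^4" where
  "diag_elt = vector
    [vector [1, 0, 0,  0],
     vector [0, 0, 0,  0],
     vector [0, 0, 0,  0],
     vector [0, 0, 0, -1]]"

definition weight_space :: "form \<Rightarrow> real \<Rightarrow> (real^4^4) set" where
  "weight_space q k = {x \<in> rep q. diag_elt ** x - x ** diag_elt = k *\<^sub>R x}"

definition weight_filt :: "form \<Rightarrow> real \<Rightarrow> (real^4^4) set" where
  "weight_filt q l = span (\<Union>k\<in>{l..}. weight_space q k)"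

text \<open>The inner product of \<^typ>\<open>real^4^4\<close> is the standard one $\sum_{i,j} x_{ij} y_{ij}$,
  and \<^const>\<open>infnorm\<close> is the maximum of the absolute values of the matrix entries.\<close>

definition orth_proj :: "'a::euclidean_space set \<Rightarrow> 'a \<Rightarrow> 'a" where
  "orth_proj S x = (THE y. y \<in> S \<and> x - y \<in> S\<^sup>\<bottom>)"

definition proj_u :: "form \<Rightarrow> real \<Rightarrow> real^4^4 \<Rightarrow> real^4^4 \<Rightarrow> real^4^4" where
  "proj_u q l u = orth_proj (weight_filt q l) \<circ> Ad u"

definition rep_ball :: "form \<Rightarrow> (real^4^4) set" where
  "rep_ball q = {x \<in> rep q. infnorm x \<le> 1}"

text \<open>The least number of closed \<open>\<delta>\<close>-balls for the max norm, with arbitrary centres in the ambient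
  space, that cover \<open>A\<close>; meaningful for bounded \<open>A\<close> only.\<close>

definition covering_number :: "real \<Rightarrow> 'a::euclidean_space set \<Rightarrow> nat" where
  "covering_number \<delta> A =
    (LEAST n. \<exists>C. finite C \<and> card C = n \<and> A \<subseteq> (\<Union>c\<in>C. {x. infnorm (x - c) \<le> \<delta>}))"

lemma orth_proj_unique:
  fixes S :: "'a::euclidean_space set"
  assumes "subspace S"
  shows "\<exists>!y. y \<in> S \<and> x - y \<in> S\<^sup>\<bottom>"
proof -
  obtain y z where yz: "y \<in> span S" "\<And>w. w \<in> span S \<Longrightarrow> orthogonal z w" "x = y + z"
    using orthogonal_subspace_decomp_exists[of S x] by metis
  have sp: "span S = S" using assms by (simp add: span_eq_iff)
  show ?thesis
  proof (rule ex1I[of _ y])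
    show "y \<in> S \<and> x - y \<in> S\<^sup>\<bottom>"
      using yz sp by (auto simp: orthogonal_comp_def orthogonal_commute)
  next
    fix y' assume y': "y' \<in> S \<and> x - y' \<in> S\<^sup>\<bottom>"
    have "y - y' \<in> S" using yz sp y' assms by (simp add: subspace_diff)
    moreover have "x - y' = (y - y') + z" using yz by simp
    ultimately have "(y - y') \<bullet> ((y - y') + z) = 0" "(y - y') \<bullet> z = 0"
      using y' yz(2)[of "y - y'"] sp
      by (metis (no_types, lifting) mem_Collect_eq orthogonal_comp_def orthogonal_def)
         (use yz(2)[of "y - y'"] sp \<open>y - y' \<in> S\<close> in \<open>simp add: orthogonal_def inner_commute\<close>)
    then show "y' = y" by (simp add: inner_add_right)
  qed
qed

lemma covering_number_attained:
  fixes A :: "'a::euclidean_space set"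
  assumes "bounded A" "\<delta> > 0"
  shows "\<exists>C. finite C \<and> card C = covering_number \<delta> A \<and>
    A \<subseteq> (\<Union>c\<in>C. {x. infnorm (x - c) \<le> \<delta>})"
proof -
  have "\<exists>C. finite C \<and> closure A \<subseteq> (\<Union>c\<in>C. ball c \<delta>)"
    using assms compact_eq_totally_bounded[of "closure A"] by (auto simp: compact_closure)
  then obtain C where C: "finite C" "closure A \<subseteq> (\<Union>c\<in>C. ball c \<delta>)" by blast
  have "A \<subseteq> (\<Union>c\<in>C. {x. infnorm (x - c) \<le> \<delta>})"
  proof
    fix x assume "x \<in> A"
    then obtain c where c: "c \<in> C" "norm (x - c) < \<delta>"
      using C closure_subset[of A] by (fastforce simp: dist_norm norm_minus_commute)
    then have "infnorm (x - c) \<le> \<delta>" using infnorm_le_norm[of "x - c"] by simp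
    then show "x \<in> (\<Union>c\<in>C. {x. infnorm (x - c) \<le> \<delta>})" using c by blast
  qed
  then have "\<exists>n. \<exists>C. finite C \<and> card C = n \<and> A \<subseteq> (\<Union>c\<in>C. {x. infnorm (x - c) \<le> \<delta>})"
    using C(1) by blast
  from LeastI_ex[OF this] show ?thesis unfolding covering_number_def .
qed


section \<open>The horospherical subgroup and its Haar measure\<close>

fun uni :: "form \<Rightarrow> real \<Rightarrow> real \<Rightarrow> real^4^4" where
  "uni Split r s = vector
    [vector [1, r, s, s * r],
     vector [0, 1, 0, s],
     vector [0, 0, 1, r],
     vector [0, 0, 0, 1]]"
| "uni Lorentz r s = vector
    [vector [1, r, s, (r\<^sup>2 + s\<^sup>2) / 2],
     vector [0, 1, 0, r],
     vector [0, 0, 1, s],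
     vector [0, 0, 0, 1]]"

definition uni_group :: "form \<Rightarrow> (real^4^4) set" where
  "uni_group q = {uni q r s | r s. True}"

definition uni_ball :: "form \<Rightarrow> (real^4^4) set" where
  "uni_ball q = {uni q r s | r s. \<bar>r\<bar> \<le> 1 \<and> \<bar>s\<bar> \<le> 1}"

lemma quad_form_uni: "quad_form q (uni q r s *v x) = quad_form q x"
  by (cases q) (simp_all add: matrix_vector_mult_def sum_4 power2_eq_square field_simps)

lemma uni_mult: "uni q r s ** uni q r' s' = uni q (r + r') (s + s')"
  by (cases q) (simp_all add: vec_eq_iff forall_4 matrix_matrix_mult_def sum_4
      power2_eq_square field_simps)

definition left_haar_measure_on :: "(real^4^4) set \<Rightarrow> (real^4^4) measure \<Rightarrow> bool" where
  "left_haar_measure_on G m \<longleftrightarrow>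
     sets m = sets (restrict_space borel G) \<and>
     (\<forall>g\<in>G. \<forall>X\<in>sets m. emeasure m ((**) g ` X) = emeasure m X) \<and>
     (\<forall>K. compact K \<and> K \<subseteq> G \<longrightarrow> emeasure m K < \<infinity>) \<and>
     emeasure m G \<noteq> 0"

definition haar_U :: "form \<Rightarrow> (real^4^4) measure" where
  "haar_U q = (THE m. left_haar_measure_on (uni_group q) m \<and> emeasure m (uni_ball q) = 1)"

lemma uni_coords [simp]: "uni q r s $ 1 $ 2 = r" "uni q r s $ 1 $ 3 = s"
  by (cases q; simp)+

lemma uni_inj [simp]: "uni q r s = uni q r' s' \<longleftrightarrow> r = r' \<and> s = s'"
  by (metis uni_coords)

lemma continuous_on_uni: "continuous_on S (\<lambda>p. uni q (fst p) (snd p))"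
proof -
  have "continuous_on S (\<lambda>p. uni q (fst p) (snd p) $ i $ j)" for i j :: 4
    using exhaust_4[of i] exhaust_4[of j]
    by (cases q) (auto intro!: continuous_on_fst continuous_on_snd continuous_on_id continuous_on_const
          continuous_on_add continuous_on_mult continuous_on_power continuous_on_divide)
  then show ?thesis
    by (intro continuous_on_vec_lambda[where f="\<lambda>i p. uni q (fst p) (snd p) $ i", simplified vec_lambda_eta]
         continuous_on_vec_lambda[where f="\<lambda>j p. uni q (fst p) (snd p) $ i $ j" for i, simplified vec_lambda_eta])
qed

lemma translation_invariant_lborel:
  fixes \<mu> :: "(real \<times> real) measure"
  assumes sets [measurable_cong, simp]: "sets \<mu> = sets borel"
    and "sigma_finite_measure \<mu>"
    and inv: "\<And>c. distr \<mu> borel ((+) c) = \<mu>"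
    and A [measurable]: "A \<in> sets borel" and B [measurable]: "B \<in> sets borel"
  shows "emeasure \<mu> A * emeasure lborel B = emeasure lborel A * emeasure \<mu> (uminus -` B)"
proof -
  interpret M: sigma_finite_measure \<mu> by fact
  interpret pair_sigma_finite "lborel :: (real \<times> real) measure" \<mu> ..
  have "emeasure \<mu> A * emeasure lborel B = (\<integral>\<^sup>+y. emeasure \<mu> A * indicator B y \<partial>lborel)"
    by (simp add: nn_integral_cmult)
  also have "\<dots> = (\<integral>\<^sup>+y. (\<integral>\<^sup>+x. indicator A x * indicator B y \<partial>\<mu>) \<partial>lborel)"
    by (simp add: nn_integral_multc)
  also have "\<dots> = (\<integral>\<^sup>+y. (\<integral>\<^sup>+x. indicator A x * indicator B y \<partial>distr \<mu> borel ((+) y)) \<partial>lborel)"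
    by (simp add: inv)
  also have "\<dots> = (\<integral>\<^sup>+y. (\<integral>\<^sup>+x. indicator A (y + x) * indicator B y \<partial>\<mu>) \<partial>lborel)"
    by (intro nn_integral_cong nn_integral_distr) auto
  also have "\<dots> = (\<integral>\<^sup>+x. (\<integral>\<^sup>+y. indicator A (y + x) * indicator B y \<partial>lborel) \<partial>\<mu>)"
    by (intro Fubini'[symmetric]) measurable
  also have "\<dots> = (\<integral>\<^sup>+x. (\<integral>\<^sup>+y. indicator A (y + x) * indicator B y \<partial>distr lborel borel ((+) (- x))) \<partial>\<mu>)"
    by (simp add: lborel_distr_plus)
  also have "\<dots> = (\<integral>\<^sup>+x. (\<integral>\<^sup>+y. indicator A y * indicator B (y - x) \<partial>lborel) \<partial>\<mu>)"
    by (intro nn_integral_cong, subst nn_integral_distr) auto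
  also have "\<dots> = (\<integral>\<^sup>+y. (\<integral>\<^sup>+x. indicator A y * indicator B (y - x) \<partial>\<mu>) \<partial>lborel)"
    by (intro Fubini') measurable
  also have "\<dots> = (\<integral>\<^sup>+y. (\<integral>\<^sup>+x. indicator A y * indicator B (y - x) \<partial>distr \<mu> borel ((+) y)) \<partial>lborel)"
    by (simp add: inv)
  also have "\<dots> = (\<integral>\<^sup>+y. (\<integral>\<^sup>+x. indicator A y * indicator (uminus -` B) x \<partial>\<mu>) \<partial>lborel)"
    by (intro nn_integral_cong, subst nn_integral_distr) (auto simp: indicator_def)
  also have "\<dots> = (\<integral>\<^sup>+y. indicator A y * emeasure \<mu> (uminus -` B) \<partial>lborel)"
  proof -
    have "uminus -` B \<in> sets borel"
      using measurable_sets_borel[of uminus borel B] by simp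
    then show ?thesis by (simp add: nn_integral_cmult)
  qed
  also have "\<dots> = emeasure lborel A * emeasure \<mu> (uminus -` B)"
    by (simp add: nn_integral_multc)
  finally show ?thesis .
qed

lemma mult_uni_image:
  assumes "X \<subseteq> uni_group q"
  shows "(**) (uni q a b) ` X = {y \<in> uni_group q. uni q (- a) (- b) ** y \<in> X}"
proof (intro set_eqI iffI)
  fix y assume "y \<in> (**) (uni q a b) ` X"
  then obtain x where x: "x \<in> X" "y = uni q a b ** x" by blast
  moreover obtain r s where "x = uni q r s" using assms x(1) by (auto simp: uni_group_def)
  ultimately have "uni q (- a) (- b) ** y = x" "y = uni q (a + r) (b + s)"
    by (simp_all add: uni_mult)
  then show "y \<in> {y \<in> uni_group q. uni q (- a) (- b) ** y \<in> X}"
    using x(1) by (auto simp: uni_group_def)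
next
  fix y assume y: "y \<in> {y \<in> uni_group q. uni q (- a) (- b) ** y \<in> X}"
  then have "y = uni q a b ** (uni q (- a) (- b) ** y)"
    by (auto simp: uni_group_def uni_mult)
  then show "y \<in> (**) (uni q a b) ` X" using y by blast
qed

lemma uni_ball_eq: "uni_ball q = (\<lambda>p. uni q (fst p) (snd p)) ` cbox (-1, -1) (1, 1)"
  by (auto simp: uni_ball_def image_def cbox_Pair_eq abs_le_iff)

text \<open>In the coordinates \<open>(r, s)\<close>, a normalized Haar measure is a quarter of Lebesgue measure.\<close>

definition haar_coord :: "form \<Rightarrow> (real^4^4) measure" where
  "haar_coord q = distr (scale_measure (1/4) lborel) (restrict_space borel (uni_group q))
     (\<lambda>p. uni q (fst p) (snd p))"

lemma measurable_uni [measurable]: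
  "(\<lambda>p. uni q (fst p) (snd p)) \<in> borel \<rightarrow>\<^sub>M restrict_space borel (uni_group q)"
  by (intro measurable_restrict_space2 borel_measurable_continuous_onI continuous_on_uni)
     (auto simp: uni_group_def)

lemma measurable_coords [measurable]:
  "(\<lambda>x :: real^4^4. (x$1$2, x$1$3)) \<in> borel \<rightarrow>\<^sub>M borel"
  by (intro borel_measurable_continuous_onI continuous_intros)

lemma emeasure_haar_coord:
  assumes "X \<in> sets (restrict_space borel (uni_group q))"
  shows "emeasure (haar_coord q) X = emeasure lborel {p. uni q (fst p) (snd p) \<in> X} / 4"
proof -
  have "(\<lambda>p. uni q (fst p) (snd p)) \<in>
      scale_measure (1/4) lborel \<rightarrow>\<^sub>M restrict_space borel (uni_group q)"
    using measurable_uni by (simp cong: measurable_cong_sets)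
  then show ?thesis unfolding haar_coord_def
    by (subst emeasure_distr)
       (use assms in \<open>simp_all add: vimage_def divide_ennreal_def mult.commute space_scale_measure\<close>)
qed

lemma emeasure_lborel_ball: "emeasure lborel (cbox (-1, -1) (1, 1) :: (real \<times> real) set) = 4"
  by (subst emeasure_lborel_cbox) (auto simp: Basis_prod_def prod.union_disjoint)

lemma uni_ball_sets: "uni_ball q \<in> sets (restrict_space borel (uni_group q))"
proof -
  have "compact (uni_ball q)" unfolding uni_ball_eq
    by (intro compact_continuous_image continuous_on_uni compact_cbox)
  then have "uni_ball q \<in> sets borel" by (simp add: borel_compact)
  moreover have "uni_ball q \<subseteq> uni_group q" by (auto simp: uni_ball_def uni_group_def)
  ultimately show ?thesis by (auto simp: sets_restrict_space)
qed

lemma haar_coord_haar: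
  "left_haar_measure_on (uni_group q) (haar_coord q)" "emeasure (haar_coord q) (uni_ball q) = 1"
proof -
  have "{p. uni q (fst p) (snd p) \<in> uni_ball q} = cbox (-1, -1) (1, 1)"
    by (auto simp: uni_ball_eq image_def)
  then show ball: "emeasure (haar_coord q) (uni_ball q) = 1"
    by (simp add: emeasure_haar_coord uni_ball_sets emeasure_lborel_ball)
  have sets: "sets (haar_coord q) = sets (restrict_space borel (uni_group q))"
    by (simp add: haar_coord_def)
  show "left_haar_measure_on (uni_group q) (haar_coord q)"
    unfolding left_haar_measure_on_def
  proof (intro conjI ballI allI impI)
    show "sets (haar_coord q) = sets (restrict_space borel (uni_group q))" by (fact sets)
    fix g X assume g: "g \<in> uni_group q" and X: "X \<in> sets (haar_coord q)"
    obtain a b where ab: "g = uni q a b" using g by (auto simp: uni_group_def)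
    have XU: "X \<subseteq> uni_group q" using X by (auto simp: sets sets_restrict_space)
    define P where "P = {p. uni q (fst p) (snd p) \<in> X}"
    have "P \<in> sets borel"
      using measurable_sets[OF measurable_uni X[unfolded sets]] by (simp add: P_def vimage_def)
    have pre: "{p. uni q (fst p) (snd p) \<in> (**) g ` X} = (+) (-a, -b) -` P"
      by (auto simp: ab mult_uni_image[OF XU] P_def uni_mult) (auto simp: uni_group_def)
    have im: "(**) g ` X \<in> sets (restrict_space borel (uni_group q))"
    proof -
      have "(\<lambda>y. uni q (- a) (- b) ** y) \<in>
          restrict_space borel (uni_group q) \<rightarrow>\<^sub>M restrict_space borel (uni_group q)"
      proof (intro measurable_restrict_space2)
        show "(\<lambda>y. uni q (- a) (- b) ** y) \<in> restrict_space borel (uni_group q) \<rightarrow>\<^sub>M borel"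
          by (intro measurable_restrict_space1 borel_measurable_continuous_onI
              linear_continuous_on linear_conv_bounded_linear[THEN iffD1] linearI)
             (simp_all add: matrix_add_ldistrib vec_eq_iff matrix_matrix_mult_def sum_distrib_left
                distrib_left sum.distrib ac_simps)
      next
        show "(\<lambda>y. uni q (- a) (- b) ** y) \<in> space (restrict_space borel (uni_group q)) \<rightarrow> uni_group q"
          by (auto simp: space_restrict_space uni_group_def uni_mult)
      qed
      from measurable_sets[OF this X[unfolded sets]] show ?thesis
        unfolding ab mult_uni_image[OF XU] by (simp add: vimage_def Int_def conj_commute space_restrict_space)
    qed
    have "emeasure lborel P = emeasure (distr lborel borel ((+) (-a, -b))) P"
      by (simp add: lborel_distr_plus)
    also have "\<dots> = emeasure lborel ((+) (-a, -b) -` P)"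
      using \<open>P \<in> sets borel\<close> by (subst emeasure_distr) auto
    finally show "emeasure (haar_coord q) ((**) g ` X) = emeasure (haar_coord q) X"
      using X im by (simp add: emeasure_haar_coord sets pre flip: P_def)
  next
    fix K assume K: "compact K \<and> K \<subseteq> uni_group q"
    then have KS: "K \<in> sets (restrict_space borel (uni_group q))"
      by (auto simp: sets_restrict_space borel_compact)
    have "{p. uni q (fst p) (snd p) \<in> K} = (\<lambda>x. (x$1$2, x$1$3)) ` K"
      using K by (force simp: uni_group_def image_def)
    moreover have "compact ((\<lambda>x. (x$1$2, x$1$3)) ` K)"
      by (intro compact_continuous_image continuous_intros) (use K in auto)
    ultimately have "emeasure lborel {p. uni q (fst p) (snd p) \<in> K} < \<infinity>"
      by (simp only: emeasure_bounded_finite compact_imp_bounded)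
    then show "emeasure (haar_coord q) K < \<infinity>"
      by (simp add: emeasure_haar_coord[OF KS] ennreal_divide_eq_top_iff flip: less_top)
  next
    have "emeasure (haar_coord q) (uni_ball q) \<le> emeasure (haar_coord q) (uni_group q)"
      by (intro emeasure_mono) (auto simp: uni_ball_def uni_group_def sets sets_restrict_space)
    then show "emeasure (haar_coord q) (uni_group q) \<noteq> 0" using ball by auto
  qed
qed

lemma haar_unique:
  assumes haar: "left_haar_measure_on (uni_group q) m" and ball: "emeasure m (uni_ball q) = 1"
  shows "m = haar_coord q"
proof (rule measure_eqI)
  let ?R = "restrict_space borel (uni_group q)"
  let ?f = "\<lambda>p. uni q (fst p) (snd p)" and ?g = "\<lambda>x :: real^4^4. (x$1$2, x$1$3)"
  have sets [measurable_cong]: "sets m = sets ?R"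
    using haar by (simp add: left_haar_measure_on_def)
  have space: "space m = uni_group q"
    using sets_eq_imp_space_eq[OF sets] by (simp add: space_restrict_space)
  show "sets m = sets (haar_coord q)" by (simp add: sets haar_coord_def)
  have "?g \<in> ?R \<rightarrow>\<^sub>M borel" by (intro measurable_restrict_space1 measurable_coords)
  then have g: "?g \<in> m \<rightarrow>\<^sub>M borel" by (simp add: sets cong: measurable_cong_sets)
  define \<mu> where "\<mu> = distr m borel ?g"
  have sets_\<mu>: "sets \<mu> = sets borel" and space_\<mu>: "space \<mu> = UNIV" by (simp_all add: \<mu>_def)
  have em: "emeasure \<mu> A = emeasure m (?f ` A)" if "A \<in> sets borel" for A
  proof -
    have "?g -` A \<inter> space m = ?f ` A" by (force simp: space uni_group_def image_def)
    then show ?thesis using that g by (simp add: \<mu>_def emeasure_distr)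
  qed
  have inv: "distr \<mu> borel ((+) c) = \<mu>" for c
  proof (rule measure_eqI)
    fix A assume "A \<in> sets (distr \<mu> borel ((+) c))"
    then have A: "A \<in> sets borel" by simp
    have pA: "(+) c -` A \<in> sets borel"
      using measurable_sets_borel[of "(+) c" borel A] A by simp
    have fA: "?f ` ((+) c -` A) \<in> sets m"
    proof -
      have "?f ` ((+) c -` A) = ?g -` ((+) c -` A) \<inter> space m"
        by (force simp: space uni_group_def image_def)
      then show ?thesis using measurable_sets[OF g pA] by simp
    qed
    have "?f ` A = (**) (uni q (fst c) (snd c)) ` ?f ` ((+) c -` A)"
    proof -
      have "A = (+) c ` ((+) c -` A)" by (auto intro!: image_eqI[of _ _ "_ - c"])
      then have "?f ` A = ?f ` (+) c ` ((+) c -` A)" by (rule arg_cong)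
      also have "\<dots> = (**) (uni q (fst c) (snd c)) ` ?f ` ((+) c -` A)"
        unfolding image_image by (simp add: uni_mult)
      finally show ?thesis .
    qed
    moreover have "uni q (fst c) (snd c) \<in> uni_group q" by (auto simp: uni_group_def)
    ultimately have "emeasure m (?f ` A) = emeasure m (?f ` ((+) c -` A))"
      using haar fA by (simp add: left_haar_measure_on_def)
    then show "emeasure (distr \<mu> borel ((+) c)) A = emeasure \<mu> A"
      using A pA by (simp add: em emeasure_distr sets_\<mu> space_\<mu>
          cong: measurable_cong_sets)
  qed (simp add: \<mu>_def)
  have sf: "sigma_finite_measure \<mu>"
  proof
    define C where "C n = cbox (- (real n, real n)) (real n, real n)" for n
    have fin: "emeasure \<mu> (C n) < \<infinity>" for n
    proof -
      have "compact (?f ` C n)" unfolding C_def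
        by (intro compact_continuous_image continuous_on_uni compact_cbox)
      moreover have "?f ` C n \<subseteq> uni_group q" by (auto simp: uni_group_def)
      ultimately show ?thesis using haar by (simp add: em C_def left_haar_measure_on_def)
    qed
    have "(\<Union>n. C n) = UNIV"
    proof -
      have "\<exists>n. p \<in> C n" for p
      proof -
        obtain n where "max \<bar>fst p\<bar> \<bar>snd p\<bar> \<le> real n" using real_arch_simple by blast
        then show ?thesis by (cases p) (auto simp: C_def cbox_Pair_eq intro!: exI[of _ n])
      qed
      then show ?thesis by auto
    qed
    then show "\<exists>A. countable A \<and> A \<subseteq> sets \<mu> \<and> \<Union>A = space \<mu> \<and> (\<forall>a\<in>A. emeasure \<mu> a \<noteq> \<infinity>)"
      using fin by (intro exI[of _ "range C"]) (auto simp: \<mu>_def C_def less_top)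
  qed
  fix X assume "X \<in> sets m"
  then have X: "X \<in> sets ?R" by (simp add: sets)
  define P where "P = {p. ?f p \<in> X}"
  have P: "P \<in> sets borel"
    using measurable_sets[OF measurable_uni X] by (simp add: P_def vimage_def)
  have "?f ` P = X"
  proof
    show "X \<subseteq> ?f ` P"
    proof
      fix x assume "x \<in> X"
      moreover then obtain r s where "x = uni q r s"
        using X by (auto simp: sets_restrict_space uni_group_def)
      ultimately show "x \<in> ?f ` P" by (intro image_eqI[of _ _ "(r, s)"]) (auto simp: P_def)
    qed
  qed (auto simp: P_def)
  let ?B = "cbox (-1, -1) (1, 1) :: (real \<times> real) set"
  have "uminus -` ?B = ?B" by (auto simp: cbox_Pair_eq)
  then have "emeasure \<mu> P * 4 = emeasure lborel P"
    using translation_invariant_lborel[of \<mu> P ?B] sf inv P ball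
    by (simp add: sets_\<mu> emeasure_lborel_ball em uni_ball_eq)
  then have "emeasure \<mu> P = emeasure lborel P / 4"
    using ennreal_mult_divide_eq[of 4 "emeasure \<mu> P"] by simp
  then show "emeasure m X = emeasure (haar_coord q) X"
    using em[OF P] \<open>?f ` P = X\<close> by (simp add: emeasure_haar_coord[OF X] flip: P_def)
qed

lemma haar_U_unique:
  "\<exists>!m. left_haar_measure_on (uni_group q) m \<and> emeasure m (uni_ball q) = 1"
  by (rule ex1I[of _ "haar_coord q"], intro conjI haar_coord_haar, elim conjE, rule haar_unique)

lemma haar_U_eq: "haar_U q = haar_coord q"
  unfolding haar_U_def
  by (rule the_equality, intro conjI haar_coord_haar, elim conjE, rule haar_unique)


section \<open>The exceptional set\<close>

definition exceptional_set ::
    "form \<Rightarrow> real \<Rightarrow> real \<Rightarrow> real \<Rightarrow> (real^4^4) set \<Rightarrow> (real^4^4) set" where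
  "exceptional_set q M \<epsilon> \<delta> A = {u \<in> uni_ball q. \<exists>A'\<subseteq>A.
     real (covering_number \<delta> A') \<ge> \<delta> powr \<epsilon> * real (covering_number \<delta> A) \<and>
     real (covering_number \<delta> (proj_u q 0 u ` A')) <
       \<delta> powr (M * \<epsilon>) * real (covering_number \<delta> A) powr (6/9)}"

end

theory Submission
  imports Defs "HOL-Library.Sublist" "HOL-Computational_Algebra.Polynomial"
begin

text \<open>
  Put \<open>y = x ** form_mat q\<close>. For \<open>x\<close> in the representation this is a symmetric bilinear form on
  four-space subject to one trace relation, and \<open>Ad u\<close> acts on it by congruence. The projection
  \<open>proj_u q 0 u x\<close> keeps exactly the restriction of \<open>y\<close> to the hyperplane spanned by the first three rows
  of \<open>u\<close>, a tangent hyperplane of the cone of isotropic vectors (\<open>proj_form_val\<close>). So each \<open>u\<close> gives a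
  hyperplane, and two different \<open>u\<close> give a plane, the intersection of their hyperplanes.

  The exponent \<open>6/9 = 4/6\<close> comes from two facts of linear algebra about six generic points, arranged
  in three pairs. First, the restrictions of \<open>y\<close> to the two hyperplanes of a pair determine \<open>y\<close>.
  Secondly, the restrictions of \<open>y\<close> to the three planes determine \<open>y\<close>. Let \<open>y\<close> be uniformly distributed
  on a finite set and write \<open>H\<close> for the entropy of \<open>y\<close>, \<open>h\<^sub>i\<close> for that of the restriction to the \<open>i\<close>-th
  hyperplane and \<open>g\<^sub>j\<close> for that of the restriction to the \<open>j\<close>-th plane. Submodularity and the first
  fact give \<open>H + g\<^sub>j \<le> h\<^sub>2\<^sub>j + h\<^sub>2\<^sub>j\<^sub>+\<^sub>1\<close>; subadditivity and the second fact give \<open>H \<le> g\<^sub>0 + g\<^sub>1 + g\<^sub>2\<close>. Adding these,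
  \<open>4 * H\<close> is at most the sum of the six \<open>h\<^sub>i\<close>. As \<open>h\<^sub>i\<close> is at most the logarithm of the size of the \<open>i\<close>-th
  projection, the fourth power of the size of a set is at most the product of the sizes of its six
  projections. (Three points do not suffice, although the three kernels, of dimension three each, have
  the right total dimension: their hyperplanes have a vector \<open>v\<close> in common, and all three kernels lie
  in the space of those \<open>y\<close> with \<open>y v v = 0\<close>.)

  At scale \<open>\<delta>\<close>, sets are replaced by the grid cells that they meet, and the linear algebra has to be
  quantitative. Both facts lose powers of a Gram determinant, which is a polynomial in the six
  points and is not zero at an explicit configuration (\<open>witness_pair\<close>, \<open>witness_triple\<close>). Sublevel
  sets of polynomials are small (\<open>plane_poly_sublevel\<close>). So if the exceptional set had measure larger
  than \<open>\<delta> powr \<epsilon>\<close>, a greedy choice would give about \<open>\<delta> powr (-2 * \<epsilon>)\<close> exceptional points such that the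
  determinant of any six of them is at least a fixed power of \<open>\<delta> powr \<epsilon>\<close> (\<open>generic_list\<close>). By
  pigeonhole the large subsets \<open>A'\<close> that belong to some six of these points have many cells in common
  (\<open>common_elements\<close>), and the inequality for these cells contradicts the smallness of the six
  projections if \<open>M\<close> is large (\<open>projection_count\<close>, \<open>exc_set_measure\<close>).
\<close>

section \<open>Entropy of maps on a finite set\<close>

text \<open>Concavity of the logarithm: its graph lies below the tangent at \<open>W\<close>. Every entropy inequality
  below is this lemma together with a count of fibres.\<close>

lemma sum_ln_le:
  fixes w :: "'a \<Rightarrow> real" and W :: real
  assumes "\<And>x. x \<in> S \<Longrightarrow> w x > 0" and "W > 0" and "(\<Sum>x\<in>S. w x) \<le> card S * W"
  shows "(\<Sum>x\<in>S. ln (w x)) \<le> card S * ln W"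
proof -
  have "ln (w x) \<le> w x / W - 1 + ln W" if "x \<in> S" for x
    using ln_le_minus_one[of "w x / W"] assms(1)[OF that] \<open>W > 0\<close> by (simp add: ln_div)
  then have "(\<Sum>x\<in>S. ln (w x)) \<le> (\<Sum>x\<in>S. w x / W - 1 + ln W)"
    by (rule sum_mono)
  also have "\<dots> = (\<Sum>x\<in>S. w x) / W - card S + card S * ln W"
    by (simp add: sum.distrib sum_subtractf sum_divide_distrib)
  also have "\<dots> \<le> card S * ln W"
    using assms(2,3) by (simp add: divide_simps)
  finally show ?thesis .
qed

lemma sum_compose_le:
  fixes \<phi> :: "'b \<Rightarrow> real"
  assumes "finite S" "finite T" "h ` S \<subseteq> T" and "\<And>t. t \<in> T \<Longrightarrow> \<phi> t \<ge> 0"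
    and "K > 0" "\<And>x. x \<in> S \<Longrightarrow> real (card {y \<in> S. h y = h x}) \<le> K"
  shows "(\<Sum>x\<in>S. \<phi> (h x)) \<le> K * (\<Sum>t\<in>T. \<phi> t)"
proof -
  have K: "real (card {y \<in> S. h y = t}) \<le> K" if "t \<in> h ` S" for t
    using that assms(6) by auto
  have "(\<Sum>x\<in>S. \<phi> (h x)) = (\<Sum>t\<in>h ` S. \<Sum>x\<in>{y \<in> S. h y = t}. \<phi> (h x))"
    by (rule sum.image_gen[OF assms(1)])
  also have "\<dots> = (\<Sum>t\<in>h ` S. real (card {y \<in> S. h y = t}) * \<phi> t)"
    by (intro sum.cong refl) simp
  also have "\<dots> \<le> (\<Sum>t\<in>h ` S. K * \<phi> t)"
    using K assms(3,4) by (intro sum_mono mult_right_mono) auto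
  also have "\<dots> = K * (\<Sum>t\<in>h ` S. \<phi> t)"
    by (simp add: sum_distrib_left)
  also have "\<dots> \<le> K * (\<Sum>t\<in>T. \<phi> t)"
    using assms by (intro mult_left_mono sum_mono2) auto
  finally show ?thesis .
qed

lemma sum_card_fibres:
  assumes "finite S"
  shows "(\<Sum>\<alpha>\<in>f ` S. real (card {y \<in> S. f y = \<alpha> \<and> P y})) = real (card {y \<in> S. P y})"
proof -
  have "card {y \<in> S. P y} = (\<Sum>\<alpha>\<in>f ` S. card {y \<in> {y \<in> S. P y}. f y = \<alpha>})"
    using assms by (simp only: card_eq_sum, intro sum.group[symmetric]) auto
  also have "\<dots> = (\<Sum>\<alpha>\<in>f ` S. card {y \<in> S. f y = \<alpha> \<and> P y})"
    by (intro sum.cong refl arg_cong[where f=card]) auto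
  finally show ?thesis by simp
qed

text \<open>For the uniform distribution on \<open>S\<close>, the entropy of \<open>f\<close> is the average over \<open>x\<close> of
  \<open>ln (card S / card {y \<in> S. f y = f x})\<close>. Sums over \<open>S\<close>, that is \<open>card S\<close> times the entropies, are used
  throughout. A variable has at most the entropy of the uniform distribution on its range.\<close>

lemma entropy_le_ln_card:
  assumes "finite S" "S \<noteq> {}"
  shows "(\<Sum>x\<in>S. ln (real (card S) / card {y \<in> S. f y = f x})) \<le> card S * ln (card (f ` S))"
proof (rule sum_ln_le)
  have pos: "card {y \<in> S. f y = f x} > 0" if "x \<in> S" for x
    using assms that by (auto simp: card_gt_0_iff)
  then show "real (card S) / card {y \<in> S. f y = f x} > 0" if "x \<in> S" for x
    using assms that by (simp add: card_gt_0_iff)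
  have "(\<Sum>x\<in>S. 1 / real (card {y \<in> S. f y = f x}))
      = (\<Sum>t\<in>f ` S. \<Sum>x\<in>{y \<in> S. f y = t}. 1 / real (card {y \<in> S. f y = f x}))"
    by (rule sum.image_gen[OF assms(1)])
  also have "\<dots> = (\<Sum>t\<in>f ` S. 1)"
  proof (rule sum.cong[OF refl])
    fix t assume "t \<in> f ` S"
    then have "card {y \<in> S. f y = t} > 0" using pos by force
    then show "(\<Sum>x\<in>{y \<in> S. f y = t}. 1 / real (card {y \<in> S. f y = f x})) = 1" by simp
  qed
  finally have "(\<Sum>x\<in>S. 1 / real (card {y \<in> S. f y = f x})) = card (f ` S)" by simp
  then show "(\<Sum>x\<in>S. real (card S) / real (card {y \<in> S. f y = f x})) \<le> card S * real (card (f ` S))"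
    by (simp add: sum_distrib_left flip: divide_inverse sum_distrib_left)
       (metis (no_types, lifting) mult_1_right order_refl sum.cong sum_distrib_left times_divide_eq_right)
  show "real (card (f ` S)) > 0" using assms by (simp add: card_gt_0_iff)
qed

text \<open>The conditional entropy of \<open>g\<close> given \<open>f\<close> is at most \<open>ln K\<close> if each value of \<open>f\<close> leaves
  at most \<open>K\<close> values for \<open>g\<close>. This absorbs the rounding errors: a linear map of a rounded
  vector determines the rounded image only up to boundedly many choices.\<close>

lemma entropy_refine:
  assumes "finite S" "K > 0"
    and "\<And>x. x \<in> S \<Longrightarrow> real (card (g ` {y \<in> S. f y = f x})) \<le> K"
  shows "(\<Sum>x\<in>S. ln (real (card {y \<in> S. f y = f x}) / card {y \<in> S. f y = f x \<and> g y = g x}))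
    \<le> card S * ln K"
proof (rule sum_ln_le[OF _ assms(2)])
  let ?F = "\<lambda>t. {y \<in> S. f y = t}" and ?G = "\<lambda>t s. {y \<in> S. f y = t \<and> g y = s}"
  show "real (card (?F (f x))) / card (?G (f x) (g x)) > 0" if "x \<in> S" for x
    using assms(1) that by (auto simp: card_gt_0_iff intro!: divide_pos_pos)
  have "(\<Sum>x\<in>S. real (card (?F (f x))) / card (?G (f x) (g x)))
     = (\<Sum>t\<in>f ` S. \<Sum>x\<in>?F t. real (card (?F (f x))) / card (?G (f x) (g x)))"
    by (rule sum.image_gen[OF assms(1)])
  also have "\<dots> \<le> (\<Sum>t\<in>f ` S. card (?F t) * K)"
  proof (rule sum_mono)
    fix t assume "t \<in> f ` S"
    have "(\<Sum>x\<in>?F t. real (card (?F (f x))) / card (?G (f x) (g x)))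
        = (\<Sum>x\<in>?F t. real (card (?F t)) / card (?G t (g x)))"
      by (intro sum.cong) auto
    also have "\<dots> = (\<Sum>s\<in>g ` ?F t. \<Sum>x\<in>{y \<in> ?F t. g y = s}. real (card (?F t)) / card (?G t (g x)))"
      using assms(1) by (intro sum.image_gen) simp
    also have "\<dots> = (\<Sum>s\<in>g ` ?F t. real (card (?F t)))"
    proof (rule sum.cong[OF refl])
      fix s assume "s \<in> g ` ?F t"
      then have "card (?G t s) > 0" using assms(1) by (auto simp: card_gt_0_iff)
      moreover have "{y \<in> ?F t. g y = s} = ?G t s" by auto
      ultimately show "(\<Sum>x\<in>{y \<in> ?F t. g y = s}. real (card (?F t)) / card (?G t (g x))) = card (?F t)"
        by simp
    qed
    also have "\<dots> = card (?F t) * real (card (g ` ?F t))" by simp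
    also have "\<dots> \<le> card (?F t) * K"
      using assms(3) \<open>t \<in> f ` S\<close> by (intro mult_left_mono) auto
    finally show "(\<Sum>x\<in>?F t. real (card (?F (f x))) / card (?G (f x) (g x))) \<le> card (?F t) * K" .
  qed
  also have "\<dots> = card S * K"
    using sum_card_fibres[OF assms(1), of f "\<lambda>_. True"] by (simp add: sum_distrib_right[symmetric])
  finally show "(\<Sum>x\<in>S. real (card (?F (f x))) / card (?G (f x) (g x))) \<le> card S * K" .
qed

text \<open>Submodularity, \<open>H(a, b, g) + H(g) \<le> H(a, g) + H(b, g)\<close>, where \<open>H(a, b, g)\<close> is already replaced
  by \<open>ln (card S)\<close>: as \<open>(a, b)\<close> is \<open>K\<close>-to-one, this costs \<open>ln K\<close>.\<close>

lemma entropy_submodular: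
  assumes "finite S" "K > 0"
    and "\<And>x. x \<in> S \<Longrightarrow> real (card {y \<in> S. a y = a x \<and> b y = b x}) \<le> K"
  shows "(\<Sum>x\<in>S. ln (real (card {y \<in> S. a y = a x \<and> g y = g x})
      * card {y \<in> S. b y = b x \<and> g y = g x} / card {y \<in> S. g y = g x})) \<le> card S * ln K"
proof (rule sum_ln_le[OF _ assms(2)])
  let ?A = "\<lambda>\<alpha> t. real (card {y \<in> S. a y = \<alpha> \<and> g y = t})"
  let ?B = "\<lambda>\<beta> t. real (card {y \<in> S. b y = \<beta> \<and> g y = t})"
  let ?G = "\<lambda>t. real (card {y \<in> S. g y = t})"
  show "?A (a x) (g x) * ?B (b x) (g x) / ?G (g x) > 0" if "x \<in> S" for x
    using assms(1) that by (auto simp: card_gt_0_iff intro!: divide_pos_pos mult_pos_pos)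
  define \<phi> where "\<phi> = (\<lambda>(t, \<alpha>, \<beta>). ?A \<alpha> t * ?B \<beta> t / ?G t)"
  define T where "T = g ` S \<times> a ` S \<times> b ` S"
  have "(\<Sum>x\<in>S. ?A (a x) (g x) * ?B (b x) (g x) / ?G (g x)) = (\<Sum>x\<in>S. \<phi> (g x, a x, b x))"
    by (simp add: \<phi>_def)
  also have "\<dots> \<le> K * (\<Sum>t\<in>T. \<phi> t)"
  proof (rule sum_compose_le[OF _ _ _ _ assms(2)])
    fix x assume x: "x \<in> S"
    have "real (card {y \<in> S. (g y, a y, b y) = (g x, a x, b x)})
        \<le> real (card {y \<in> S. a y = a x \<and> b y = b x})"
      using assms(1) by (intro of_nat_mono card_mono) auto
    then show "real (card {y \<in> S. (g y, a y, b y) = (g x, a x, b x)}) \<le> K"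
      using assms(3)[OF x] by linarith
  qed (use assms(1) in \<open>auto simp: T_def \<phi>_def\<close>)
  also have "(\<Sum>t\<in>T. \<phi> t) = (\<Sum>t\<in>g ` S. (\<Sum>\<alpha>\<in>a ` S. ?A \<alpha> t) * (\<Sum>\<beta>\<in>b ` S. ?B \<beta> t) / ?G t)"
    by (simp add: T_def \<phi>_def sum.cartesian_product[symmetric] sum_product sum_divide_distrib)
  also have "\<dots> = (\<Sum>t\<in>g ` S. ?G t)"
    unfolding sum_card_fibres[OF assms(1)] by (intro sum.cong refl) simp
  also have "\<dots> = card S"
    using sum_card_fibres[OF assms(1), of g "\<lambda>_. True"] by simp
  finally show "(\<Sum>x\<in>S. ?A (a x) (g x) * ?B (b x) (g x) / ?G (g x)) \<le> card S * K"
    by (simp add: mult.commute)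
qed

lemma entropy_subadditive3:
  assumes "finite S" "S \<noteq> {}" "K > 0"
    and "\<And>x. x \<in> S \<Longrightarrow> real (card {y \<in> S. f y = f x \<and> g y = g x \<and> h y = h x}) \<le> K"
  shows "(\<Sum>x\<in>S. ln (real (card {y \<in> S. f y = f x}) * card {y \<in> S. g y = g x}
      * card {y \<in> S. h y = h x})) \<le> card S * ln (K * (real (card S))\<^sup>2)"
proof (rule sum_ln_le)
  let ?F = "\<lambda>t. real (card {y \<in> S. f y = t})" and ?G = "\<lambda>t. real (card {y \<in> S. g y = t})"
    and ?H = "\<lambda>t. real (card {y \<in> S. h y = t})"
  show "?F (f x) * ?G (g x) * ?H (h x) > 0" if "x \<in> S" for x
    using assms(1) that by (auto simp: card_gt_0_iff intro!: mult_pos_pos)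
  show "K * (real (card S))\<^sup>2 > 0" using assms by (simp add: card_gt_0_iff)
  define \<phi> where "\<phi> = (\<lambda>(r, s, t). ?F r * ?G s * ?H t)"
  define T where "T = f ` S \<times> g ` S \<times> h ` S"
  have "(\<Sum>x\<in>S. ?F (f x) * ?G (g x) * ?H (h x)) = (\<Sum>x\<in>S. \<phi> (f x, g x, h x))"
    by (simp add: \<phi>_def)
  also have "\<dots> \<le> K * (\<Sum>t\<in>T. \<phi> t)"
    using assms by (intro sum_compose_le) (auto simp: T_def \<phi>_def)
  also have "(\<Sum>t\<in>T. \<phi> t) = (\<Sum>r\<in>f ` S. ?F r) * ((\<Sum>s\<in>g ` S. ?G s) * (\<Sum>t\<in>h ` S. ?H t))"
    unfolding T_def \<phi>_def sum_product
    by (simp add: sum.cartesian_product[symmetric] sum_distrib_left mult.assoc)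
  also have "\<dots> = real (card S) * card S * card S"
    using sum_card_fibres[OF assms(1), of f "\<lambda>_. True"] sum_card_fibres[OF assms(1), of g "\<lambda>_. True"]
      sum_card_fibres[OF assms(1), of h "\<lambda>_. True"] by simp
  finally show "(\<Sum>x\<in>S. ?F (f x) * ?G (g x) * ?H (h x)) \<le> card S * (K * (real (card S))\<^sup>2)"
    by (simp add: power2_eq_square algebra_simps)
qed

text \<open>The discrete form of \<open>H(x) + H(x on a plane) \<le> H(x on a hyperplane) + H(x on another hyperplane)\<close>,
  the plane being the intersection of the two hyperplanes.\<close>

lemma entropy_pair:
  assumes fin: "finite S" "S \<noteq> {}" and "K > 0"
    and ab: "\<And>x. x \<in> S \<Longrightarrow> real (card {y \<in> S. a y = a x \<and> b y = b x}) \<le> K"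
    and ga: "\<And>x. x \<in> S \<Longrightarrow> real (card (g ` {y \<in> S. a y = a x})) \<le> K"
    and gb: "\<And>x. x \<in> S \<Longrightarrow> real (card (g ` {y \<in> S. b y = b x})) \<le> K"
  shows "card S * (2 * ln (card S)) - (\<Sum>x\<in>S. ln (card {y \<in> S. g y = g x}))
    \<le> card S * (ln (card (a ` S)) + ln (card (b ` S)) + 3 * ln K)"
proof -
  let ?n = "real (card S)"
  define Na where "Na x = real (card {y \<in> S. a y = a x})" for x
  define Nb where "Nb x = real (card {y \<in> S. b y = b x})" for x
  define Ng where "Ng x = real (card {y \<in> S. g y = g x})" for x
  define Ja where "Ja x = real (card {y \<in> S. a y = a x \<and> g y = g x})" for x
  define Jb where "Jb x = real (card {y \<in> S. b y = b x \<and> g y = g x})" for x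
  note defs = Na_def[symmetric] Nb_def[symmetric] Ng_def[symmetric] Ja_def[symmetric] Jb_def[symmetric]
  have pos: "?n > 0" "Na x > 0" "Nb x > 0" "Ng x > 0" "Ja x > 0" "Jb x > 0" if "x \<in> S" for x
    using fin that by (auto simp: card_gt_0_iff Na_def Nb_def Ng_def Ja_def Jb_def)
  have split: "ln (?n / Na x) = ln ?n - ln (Na x)" "ln (?n / Nb x) = ln ?n - ln (Nb x)"
    "ln (Na x / Ja x) = ln (Na x) - ln (Ja x)" "ln (Nb x / Jb x) = ln (Nb x) - ln (Jb x)"
    "ln (Ja x * Jb x / Ng x) = ln (Ja x) + ln (Jb x) - ln (Ng x)" if "x \<in> S" for x
    using pos[OF that] by (simp_all add: ln_div ln_mult)
  have "(\<Sum>x\<in>S. ln ?n - ln (Na x)) \<le> ?n * ln (card (a ` S))"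
    using entropy_le_ln_card[OF fin, of a] by (simp add: defs split cong: sum.cong)
  moreover have "(\<Sum>x\<in>S. ln ?n - ln (Nb x)) \<le> ?n * ln (card (b ` S))"
    using entropy_le_ln_card[OF fin, of b] by (simp add: defs split cong: sum.cong)
  moreover have "(\<Sum>x\<in>S. ln (Na x) - ln (Ja x)) \<le> ?n * ln K"
    using entropy_refine[OF fin(1) \<open>K > 0\<close>, of g a, OF ga] by (simp add: defs split cong: sum.cong)
  moreover have "(\<Sum>x\<in>S. ln (Nb x) - ln (Jb x)) \<le> ?n * ln K"
    using entropy_refine[OF fin(1) \<open>K > 0\<close>, of g b, OF gb] by (simp add: defs split cong: sum.cong)
  moreover have "(\<Sum>x\<in>S. ln (Ja x) + ln (Jb x) - ln (Ng x)) \<le> ?n * ln K"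
    using entropy_submodular[OF fin(1) \<open>K > 0\<close>, of a b g, OF ab] by (simp add: defs split cong: sum.cong)
  ultimately show ?thesis
    unfolding defs by (simp add: sum.distrib sum_subtractf algebra_simps)
qed

text \<open>Write \<open>H = ln (card S)\<close> and let \<open>G j\<close> be the entropy of \<open>g j\<close>. The three instances of \<open>entropy_pair\<close> add up to
  \<open>3 * H + G 0 + G 1 + G 2\<close>, and subadditivity bounds \<open>G 0 + G 1 + G 2\<close> from below by \<open>H\<close>, up to \<open>ln K\<close>. So \<open>4 * H\<close> is
  compared with six projections; \<open>4/6\<close> is the exponent \<open>6/9\<close> of the projection theorem.\<close>

lemma card_power4_le:
  fixes a b :: "nat \<Rightarrow> 'a \<Rightarrow> 'b" and g :: "nat \<Rightarrow> 'a \<Rightarrow> 'c"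
  assumes fin: "finite S" "S \<noteq> {}" and "K > 0"
    and ab: "\<And>j x. j < 3 \<Longrightarrow> x \<in> S \<Longrightarrow> real (card {y \<in> S. a j y = a j x \<and> b j y = b j x}) \<le> K"
    and ga: "\<And>j x. j < 3 \<Longrightarrow> x \<in> S \<Longrightarrow> real (card (g j ` {y \<in> S. a j y = a j x})) \<le> K"
    and gb: "\<And>j x. j < 3 \<Longrightarrow> x \<in> S \<Longrightarrow> real (card (g j ` {y \<in> S. b j y = b j x})) \<le> K"
    and ggg: "\<And>x. x \<in> S \<Longrightarrow> real (card {y \<in> S. \<forall>j<3. g j y = g j x}) \<le> K"
  shows "real (card S) ^ 4 \<le> K ^ 10 * (\<Prod>j<3. real (card (a j ` S)) * real (card (b j ` S)))"
proof -
  let ?n = "real (card S)"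
  let ?N = "\<lambda>j x. real (card {y \<in> S. g j y = g j x})"
  define A where "A j = real (card (a j ` S))" for j
  define B where "B j = real (card (b j ` S))" for j
  have n: "?n > 0" and AB: "A j > 0" "B j > 0" for j
    using fin by (auto simp: card_gt_0_iff A_def B_def)
  have N: "?N j x > 0" if "x \<in> S" for j x
    using fin that by (auto simp: card_gt_0_iff)
  have pair: "?n * (2 * ln ?n) - (\<Sum>x\<in>S. ln (?N j x)) \<le> ?n * (ln (A j) + ln (B j) + 3 * ln K)"
    if "j < 3" for j
    using entropy_pair[OF fin \<open>K > 0\<close>, of "a j" "b j" "g j"] ab ga gb that
    by (simp add: A_def B_def)
  have three: "(\<forall>j<3. P j) \<longleftrightarrow> P 0 \<and> P 1 \<and> P 2" for P :: "nat \<Rightarrow> bool"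
    by (auto simp: less_Suc_eq numeral_3_eq_3 numeral_2_eq_2)
  have "(\<Sum>x\<in>S. ln (?N 0 x * ?N 1 x * ?N 2 x)) \<le> ?n * ln (K * ?n\<^sup>2)"
    using entropy_subadditive3[OF fin \<open>K > 0\<close>, of "g 0" "g 1" "g 2"] ggg by (simp add: three)
  also have "ln (K * ?n\<^sup>2) = ln K + 2 * ln ?n"
    using \<open>K > 0\<close> n by (simp add: ln_mult ln_realpow)
  also have "(\<Sum>x\<in>S. ln (?N 0 x * ?N 1 x * ?N 2 x)) = (\<Sum>x\<in>S. ln (?N 0 x) + ln (?N 1 x) + ln (?N 2 x))"
  proof (rule sum.cong[OF refl])
    fix x assume "x \<in> S"
    then show "ln (?N 0 x * ?N 1 x * ?N 2 x) = ln (?N 0 x) + ln (?N 1 x) + ln (?N 2 x)"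
      using N[of x 0] N[of x 1] N[of x 2] by (simp add: ln_mult)
  qed
  finally have "(\<Sum>x\<in>S. ln (?N 0 x) + ln (?N 1 x) + ln (?N 2 x)) \<le> ?n * (ln K + 2 * ln ?n)" .
  with pair[of 0] pair[of 1] pair[of 2]
  have "?n * (4 * ln ?n) \<le> ?n * (10 * ln K + (ln (A 0) + ln (B 0)) + (ln (A 1) + ln (B 1)) + (ln (A 2) + ln (B 2)))"
    by (simp add: sum.distrib algebra_simps)
  then have "4 * ln ?n \<le> 10 * ln K + (ln (A 0) + ln (B 0)) + (ln (A 1) + ln (B 1)) + (ln (A 2) + ln (B 2))"
    using n by simp
  then have "ln (?n ^ 4) \<le> ln (K ^ 10 * ((A 0 * B 0) * (A 1 * B 1) * (A 2 * B 2)))"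
    using n AB AB[THEN less_imp_neq, THEN not_sym] \<open>K > 0\<close> by (simp add: ln_mult ln_realpow)
  then have "?n ^ 4 \<le> K ^ 10 * ((A 0 * B 0) * (A 1 * B 1) * (A 2 * B 2))"
    using n AB \<open>K > 0\<close> by (subst (asm) ln_le_cancel_iff) auto
  then show ?thesis
    by (simp add: A_def B_def numeral_3_eq_3 numeral_2_eq_2 lessThan_Suc mult_ac)
qed

section \<open>Sublevel sets of polynomials\<close>

text \<open>Divide out a point \<open>t\<close> of the sublevel set: away from \<open>t\<close> the quotient is still small, whereas at
  \<open>x0\<close> it is large. So each step costs one interval and one degree. The polynomial enters only
  through its value at the reference point \<open>x0\<close>, never through its coefficients.\<close>

lemma poly_sublevel_cover:
  fixes P :: "real poly"
  assumes "degree P \<le> n" "0 < \<eta>" "\<eta> \<le> 1" "x0 \<in> {-1..1}" "\<bar>poly P x0\<bar> > (5 / \<eta>) ^ n * \<kappa>" "\<kappa> \<ge> 0"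
  shows "\<exists>C. finite C \<and> card C \<le> n \<and> {x\<in>{-1..1}. \<bar>poly P x\<bar> \<le> \<kappa>} \<subseteq> (\<Union>c\<in>C. {c - \<eta>..c + \<eta>})"
  using assms
proof (induction n arbitrary: P \<kappa>)
  case 0
  then obtain a where "P = [:a:]" using degree_eq_zeroE by blast
  then show ?case using 0 by (intro exI[of _ "{}"]) auto
next
  case (Suc n)
  let ?B = "{x\<in>{-1..1}. \<bar>poly P x\<bar> \<le> \<kappa>}"
  show ?case
  proof (cases "?B = {}")
    case True
    then show ?thesis by (intro exI[of _ "{}"]) auto
  next
    case False
    then obtain t where t: "t \<in> {-1..1}" "\<bar>poly P t\<bar> \<le> \<kappa>" by blast
    define R where "R = synthetic_div P t"
    have P: "poly P x = (x - t) * poly R x + poly P t" for x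
      using arg_cong[OF synthetic_div_correct'[of t P], of "\<lambda>p. poly p x"]
      by (simp add: R_def algebra_simps)
    have deg: "degree R \<le> n" using Suc.prems(1) by (simp add: R_def degree_synthetic_div)
    \<comment> \<open>Of the base 5, one unit absorbs the value of P at t; four are left for the factor 2 in the bound for R and for the length 2 of the interval.\<close>
    have cancel: "5 * t < a + t \<Longrightarrow> 4 * t < a" for t a :: real by simp
    have big: "\<bar>poly R x0\<bar> > (5 / \<eta>) ^ n * (2 * \<kappa> / \<eta>)"
    proof -
      have "(5 / \<eta>) ^ n * \<kappa> / \<eta> \<ge> \<kappa>"
      proof -
        have "1 \<le> (5 / \<eta>) ^ n" using Suc.prems(2,3) by (intro one_le_power) simp
        moreover have "1 \<le> 1 / \<eta>" using Suc.prems(2,3) by simp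
        ultimately have "1 * 1 \<le> (5 / \<eta>) ^ n * (1 / \<eta>)"
          using Suc.prems(2) by (intro mult_mono) auto
        then have "1 * \<kappa> \<le> (5 / \<eta>) ^ n * (1 / \<eta>) * \<kappa>" using Suc.prems(6) by (intro mult_right_mono) auto
        then show ?thesis by (simp add: mult_ac)
      qed
      have "(5 / \<eta>) ^ Suc n * \<kappa> < \<bar>poly P x0\<bar>" by fact
      also have "\<dots> \<le> \<bar>x0 - t\<bar> * \<bar>poly R x0\<bar> + \<kappa>"
        using P[of x0] t(2) by (simp add: abs_mult[symmetric])
      also have "\<dots> \<le> 2 * \<bar>poly R x0\<bar> + \<kappa>"
        using t(1) Suc.prems(4) by (intro add_right_mono mult_right_mono) auto
      also have "\<dots> \<le> 2 * \<bar>poly R x0\<bar> + (5 / \<eta>) ^ n * \<kappa> / \<eta>"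
        using \<open>(5 / \<eta>) ^ n * \<kappa> / \<eta> \<ge> \<kappa>\<close> by simp
      finally have "5 * ((5 / \<eta>) ^ n * \<kappa> / \<eta>) < 2 * \<bar>poly R x0\<bar> + (5 / \<eta>) ^ n * \<kappa> / \<eta>"
        by simp
      then have "4 * ((5 / \<eta>) ^ n * \<kappa> / \<eta>) < 2 * \<bar>poly R x0\<bar>"
        by (rule cancel)
      then show ?thesis by simp
    qed
    obtain C where C: "finite C" "card C \<le> n"
      "{x\<in>{-1..1}. \<bar>poly R x\<bar> \<le> 2 * \<kappa> / \<eta>} \<subseteq> (\<Union>c\<in>C. {c - \<eta>..c + \<eta>})"
      using Suc.IH[OF deg Suc.prems(2-4) big] Suc.prems(2,6) by auto
    have "?B \<subseteq> (\<Union>c\<in>insert t C. {c - \<eta>..c + \<eta>})"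
    proof
      fix x assume x: "x \<in> ?B"
      show "x \<in> (\<Union>c\<in>insert t C. {c - \<eta>..c + \<eta>})"
      proof (cases "\<bar>x - t\<bar> \<le> \<eta>")
        case True
        then show ?thesis by (auto simp: abs_le_iff)
      next
        case False
        have "\<eta> * \<bar>poly R x\<bar> \<le> \<bar>x - t\<bar> * \<bar>poly R x\<bar>"
          using False by (intro mult_right_mono) auto
        also have "\<dots> = \<bar>poly P x - poly P t\<bar>" using P[of x] by (simp add: abs_mult)
        also have "\<dots> \<le> 2 * \<kappa>" using x t(2) by auto
        finally have "\<bar>poly R x\<bar> \<le> 2 * \<kappa> / \<eta>" using Suc.prems(2) by (simp add: field_simps)
        then have "x \<in> (\<Union>c\<in>C. {c - \<eta>..c + \<eta>})" using C(3) x by blast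
        then show ?thesis by blast
      qed
    qed
    moreover have "card (insert t C) \<le> Suc n"
      using C(1,2) by (simp add: card_insert_if)
    ultimately show ?thesis using C(1) by (intro exI[of _ "insert t C"]) auto
  qed
qed

definition poly_fun :: "nat \<Rightarrow> (real \<Rightarrow> real) \<Rightarrow> bool" where
  "poly_fun n f \<longleftrightarrow> (\<exists>P. degree P \<le> n \<and> f = poly P)"

lemma poly_fun_sublevel:
  assumes "poly_fun n f" "0 < \<eta>" "\<eta> \<le> 1" "x0 \<in> {-1..1}" "\<bar>f x0\<bar> > (5 / \<eta>) ^ n * \<kappa>" "\<kappa> \<ge> 0"
  shows "\<exists>X \<in> sets borel. {x\<in>{-1..1}. \<bar>f x\<bar> \<le> \<kappa>} \<subseteq> X \<and> emeasure lborel X \<le> ennreal (2 * real n * \<eta>)"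
proof -
  obtain P where P: "degree P \<le> n" "f = poly P" using assms(1) by (auto simp: poly_fun_def)
  obtain C where C: "finite C" "card C \<le> n" "{x\<in>{-1..1}. \<bar>f x\<bar> \<le> \<kappa>} \<subseteq> (\<Union>c\<in>C. {c - \<eta>..c + \<eta>})"
    using poly_sublevel_cover[OF P(1) assms(2-4), of \<kappa>] assms(5,6) by (auto simp: P(2))
  have "emeasure lborel (\<Union>c\<in>C. {c - \<eta>..c + \<eta>}) \<le> (\<Sum>c\<in>C. emeasure lborel {c - \<eta>..c + \<eta>})"
    using C(1) by (intro emeasure_subadditive_finite) auto
  also have "\<dots> = ennreal (card C * (2 * \<eta>))"
    using assms(2) by (simp add: ennreal_of_nat_eq_real_of_nat ennreal_mult[symmetric])
  also have "\<dots> \<le> ennreal (2 * real n * \<eta>)"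
    using C(2) assms(2) by (intro ennreal_leI) (simp add: mult_mono)
  finally show ?thesis using C by (intro bexI[of _ "\<Union>c\<in>C. {c - \<eta>..c + \<eta>}"]) auto
qed

abbreviation square :: "(real \<times> real) set" where "square \<equiv> {-1..1} \<times> {-1..1}"

text \<open>Measurability is part of the definition because the area of a sublevel set is computed by
  integrating the lengths of its slices.\<close>

definition plane_poly :: "nat \<Rightarrow> (real \<times> real \<Rightarrow> real) \<Rightarrow> bool" where
  "plane_poly n f \<longleftrightarrow> f \<in> borel_measurable borel \<and>
     (\<forall>s. poly_fun n (\<lambda>r. f (r, s))) \<and> (\<forall>r. poly_fun n (\<lambda>s. f (r, s)))"

text \<open>Move from the reference point \<open>w\<close> one coordinate at a time: for \<open>r\<close> outside few intervals
  \<open>f (r, snd w)\<close> is still large, and then \<open>f (r, s)\<close> is large for \<open>s\<close> outside few intervals.\<close>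

lemma plane_poly_sublevel:
  assumes f: "plane_poly n f" and \<eta>: "0 < \<eta>" "\<eta> \<le> 1" and w: "w \<in> square"
    and big: "\<bar>f w\<bar> > (5 / \<eta>) ^ n * ((5 / \<eta>) ^ n * \<kappa>)" and "\<kappa> \<ge> 0"
  shows "emeasure lborel {z \<in> square. \<bar>f z\<bar> \<le> \<kappa>} \<le> ennreal (8 * real n * \<eta>)"
proof -
  let ?\<kappa>' = "(5 / \<eta>) ^ n * \<kappa>"
  let ?B = "{z \<in> square. \<bar>f z\<bar> \<le> \<kappa>}"
  have [measurable]: "f \<in> borel_measurable borel" using f by (simp add: plane_poly_def)
  have [measurable]: "(square :: (real \<times> real) set) \<in> sets borel"
    by (intro borel_closed closed_Times) auto
  have B: "?B \<in> sets borel" by measurable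
  have "?\<kappa>' \<ge> 0" using \<eta> \<open>\<kappa> \<ge> 0\<close> by simp
  obtain X where X: "X \<in> sets borel" "{r\<in>{-1..1}. \<bar>f (r, snd w)\<bar> \<le> ?\<kappa>'} \<subseteq> X"
      "emeasure lborel X \<le> ennreal (2 * real n * \<eta>)"
    using poly_fun_sublevel[of n "\<lambda>r. f (r, snd w)" \<eta> "fst w" ?\<kappa>'] f \<eta> w big \<open>?\<kappa>' \<ge> 0\<close>
    by (auto simp: plane_poly_def mem_Times_iff)
  note X(1)[measurable]
  have slice: "emeasure lborel (Pair r -` ?B) \<le> ennreal 2 * indicator X r + ennreal (2 * real n * \<eta>) * indicator {-1..1} r" for r
  proof -
    consider "r \<notin> {-1..1}" | "r \<in> {-1..1}" "r \<in> X" | "r \<in> {-1..1}" "r \<notin> X" by blast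
    then show ?thesis
    proof cases
      case 1
      then have empty: "Pair r -` ?B = {}" by auto
      show ?thesis unfolding empty by simp
    next
      case 2
      have "emeasure lborel (Pair r -` ?B) \<le> emeasure lborel {-1..1::real}"
        by (intro emeasure_mono) auto
      also have "\<dots> = ennreal 2" by simp
      finally show ?thesis using 2 by (simp add: add_increasing2 del: ennreal_numeral)
    next
      case 3
      then have "\<bar>f (r, snd w)\<bar> > ?\<kappa>'" using X(2) by force
      then obtain Y where Y: "Y \<in> sets borel" "{s\<in>{-1..1}. \<bar>f (r, s)\<bar> \<le> \<kappa>} \<subseteq> Y"
          "emeasure lborel Y \<le> ennreal (2 * real n * \<eta>)"
        using poly_fun_sublevel[of n "\<lambda>s. f (r, s)" \<eta> "snd w" \<kappa>] f \<eta> w \<open>\<kappa> \<ge> 0\<close>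
        by (auto simp: plane_poly_def mem_Times_iff)
      have "emeasure lborel (Pair r -` ?B) \<le> emeasure lborel Y"
        using Y by (intro emeasure_mono) auto
      also have "\<dots> \<le> ennreal (2 * real n * \<eta>)" by (rule Y(3))
      finally show ?thesis using 3(1) by (simp add: add_increasing)
    qed
  qed
  have "emeasure lborel ?B = (\<integral>\<^sup>+r. emeasure lborel (Pair r -` ?B) \<partial>lborel)"
    unfolding lborel_prod[symmetric] using B
    by (intro lborel.emeasure_pair_measure_alt) (simp only: sets_lborel lborel_prod)
  also have "\<dots> \<le> (\<integral>\<^sup>+r. ennreal 2 * indicator X r + ennreal (2 * real n * \<eta>) * indicator {-1..1} r \<partial>lborel)"
    by (intro nn_integral_mono slice)
  also have "\<dots> = ennreal 2 * emeasure lborel X + ennreal (2 * real n * \<eta>) * emeasure lborel {-1..1::real}"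
    by (subst nn_integral_add) (auto simp: nn_integral_cmult_indicator)
  also have "\<dots> \<le> ennreal 2 * ennreal (2 * real n * \<eta>) + ennreal (2 * real n * \<eta>) * ennreal 2"
    using X(3) by (intro add_mono mult_left_mono) auto
  also have "\<dots> = ennreal (8 * real n * \<eta>)"
    using \<eta> by (simp add: ennreal_mult[symmetric] ennreal_plus[symmetric] del: ennreal_plus ennreal_numeral)
  finally show ?thesis .
qed

text \<open>Functions of a configuration of points of the plane, polynomial in every coordinate of every
  point when the others are kept fixed.\<close>

definition multi_poly :: "nat \<Rightarrow> ((nat \<Rightarrow> real \<times> real) \<Rightarrow> real) \<Rightarrow> bool" where
  "multi_poly n D \<longleftrightarrow> (\<forall>p i. plane_poly n (\<lambda>z. D (p(i := z))))"

lemma poly_fun_const: "poly_fun n (\<lambda>_. c)"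
  by (auto simp: poly_fun_def intro!: exI[of _ "[:c:]"])

lemma poly_fun_id: "poly_fun 1 (\<lambda>x. x)"
  by (auto simp: poly_fun_def intro!: exI[of _ "[:0, 1:]"])

lemma poly_fun_add: "poly_fun m f \<Longrightarrow> poly_fun n g \<Longrightarrow> poly_fun (m + n) (\<lambda>x. f x + g x)"
  unfolding poly_fun_def
proof (elim exE conjE)
  fix P Q :: "real poly" assume "degree P \<le> m" "f = poly P" "degree Q \<le> n" "g = poly Q"
  then show "\<exists>R. degree R \<le> m + n \<and> (\<lambda>x. f x + g x) = poly R"
    using degree_add_le_max[of P Q] by (intro exI[of _ "P + Q"]) auto
qed

lemma poly_fun_mult: "poly_fun m f \<Longrightarrow> poly_fun n g \<Longrightarrow> poly_fun (m + n) (\<lambda>x. f x * g x)"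
  unfolding poly_fun_def
proof (elim exE conjE)
  fix P Q :: "real poly" assume "degree P \<le> m" "f = poly P" "degree Q \<le> n" "g = poly Q"
  then show "\<exists>R. degree R \<le> m + n \<and> (\<lambda>x. f x * g x) = poly R"
    using degree_mult_le[of P Q] by (intro exI[of _ "P * Q"]) auto
qed

definition is_poly :: "((nat \<Rightarrow> real \<times> real) \<Rightarrow> real) \<Rightarrow> bool" where
  "is_poly D \<longleftrightarrow> (\<exists>n. multi_poly n D)"

lemma plane_poly_add: "plane_poly m f \<Longrightarrow> plane_poly n g \<Longrightarrow> plane_poly (m + n) (\<lambda>z. f z + g z)"
  by (auto simp: plane_poly_def intro!: poly_fun_add)

lemma plane_poly_mult: "plane_poly m f \<Longrightarrow> plane_poly n g \<Longrightarrow> plane_poly (m + n) (\<lambda>z. f z * g z)"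
  by (auto simp: plane_poly_def intro!: poly_fun_mult)

lemma plane_poly_const: "plane_poly n (\<lambda>_. c)"
  by (simp add: plane_poly_def poly_fun_const)

lemma plane_poly_coords: "plane_poly 1 fst" "plane_poly 1 snd"
  using borel_measurable_continuous_onI[OF continuous_on_fst[OF continuous_on_id]]
    borel_measurable_continuous_onI[OF continuous_on_snd[OF continuous_on_id]]
  by (simp_all add: plane_poly_def poly_fun_const poly_fun_id[simplified])

lemma is_poly_const: "is_poly (\<lambda>_. c)"
  by (auto simp: is_poly_def multi_poly_def plane_poly_const)

lemma is_poly_coords: "is_poly (\<lambda>p. fst (p k))" "is_poly (\<lambda>p. snd (p k))"
proof -
  have "multi_poly 1 (\<lambda>p. fst (p k))" "multi_poly 1 (\<lambda>p. snd (p k))"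
    unfolding multi_poly_def
    by (intro allI, rename_tac p i, case_tac "i = k"; simp add: plane_poly_const plane_poly_coords[simplified])+
  then show "is_poly (\<lambda>p. fst (p k))" "is_poly (\<lambda>p. snd (p k))" by (auto simp: is_poly_def)
qed

lemma is_poly_add:
  assumes "is_poly D" "is_poly E" shows "is_poly (\<lambda>p. D p + E p)"
proof -
  obtain m n where "multi_poly m D" "multi_poly n E" using assms by (auto simp: is_poly_def)
  then have "multi_poly (m + n) (\<lambda>p. D p + E p)"
    by (simp add: multi_poly_def plane_poly_add)
  then show ?thesis by (auto simp: is_poly_def)
qed

lemma is_poly_mult:
  assumes "is_poly D" "is_poly E" shows "is_poly (\<lambda>p. D p * E p)"
proof -
  obtain m n where "multi_poly m D" "multi_poly n E" using assms by (auto simp: is_poly_def)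
  then have "multi_poly (m + n) (\<lambda>p. D p * E p)"
    by (simp add: multi_poly_def plane_poly_mult)
  then show ?thesis by (auto simp: is_poly_def)
qed

lemma is_poly_sum: "(\<And>a. a \<in> A \<Longrightarrow> is_poly (D a)) \<Longrightarrow> is_poly (\<lambda>p. \<Sum>a\<in>A. D a p)"
  by (induction A rule: infinite_finite_induct) (auto intro: is_poly_const is_poly_add)

lemma is_poly_prod: "(\<And>a. a \<in> A \<Longrightarrow> is_poly (D a)) \<Longrightarrow> is_poly (\<lambda>p. \<Prod>a\<in>A. D a p)"
  by (induction A rule: infinite_finite_induct) (auto intro: is_poly_const is_poly_mult)

lemma is_poly_det:
  fixes M :: "(nat \<Rightarrow> real \<times> real) \<Rightarrow> real^'n^'n"
  shows "(\<And>i j. is_poly (\<lambda>p. M p $ i $ j)) \<Longrightarrow> is_poly (\<lambda>p. det (M p))"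
  unfolding det_def by (intro is_poly_sum is_poly_mult is_poly_const is_poly_prod)

section \<open>Selecting points in general position\<close>

text \<open>The configuration that starts with the points of \<open>qs\<close>, the last element first, and continues with
  \<open>w\<close>. The order is reversed because the list of selected points grows at its head.\<close>

definition overwrite :: "(nat \<Rightarrow> 'a) \<Rightarrow> 'a list \<Rightarrow> nat \<Rightarrow> 'a" where
  "overwrite w qs k = (if k < length qs then rev qs ! k else w k)"

lemma overwrite_Cons: "overwrite w (z # qs) = (overwrite w qs)(length qs := z)"
  by (auto simp: overwrite_def nth_append fun_eq_iff less_Suc_eq)

text \<open>Greedy selection. The value \<open>\<bar>D w\<bar>\<close> at the reference configuration is large; replacing the points of
  \<open>w\<close> one after the other by selected points loses a fixed factor each time. For each short
  subsequence of the points selected so far, the next point has to avoid one sublevel set, and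
  there are at most \<open>\<Sum>i\<le>m. N ^ i\<close> such sets, which together cannot contain \<open>E\<close>. Only Borel
  supersets of \<open>E\<close> are measured, so \<open>E\<close> itself is arbitrary.\<close>

lemma generic_list:
  assumes D: "multi_poly n D" and w: "\<And>i. w i \<in> square" and \<eta>: "0 < \<eta>" "\<eta> \<le> 1" and "D w \<noteq> 0"
    and E: "E \<subseteq> square"
    and big: "\<And>B. B \<in> sets borel \<Longrightarrow> E \<subseteq> B \<Longrightarrow>
        emeasure lborel B > ennreal (real (\<Sum>i\<le>m. N ^ i) * (8 * real n * \<eta>))"
  defines "\<kappa> \<equiv> \<lambda>j. \<bar>D w\<bar> * (1 / (2 * ((5 / \<eta>) ^ n)\<^sup>2)) ^ j"
  shows "\<exists>L. length L = N \<and> set L \<subseteq> E \<and>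
    (\<forall>qs. subseq qs L \<and> length qs \<le> Suc m \<longrightarrow> \<kappa> (length qs) \<le> \<bar>D (overwrite w qs)\<bar>)"
proof -
  let ?K = "(5 / \<eta>) ^ n"
  have K: "?K > 0" using \<eta> by simp
  have \<kappa>: "\<kappa> j > 0" "?K * (?K * \<kappa> (Suc j)) = \<kappa> j / 2" for j
    using K \<eta> \<open>D w \<noteq> 0\<close> by (simp_all add: \<kappa>_def power2_eq_square)
  have "\<exists>L. length L = k \<and> set L \<subseteq> E \<and>
    (\<forall>qs. subseq qs L \<and> length qs \<le> Suc m \<longrightarrow> \<kappa> (length qs) \<le> \<bar>D (overwrite w qs)\<bar>)"
    if "k \<le> N" for k
    using that
  proof (induction k)
    case 0
    show ?case by (intro exI[of _ "[]"]) (auto simp: \<kappa>_def overwrite_def dest!: list_emb_Nil2)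
  next
    case (Suc k)
    then obtain L where L: "length L = k" "set L \<subseteq> E"
      "\<And>qs. subseq qs L \<Longrightarrow> length qs \<le> Suc m \<Longrightarrow> \<kappa> (length qs) \<le> \<bar>D (overwrite w qs)\<bar>"
      by auto
    define lists where "lists = {qs. set qs \<subseteq> set L \<and> length qs \<le> m}"
    define Q where "Q = {qs \<in> lists. \<kappa> (length qs) \<le> \<bar>D (overwrite w qs)\<bar>}"
    define bad where "bad qs = {z \<in> square. \<bar>D ((overwrite w qs)(length qs := z))\<bar> \<le> \<kappa> (Suc (length qs))}" for qs
    have "card (set L) \<le> N" using Suc.prems L(1) card_length[of L] by simp
    then have "card lists \<le> (\<Sum>i\<le>m. N ^ i)"
      unfolding lists_def by (subst card_lists_length_le) (auto intro!: sum_mono power_mono)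
    moreover have "finite lists" unfolding lists_def by (rule finite_lists_length_le) simp
    ultimately have Q: "finite Q" "card Q \<le> (\<Sum>i\<le>m. N ^ i)"
      by (auto simp: Q_def intro: order_trans[OF card_mono])
    have bad: "bad qs \<in> sets borel" "emeasure lborel (bad qs) \<le> ennreal (8 * real n * \<eta>)" if "qs \<in> Q" for qs
    proof -
      let ?f = "\<lambda>z. D ((overwrite w qs)(length qs := z))"
      have f: "plane_poly n ?f" using D by (simp add: multi_poly_def)
      then have [measurable]: "?f \<in> borel_measurable borel" by (simp add: plane_poly_def)
      have [measurable]: "(square :: (real \<times> real) set) \<in> sets borel"
        by (intro borel_closed closed_Times) auto
      show "bad qs \<in> sets borel" unfolding bad_def by measurable
      \<comment> \<open>The next point of w is a reference point of the sublevel set, with a value that is large by induction.\<close>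
      have "?f (w (length qs)) = D (overwrite w qs)"
        by (rule arg_cong[where f=D]) (auto simp: overwrite_def)
      then have "\<bar>?f (w (length qs))\<bar> > ?K * (?K * \<kappa> (Suc (length qs)))"
        using that \<kappa>[of "length qs"] by (simp add: Q_def)
      then show "emeasure lborel (bad qs) \<le> ennreal (8 * real n * \<eta>)"
        unfolding bad_def using f \<eta> w \<kappa>(1)[of "Suc (length qs)"] by (intro plane_poly_sublevel) auto
    qed
    have "emeasure lborel (\<Union>qs\<in>Q. bad qs) \<le> (\<Sum>qs\<in>Q. emeasure lborel (bad qs))"
      using bad Q by (intro emeasure_subadditive_finite) auto
    also have "\<dots> \<le> (\<Sum>qs\<in>Q. ennreal (8 * real n * \<eta>))" by (intro sum_mono bad)
    also have "\<dots> = ennreal (real (card Q) * (8 * real n * \<eta>))"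
      using \<eta> by (simp add: ennreal_of_nat_eq_real_of_nat ennreal_mult)
    also have "\<dots> \<le> ennreal (real (\<Sum>i\<le>m. N ^ i) * (8 * real n * \<eta>))"
      using Q(2) \<eta> by (intro ennreal_leI mult_right_mono of_nat_mono) auto
    finally have "\<not> E \<subseteq> (\<Union>qs\<in>Q. bad qs)"
      using big[of "\<Union>qs\<in>Q. bad qs"] Q(1) bad(1) by (meson leD sets.finite_UN)
    then obtain z where z: "z \<in> E" "\<And>qs. qs \<in> Q \<Longrightarrow> z \<notin> bad qs" by blast
    have "\<kappa> (length qs) \<le> \<bar>D (overwrite w qs)\<bar>" if "subseq qs (z # L)" "length qs \<le> Suc m" for qs
    proof (cases "subseq qs L")
      case True
      then show ?thesis using L(3) that(2) by blast
    next
      case False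
      with that(1) obtain rs where rs: "qs = z # rs" "subseq rs L"
        by (auto elim!: list_emb.cases[where ?a1.0 = qs])
      have "set rs \<subseteq> set L" using rs(2) by (auto dest: list_emb_set)
      then have "rs \<in> Q" using rs that(2) L(3)[of rs] by (simp add: Q_def lists_def)
      then have "z \<notin> bad rs" by (rule z)
      then show ?thesis using z(1) E by (auto simp: bad_def rs(1) overwrite_Cons)
    qed
    then show ?case using L z(1) by (intro exI[of _ "z # L"]) auto
  qed
  then show ?thesis by blast
qed

text \<open>Double counting and pigeonhole: an average element of \<open>S\<close> lies in at least \<open>\<theta> * length L \<ge> 2 * k\<close> of the sets, so
  a proportion \<open>\<theta> / 2\<close> of the elements lies in at least \<open>k\<close> of them. Each of these elements chooses a
  \<open>k\<close>-element subsequence of \<open>L\<close>, and a most popular choice is the answer.\<close>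

lemma common_elements:
  fixes L :: "'p list" and T :: "'p \<Rightarrow> 'c set" and \<theta> :: real
  assumes "finite S" "S \<noteq> {}" "\<theta> > 0" and T: "\<And>u. u \<in> set L \<Longrightarrow> T u \<subseteq> S \<and> \<theta> * card S \<le> card (T u)"
    and long: "2 * real k \<le> length L * \<theta>" and "0 < k"
  shows "\<exists>qs. subseq qs L \<and> length qs = k \<and>
    \<theta> / 2 * card S \<le> real (length L ^ k) * card {c \<in> S. \<forall>u\<in>set qs. c \<in> T u}"
proof -
  let ?N = "length L"
  define f where "f c = filter (\<lambda>u. c \<in> T u) L" for c
  define G where "G = {c \<in> S. k \<le> length (f c)}"
  have G: "finite G" "G \<subseteq> S" using assms(1) by (auto simp: G_def)
  have N: "?N > 0" using long \<open>0 < k\<close> by (cases L) auto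
  have count: "(\<Sum>c\<in>S. length (filter (\<lambda>u. c \<in> T u) L')) = (\<Sum>u\<leftarrow>L'. card (T u))"
    if "\<And>u. u \<in> set L' \<Longrightarrow> T u \<subseteq> S" for L'
    using that
  proof (induction L')
    case (Cons u L')
    have "(\<Sum>c\<in>S. length (filter (\<lambda>u. c \<in> T u) (u # L')))
        = (\<Sum>c\<in>S. (if c \<in> T u then 1 else 0) + length (filter (\<lambda>u. c \<in> T u) L'))"
      by (intro sum.cong) auto
    also have "\<dots> = card (S \<inter> T u) + (\<Sum>c\<in>S. length (filter (\<lambda>u. c \<in> T u) L'))"
      using assms(1) by (simp add: sum.distrib sum.If_cases Int_def)
    also have "S \<inter> T u = T u" using Cons.prems by auto
    finally show ?case using Cons by simp
  qed simp
  have real_sum_list: "(\<Sum>u\<leftarrow>L'. real (card (T u))) = real (\<Sum>u\<leftarrow>L'. card (T u))" for L'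
    by (induction L') auto
  have "real ?N * (\<theta> * card S) = (\<Sum>u\<leftarrow>L. \<theta> * card S)" by (simp add: sum_list_triv)
  also have "\<dots> \<le> (\<Sum>u\<leftarrow>L. real (card (T u)))" using T by (intro sum_list_mono) auto
  also have "\<dots> = real (\<Sum>c\<in>S. length (f c))"
    using count[of L] T real_sum_list[of L] by (simp add: f_def)
  also have "\<dots> = (\<Sum>c\<in>S. real (length (f c)))" by simp
  also have "\<dots> \<le> (\<Sum>c\<in>S. (if c \<in> G then real ?N else 0) + k)"
    by (intro sum_mono) (auto simp: G_def f_def add_increasing2)
  also have "\<dots> = real ?N * card G + real k * card S"
    using assms(1) G by (simp add: sum.distrib sum.If_cases inf.absorb2 inf.absorb1)
  also have "real k * card S \<le> ?N * \<theta> / 2 * card S"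
    using long by (intro mult_right_mono) auto
  finally have "real ?N * (\<theta> / 2 * card S) \<le> real ?N * card G"
    by (simp add: algebra_simps)
  then have cardG: "\<theta> / 2 * card S \<le> card G" using N by simp
  define Q where "Q = {qs. set qs \<subseteq> set L \<and> length qs = k}"
  have Q: "finite Q" "card Q \<le> ?N ^ k"
    using card_lists_length_eq[of "set L" k] finite_lists_length_eq[of "set L" k]
    by (auto simp: Q_def card_length power_mono)
  have sub: "subseq (take k (f c)) L" for c
    unfolding f_def by (rule subseq_order.trans[OF prefix_imp_subseq[OF take_is_prefix] subseq_filter_left])
  have "(\<lambda>c. take k (f c)) ` G \<subseteq> Q"
    by (auto simp: Q_def G_def f_def dest!: in_set_takeD)
  define R where "R qs = {c \<in> G. take k (f c) = qs}" for qs
  have False: "G \<noteq> {}"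
    using cardG assms(1-3) by (auto simp: mult_le_0_iff)
  have "card G = (\<Sum>qs\<in>(\<lambda>c. take k (f c)) ` G. card (R qs))"
    unfolding R_def card_eq_sum using G by (intro sum.image_gen)
  also have "\<dots> \<le> (\<Sum>qs\<in>(\<lambda>c. take k (f c)) ` G. Max (card ` R ` (\<lambda>c. take k (f c)) ` G))"
    using G by (intro sum_mono Max_ge) auto
  also have "\<dots> \<le> ?N ^ k * Max (card ` R ` (\<lambda>c. take k (f c)) ` G)"
    using Q card_mono[OF Q(1) \<open>_ ` G \<subseteq> Q\<close>] by simp
  finally have "card G \<le> ?N ^ k * Max (card ` R ` (\<lambda>c. take k (f c)) ` G)" .
  moreover have "Max (card ` R ` (\<lambda>c. take k (f c)) ` G) \<in> card ` R ` (\<lambda>c. take k (f c)) ` G"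
    using G False by (intro Max_in) auto
  ultimately obtain c0 where c0: "c0 \<in> G" "card G \<le> ?N ^ k * card (R (take k (f c0)))"
    by auto
  let ?qs = "take k (f c0)"
  have "R ?qs \<subseteq> {c \<in> S. \<forall>u\<in>set ?qs. c \<in> T u}"
  proof
    fix c assume "c \<in> R ?qs"
    then have "c \<in> G" "?qs = take k (f c)" by (auto simp: R_def)
    then show "c \<in> {c \<in> S. \<forall>u\<in>set ?qs. c \<in> T u}"
      using G by (auto simp: f_def dest!: in_set_takeD)
  qed
  then have "card (R ?qs) \<le> card {c \<in> S. \<forall>u\<in>set ?qs. c \<in> T u}"
    using assms(1) by (intro card_mono) auto
  then have "card G \<le> ?N ^ k * card {c \<in> S. \<forall>u\<in>set ?qs. c \<in> T u}"
    using c0(2) by (meson mult_le_mono2 order_trans)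
  then have "real (card G) \<le> real (?N ^ k * card {c \<in> S. \<forall>u\<in>set ?qs. c \<in> T u})"
    by (rule of_nat_mono)
  then have "real (card G) \<le> real (?N ^ k) * card {c \<in> S. \<forall>u\<in>set ?qs. c \<in> T u}"
    by simp
  then show ?thesis
    using sub c0(1) cardG by (intro exI[of _ ?qs]) (auto simp: G_def)
qed

section \<open>Quantitative injectivity through Gram determinants\<close>

text \<open>The Gram matrix of a family of linear functionals: it is invertible exactly if they separate
  points, and its determinant is a polynomial in their coefficients.\<close>

definition gram :: "'k set \<Rightarrow> ('k \<Rightarrow> real^'n) \<Rightarrow> real^'n^'n" where
  "gram K \<Phi> = (\<chi> i j. \<Sum>k\<in>K. \<Phi> k $ i * \<Phi> k $ j)"

lemma gram_mult_vector: "(gram K \<Phi> *v x) $ i = (\<Sum>k\<in>K. \<Phi> k $ i * (\<Phi> k \<bullet> x))"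
proof -
  have "(gram K \<Phi> *v x) $ i = (\<Sum>j\<in>UNIV. \<Sum>k\<in>K. \<Phi> k $ i * (\<Phi> k $ j * x $ j))"
    by (simp add: gram_def matrix_vector_mult_def sum_distrib_right mult.assoc)
  also have "\<dots> = (\<Sum>k\<in>K. \<Sum>j\<in>UNIV. \<Phi> k $ i * (\<Phi> k $ j * x $ j))" by (rule sum.swap)
  finally show ?thesis by (simp add: inner_vec_def sum_distrib_left)
qed

lemma det_gram_nonzero:
  assumes "finite K" and inj: "\<And>x. (\<And>k. k \<in> K \<Longrightarrow> \<Phi> k \<bullet> x = 0) \<Longrightarrow> x = 0"
  shows "det (gram K \<Phi>) \<noteq> 0"
proof -
  have "x = 0" if "gram K \<Phi> *v x = 0" for x
  proof (rule inj)
    have "0 = (\<Sum>i\<in>UNIV. x $ i * (gram K \<Phi> *v x) $ i)" using that by simp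
    also have "\<dots> = (\<Sum>i\<in>UNIV. \<Sum>k\<in>K. (\<Phi> k \<bullet> x) * (\<Phi> k $ i * x $ i))"
      by (simp add: gram_mult_vector sum_distrib_left mult_ac)
    also have "\<dots> = (\<Sum>k\<in>K. \<Sum>i\<in>UNIV. (\<Phi> k \<bullet> x) * (\<Phi> k $ i * x $ i))" by (rule sum.swap)
    also have "\<dots> = (\<Sum>k\<in>K. (\<Phi> k \<bullet> x)\<^sup>2)"
      by (simp add: inner_vec_def power2_eq_square sum_distrib_left)
    finally have "(\<Sum>k\<in>K. (\<Phi> k \<bullet> x)\<^sup>2) = 0" by simp
    then show "\<Phi> k \<bullet> x = 0" if "k \<in> K" for k
      using that \<open>finite K\<close> by (subst (asm) sum_nonneg_eq_0_iff) auto
  qed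
  then have "invertible (gram K \<Phi>)"
    using matrix_left_invertible_ker[of "gram K \<Phi>"] invertible_left_inverse[of "gram K \<Phi>"] by blast
  then show ?thesis by (simp add: invertible_det_nz)
qed

lemma abs_det_le:
  fixes A :: "real^'n^'n"
  assumes "\<And>i j. \<bar>A $ i $ j\<bar> \<le> R"
  shows "\<bar>det A\<bar> \<le> fact CARD('n) * R ^ CARD('n)"
proof -
  have "\<bar>det A\<bar> \<le> (\<Sum>p\<in>{p. p permutes (UNIV :: 'n set)}. \<bar>of_int (sign p) * (\<Prod>i\<in>UNIV. A $ i $ p i)\<bar>)"
    unfolding det_def by (rule sum_abs)
  also have "\<dots> \<le> (\<Sum>p\<in>{p. p permutes (UNIV :: 'n set)}. R ^ CARD('n))"
  proof (rule sum_mono)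
    fix p :: "'n \<Rightarrow> 'n"
    have "(\<Prod>i\<in>UNIV. \<bar>A $ i $ p i\<bar>) \<le> (\<Prod>i\<in>(UNIV :: 'n set). R)"
      using assms by (intro prod_mono) auto
    then show "\<bar>of_int (sign p) * (\<Prod>i\<in>UNIV. A $ i $ p i)\<bar> \<le> R ^ CARD('n)"
      by (simp add: abs_mult abs_prod sign_def)
  qed
  also have "\<dots> = fact CARD('n) * R ^ CARD('n)"
    by (simp add: card_permutations[of "UNIV :: 'n set"])
  finally show ?thesis .
qed

text \<open>By Cramer's rule, the determinant of the Gram matrix times a coordinate of \<open>x\<close> is the determinant
  of a matrix whose entries are controlled by the values of the functionals at \<open>x\<close>.\<close>

lemma gram_bound:
  fixes \<Phi> :: "'k \<Rightarrow> real^'n" and C \<beta> :: real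
  assumes C: "\<And>k i. k \<in> K \<Longrightarrow> \<bar>\<Phi> k $ i\<bar> \<le> C" "1 \<le> C"
    and \<beta>: "\<And>k. k \<in> K \<Longrightarrow> \<bar>\<Phi> k \<bullet> x\<bar> \<le> \<beta>" "0 < \<beta>"
  shows "\<bar>x $ l\<bar> * \<bar>det (gram K \<Phi>)\<bar> \<le> fact CARD('n) * (card K * C\<^sup>2) ^ CARD('n) * \<beta>"
    and "\<bar>det (gram K \<Phi>)\<bar> \<le> fact CARD('n) * (card K * C\<^sup>2) ^ CARD('n)"
proof -
  \<comment> \<open>Rescaling x makes all entries of the matrix of Cramer's rule comparable.\<close>
  define y where "y = (1 / \<beta>) *\<^sub>R x"
  have le: "\<bar>\<Sum>k\<in>K. f k\<bar> \<le> card K * C\<^sup>2" if "\<And>k. k \<in> K \<Longrightarrow> \<bar>f k\<bar> \<le> C * C" for f :: "'k \<Rightarrow> real"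
    using sum_bounded_above[of K "\<lambda>k. \<bar>f k\<bar>" "C * C"] that
    by (intro order_trans[OF sum_abs]) (simp add: power2_eq_square)
  have G: "\<bar>gram K \<Phi> $ i $ j\<bar> \<le> card K * C\<^sup>2" for i j
    unfolding gram_def using C by (simp, intro le) (auto simp: abs_mult intro!: mult_mono)
  then show "\<bar>det (gram K \<Phi>)\<bar> \<le> fact CARD('n) * (card K * C\<^sup>2) ^ CARD('n)" by (rule abs_det_le)
  have y: "\<bar>(gram K \<Phi> *v y) $ i\<bar> \<le> card K * C\<^sup>2" for i
    unfolding gram_mult_vector
  proof (rule le)
    fix k assume "k \<in> K"
    have "\<bar>\<Phi> k \<bullet> y\<bar> \<le> 1" using \<beta>(1)[OF \<open>k \<in> K\<close>] \<beta>(2) by (simp add: y_def abs_mult)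
    then show "\<bar>\<Phi> k $ i * (\<Phi> k \<bullet> y)\<bar> \<le> C * C"
      using C(1)[OF \<open>k \<in> K\<close>] C(2) by (simp add: abs_mult) (intro mult_mono; simp)
  qed
  have "\<bar>det (\<chi> i j. if j = l then (gram K \<Phi> *v y) $ i else gram K \<Phi> $ i $ j)\<bar>
      \<le> fact CARD('n) * (card K * C\<^sup>2) ^ CARD('n)"
    by (rule abs_det_le) (use G y in auto)
  then have "\<bar>y $ l * det (gram K \<Phi>)\<bar> \<le> fact CARD('n) * (card K * C\<^sup>2) ^ CARD('n)"
    by (simp add: cramer_lemma)
  then show "\<bar>x $ l\<bar> * \<bar>det (gram K \<Phi>)\<bar> \<le> fact CARD('n) * (card K * C\<^sup>2) ^ CARD('n) * \<beta>"
    using \<beta>(2) by (simp add: y_def abs_mult field_simps)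
qed

text \<open>The value of the bilinear form with matrix \<open>x ** form_mat q\<close>, which is symmetric for \<open>x \<in> rep q\<close>.\<close>

definition form_val :: "form \<Rightarrow> real^4 \<Rightarrow> real^4 \<Rightarrow> real^4^4 \<Rightarrow> real" where
  "form_val q v w x = v \<bullet> ((x ** form_mat q) *v w)"

lemma transpose_form_mat: "transpose (form_mat q) = form_mat q"
  by (cases q) (simp_all add: form_mat_Split form_mat_Lorentz transpose_def vec_eq_iff forall_4)

text \<open>In terms of \<open>y = x ** form_mat q\<close> the representation is the space of symmetric bilinear forms \<open>y\<close>
  that satisfy the one linear relation \<open>trace x = 0\<close>.\<close>

lemma rep_iff: "x \<in> rep q \<longleftrightarrow> trace x = 0 \<and> transpose (x ** form_mat q) = x ** form_mat q"
proof -
  let ?Q = "form_mat q"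
  have Q: "matrix_inv ?Q ** ?Q = mat 1" "?Q ** matrix_inv ?Q = mat 1"
    using someI_ex[OF invertible_form_mat[unfolded invertible_def], of q]
    by (auto simp: matrix_inv_def)
  have "?Q ** transpose x ** matrix_inv ?Q = x \<longleftrightarrow> ?Q ** transpose x = x ** ?Q"
  proof
    assume "?Q ** transpose x ** matrix_inv ?Q = x"
    then have "x ** ?Q = ?Q ** transpose x ** (matrix_inv ?Q ** ?Q)" by (simp only: matrix_mul_assoc)
    then show "?Q ** transpose x = x ** ?Q" by (simp add: Q)
  next
    assume "?Q ** transpose x = x ** ?Q"
    then have "?Q ** transpose x ** matrix_inv ?Q = x ** (?Q ** matrix_inv ?Q)" by (simp only: matrix_mul_assoc)
    then show "?Q ** transpose x ** matrix_inv ?Q = x" by (simp add: Q)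
  qed
  then show ?thesis by (simp add: rep_def matrix_transpose_mul transpose_form_mat)
qed

lemma form_val_axis: "form_val q (axis a 1) (axis b 1) x = (x ** form_mat q) $ a $ b"
  by (simp add: form_val_def inner_axis' matrix_vector_mult_basis column_def)

lemma matrix_diff_rdistrib: "(A - B) ** C = A ** C - B ** C" for A B :: "real^'n^'m"
  by (simp add: vec_eq_iff matrix_matrix_mult_def left_diff_distrib sum_subtractf)

lemma form_val_linear:
  "form_val q (v + v') w x = form_val q v w x + form_val q v' w x"
  "form_val q v (w + w') x = form_val q v w x + form_val q v w' x"
  "form_val q (c *\<^sub>R v) w x = c * form_val q v w x"
  "form_val q v (c *\<^sub>R w) x = c * form_val q v w x"
  "form_val q v w (x - y) = form_val q v w x - form_val q v w y"
  by (simp_all add: form_val_def inner_add_left matrix_diff_rdistrib matrix_vector_right_distrib inner_add_right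
      matrix_vector_mult_scaleR matrix_vector_mult_diff_distrib matrix_vector_mult_diff_rdistrib inner_diff_right)

definition flat :: "real^4^4 \<Rightarrow> real^(4 \<times> 4)" where
  "flat x = (\<chi> ij. x $ fst ij $ snd ij)"

definition form_vec :: "form \<Rightarrow> real^4 \<Rightarrow> real^4 \<Rightarrow> real^(4 \<times> 4)" where
  "form_vec q v w = (\<chi> ij. v $ fst ij * (form_mat q *v w) $ snd ij)"

lemma inner_flat: "f \<bullet> flat x = (\<Sum>i\<in>UNIV. \<Sum>j\<in>UNIV. f $ (i, j) * x $ i $ j)"
  by (simp add: inner_vec_def flat_def sum.cartesian_product UNIV_Times_UNIV[symmetric] case_prod_beta
      del: UNIV_Times_UNIV)

lemma form_vec_inner: "form_vec q v w \<bullet> flat x = form_val q v w x"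
  unfolding inner_flat form_val_def matrix_vector_mul_assoc[symmetric]
  by (simp add: inner_vec_def matrix_vector_mult_def[of x] form_vec_def sum_distrib_left mult_ac)

text \<open>The functionals with indices 0 and 1 cut out \<open>rep q\<close> in the space of all matrices; the others are
  the values on the vectors of the frames \<open>F 0, F 1, ...\<close>. Thus a frame family determines the
  elements of \<open>rep q\<close> if and only if all functionals together separate matrices.\<close>

fun functional :: "form \<Rightarrow> (nat \<Rightarrow> 4 \<Rightarrow> real^4) \<Rightarrow> nat \<times> 4 \<times> 4 \<Rightarrow> real^(4 \<times> 4)" where
  "functional q F (0, a, b) = form_vec q (axis a 1) (axis b 1) - form_vec q (axis b 1) (axis a 1)"
| "functional q F (Suc 0, a, b) = (\<chi> ij. if fst ij = snd ij then 1 else 0)"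
| "functional q F (Suc (Suc k), a, b) = form_vec q (F k a) (F k b)"

definition frame_det :: "form \<Rightarrow> nat \<Rightarrow> (nat \<Rightarrow> 4 \<Rightarrow> real^4) \<Rightarrow> real" where
  "frame_det q m F = det (gram ({..<m + 2} \<times> UNIV) (functional q F))"

lemma functional_trace: "(\<chi> ij. if fst ij = snd ij then 1 else 0) \<bullet> flat x = trace x"
  by (simp add: inner_flat trace_def if_distrib[where f="\<lambda>c. c * _"] cong: if_cong)

lemma frame_det_nonzero:
  assumes "\<And>x. x \<in> rep q \<Longrightarrow> (\<And>k a b. k < m \<Longrightarrow> form_val q (F k a) (F k b) x = 0) \<Longrightarrow> x = 0"
  shows "frame_det q m F \<noteq> 0"
  unfolding frame_det_def
proof (rule det_gram_nonzero)
  fix z assume z: "\<And>k. k \<in> {..<m + 2} \<times> UNIV \<Longrightarrow> functional q F k \<bullet> z = 0"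
  define x where "x = (\<chi> i j. z $ (i, j))"
  have flat: "z = flat x" by (simp add: x_def flat_def vec_eq_iff)
  have "trace x = 0"
    using z[of "(1, _, _)"] by (simp add: flat functional_trace)
  moreover have "transpose (x ** form_mat q) = x ** form_mat q"
    using z[of "(0, _, _)"]
    by (simp add: flat inner_diff_left form_vec_inner form_val_axis transpose_def vec_eq_iff)
  ultimately have "x \<in> rep q" by (simp add: rep_iff)
  moreover have "form_val q (F k a) (F k b) x = 0" if "k < m" for k a b
    using z[of "(Suc (Suc k), a, b)"] that by (simp add: flat form_vec_inner)
  ultimately have "x = 0" by (rule assms)
  then show "z = 0" by (simp add: flat flat_def vec_eq_iff)
qed simp

lemma abs_form_mat_mult_le:
  assumes "\<And>i. \<bar>w $ i\<bar> \<le> c"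
  shows "\<bar>(form_mat q *v w) $ j\<bar> \<le> c"
proof -
  have "c \<ge> 0" using assms[of 1] by linarith
  then show ?thesis
    using assms[of 1] assms[of 2] assms[of 3] assms[of 4] exhaust_4[of j]
    by (cases q) (auto simp: form_mat_Split form_mat_Lorentz matrix_vector_mult_def sum_4)
qed

lemma form_val_bound:
  assumes v: "\<And>i. \<bar>v $ i\<bar> \<le> 1" and w: "\<And>i. \<bar>w $ i\<bar> \<le> 1" and x: "\<And>i j. \<bar>x $ i $ j\<bar> \<le> \<beta>"
  shows "\<bar>form_val q v w x\<bar> \<le> 16 * \<beta>"
proof -
  let ?w = "form_mat q *v w"
  have w': "\<bar>?w $ j\<bar> \<le> 1" for j by (rule abs_form_mat_mult_le[OF w])
  have "\<beta> \<ge> 0" using x[of 1 1] by linarith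
  have eq: "form_val q v w x = (\<Sum>i\<in>UNIV. \<Sum>j\<in>UNIV. v $ i * (x $ i $ j * ?w $ j))"
    unfolding form_val_def matrix_vector_mul_assoc[symmetric]
    by (simp add: inner_vec_def matrix_vector_mult_def[of x] sum_distrib_left)
  have "\<bar>v $ i * (x $ i $ j * ?w $ j)\<bar> \<le> \<beta>" for i j
  proof -
    have "\<bar>v $ i\<bar> * (\<bar>x $ i $ j\<bar> * \<bar>?w $ j\<bar>) \<le> 1 * (\<beta> * 1)"
      using v w' x \<open>\<beta> \<ge> 0\<close> by (intro mult_mono) auto
    then show ?thesis by (simp add: abs_mult)
  qed
  then have "\<bar>\<Sum>j\<in>UNIV. v $ i * (x $ i $ j * ?w $ j)\<bar> \<le> 4 * \<beta>" for i
    using sum_bounded_above[of UNIV "\<lambda>j. \<bar>v $ i * (x $ i $ j * ?w $ j)\<bar>" \<beta>]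
    by (intro order_trans[OF sum_abs]) simp
  then show ?thesis
    unfolding eq
    using sum_bounded_above[of UNIV "\<lambda>i. \<bar>\<Sum>j\<in>UNIV. v $ i * (x $ i $ j * ?w $ j)\<bar>" "4 * \<beta>"]
    by (intro order_trans[OF sum_abs]) simp
qed

definition frame_const :: "nat \<Rightarrow> real" where
  "frame_const m = fact CARD(4 \<times> 4) * (real (16 * (m + 2)) * 16\<^sup>2) ^ CARD(4 \<times> 4)"

text \<open>The second bound is the quantitative form of injectivity: an element of \<open>rep q\<close> that is small on
  all frames is small, with a loss inversely proportional to the determinant.\<close>

lemma frame_bounds:
  assumes F: "\<And>k a i. k < m \<Longrightarrow> \<bar>F k a $ i\<bar> \<le> 4"
  shows "\<bar>frame_det q m F\<bar> \<le> frame_const m"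
    and "x \<in> rep q \<Longrightarrow> 0 < \<beta> \<Longrightarrow> (\<And>k a b. k < m \<Longrightarrow> \<bar>form_val q (F k a) (F k b) x\<bar> \<le> \<beta>) \<Longrightarrow>
      \<bar>x $ i $ j\<bar> * \<bar>frame_det q m F\<bar> \<le> frame_const m * \<beta>"
proof -
  let ?K = "{..<m + 2} \<times> (UNIV :: (4 \<times> 4) set)"
  have vec: "\<bar>form_vec q v w $ ij\<bar> \<le> c * c" if "\<And>i. \<bar>v $ i\<bar> \<le> c" "\<And>i. \<bar>w $ i\<bar> \<le> c" for v w c ij
    using that abs_form_mat_mult_le[OF that(2), of q "snd ij"] that(1)[of "fst ij"]
    by (auto simp: form_vec_def abs_mult intro!: mult_mono)
  have comp: "\<bar>functional q F k $ ij\<bar> \<le> 16" if k0: "k \<in> ?K" for k ij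
  proof -
    obtain l a b where k: "k = (l, a, b)" "l < m + 2" using k0 by (cases k) auto
    consider "l = 0" | "l = Suc 0" | l' where "l = Suc (Suc l')" by (metis nat.exhaust)
    then show ?thesis
    proof cases
      case 1
      have ax: "\<bar>(axis c 1 :: real^4) $ i\<bar> \<le> 1" for c i by (simp add: axis_def)
      show ?thesis
        using vec[where v="axis a 1" and w="axis b 1" and c=1 and ij=ij, OF ax ax]
          vec[where v="axis b 1" and w="axis a 1" and c=1 and ij=ij, OF ax ax] by (simp add: k 1)
    next
      case 2
      then show ?thesis by (simp add: k)
    next
      case 3
      then show ?thesis using vec[where v="F l' a" and w="F l' b" and c=4 and ij=ij, OF F F] k(2) by (simp add: k(1))
    qed
  qed
  have card: "real (card ?K) = real (16 * (m + 2))" by simp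
  have one: "(1::real) \<le> 16" by simp
  have const: "fact CARD(4 \<times> 4) * (real (card ?K) * 16\<^sup>2) ^ CARD(4 \<times> 4) = frame_const m"
    by (simp only: card frame_const_def)
  show "\<bar>frame_det q m F\<bar> \<le> frame_const m"
    unfolding frame_det_def
    by (rule gram_bound(2)[of ?K "functional q F" 16 0 1, OF comp one, unfolded const]) simp_all
  assume x: "x \<in> rep q" and "0 < \<beta>" and \<beta>: "\<And>k a b. k < m \<Longrightarrow> \<bar>form_val q (F k a) (F k b) x\<bar> \<le> \<beta>"
  have "\<bar>functional q F k \<bullet> flat x\<bar> \<le> \<beta>" if k0: "k \<in> ?K" for k
  proof -
    obtain l a b where k: "k = (l, a, b)" "l < m + 2" using k0 by (cases k) auto
    consider "l = 0" | "l = Suc 0" | l' where "l = Suc (Suc l')" by (metis nat.exhaust)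
    then show ?thesis
    proof cases
      case 1
      have "(x ** form_mat q) $ a $ b = (x ** form_mat q) $ b $ a"
      proof -
        have "transpose (x ** form_mat q) $ b $ a = (x ** form_mat q) $ b $ a" using x by (simp only: rep_iff)
        then show ?thesis by (simp add: transpose_def)
      qed
      then show ?thesis
        using \<open>0 < \<beta>\<close> by (simp add: k 1 inner_diff_left form_vec_inner form_val_axis)
    next
      case 2
      then show ?thesis using x \<open>0 < \<beta>\<close> by (simp add: k functional_trace rep_iff)
    next
      case 3
      then show ?thesis using \<beta>[of l' a b] k(2) by (simp add: k(1) form_vec_inner)
    qed
  qed
  from gram_bound(1)[of ?K "functional q F" 16 "flat x" \<beta>, OF comp one this \<open>0 < \<beta>\<close>, of "(i, j)", unfolded const]
  show "\<bar>x $ i $ j\<bar> * \<bar>frame_det q m F\<bar> \<le> frame_const m * \<beta>"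
    by (simp only: frame_det_def flat_def vec_lambda_beta fst_conv snd_conv)
qed

lemma is_poly_frame_det:
  assumes "\<And>k a i. k < m \<Longrightarrow> is_poly (\<lambda>p. F p k a $ i)"
  shows "is_poly (\<lambda>p. frame_det q m (F p))"
  unfolding frame_det_def
proof (intro is_poly_det)
  fix i j :: "4 \<times> 4"
  have "is_poly (\<lambda>p. functional q (F p) k $ ij)" if k0: "k \<in> {..<m + 2} \<times> UNIV" for k ij
  proof -
    obtain l a b where k: "k = (l, a, b)" "l < m + 2" using k0 by (cases k) auto
    consider "l = 0" | "l = Suc 0" | l' where "l = Suc (Suc l')" by (metis nat.exhaust)
    then show ?thesis
    proof cases
      case 3
      then show ?thesis using assms[of l'] k(2)
        by (auto simp: k(1) form_vec_def matrix_vector_mult_def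
            intro!: is_poly_mult is_poly_sum is_poly_const)
    qed (simp_all add: k(1) is_poly_const)
  qed
  then show "is_poly (\<lambda>p. gram ({..<m + 2} \<times> UNIV) (functional q (F p)) $ i $ j)"
    by (simp add: gram_def is_poly_sum is_poly_mult)
qed

section \<open>Tangent hyperplanes of the light cone and their intersections\<close>

text \<open>The first row \<open>(1, r, s, _)\<close> of \<open>uni q r s\<close> runs through the zero set of the form, and the next two
  rows are its derivatives. So the first three rows span a tangent hyperplane of this cone. The
  zero vector only fills the fourth place.\<close>

definition tangent :: "form \<Rightarrow> real \<times> real \<Rightarrow> 4 \<Rightarrow> real^4" where
  "tangent q p a = (if a = 4 then 0 else uni q (fst p) (snd p) $ a)"

text \<open>A basis of the plane in which the tangent hyperplanes at two points \<open>p\<close> and \<open>p'\<close> meet. A vector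
  \<open>(v0, v', _)\<close> of the hyperplane at \<open>p\<close> also lies in the one at \<open>p'\<close> if and only if \<open>v' - v0 * (p + p') / 2\<close> is
  orthogonal to \<open>p' - p\<close> for the polar form of the last entry of the first row, which is
  \<open>r * s\<close> or \<open>(r\<^sup>2 + s\<^sup>2) / 2\<close>. The first vector has \<open>v0 = 1\<close> and \<open>v'\<close> the midpoint, the second one has \<open>v0 = 0\<close>
  and \<open>v'\<close> orthogonal to \<open>p' - p\<close>.\<close>

definition chord :: "form \<Rightarrow> real \<times> real \<Rightarrow> real \<times> real \<Rightarrow> 4 \<Rightarrow> real^4" where
  "chord q p p' a = (let u = uni q (fst p) (snd p); dr = fst p' - fst p; ds = snd p' - snd p in
     if a = 1 then u $ 1 + (dr / 2) *\<^sub>R u $ 2 + (ds / 2) *\<^sub>R u $ 3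
     else if a = 2 then (case q of Split \<Rightarrow> dr *\<^sub>R u $ 2 + (- ds) *\<^sub>R u $ 3 | Lorentz \<Rightarrow> (- ds) *\<^sub>R u $ 2 + dr *\<^sub>R u $ 3)
     else 0)"

text \<open>The plane does not depend on the order of the points; hence both hyperplanes contain it, although
  \<open>chord\<close> is defined from the rows at \<open>p\<close> alone.\<close>

lemma chord_commute: "chord q p' p a = (if a = 2 then - chord q p p' a else chord q p p' a)"
proof -
  obtain r s r' s' where p: "p = (r, s)" "p' = (r', s')" by (cases p, cases p')
  consider "a = 1" | "a = 2" | "a \<noteq> 1" "a \<noteq> 2" by blast
  then show ?thesis
  proof cases
    case 1
    show ?thesis
      by (cases q) (simp_all add: 1 p chord_def Let_def vec_eq_iff forall_4 power2_eq_square field_simps)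
  next
    case 2
    show ?thesis
      by (cases q) (simp_all add: 2 p chord_def Let_def vec_eq_iff forall_4 algebra_simps)
  next
    case 3
    then show ?thesis by (simp add: chord_def)
  qed
qed

lemma uni_bound:
  assumes "p \<in> square"
  shows "\<bar>uni q (fst p) (snd p) $ a $ i\<bar> \<le> 1"
proof -
  obtain r s where p: "p = (r, s)" "\<bar>r\<bar> \<le> 1" "\<bar>s\<bar> \<le> 1" using assms by (cases p) (auto simp: abs_le_iff)
  have "\<bar>s * r\<bar> \<le> 1" using mult_mono[of "\<bar>s\<bar>" 1 "\<bar>r\<bar>" 1] p by (simp add: abs_mult)
  moreover have "r\<^sup>2 \<le> 1" "s\<^sup>2 \<le> 1" using p by (simp_all add: abs_square_le_1)
  then have "\<bar>(r\<^sup>2 + s\<^sup>2) / 2\<bar> \<le> 1" by (subst abs_of_nonneg) auto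
  ultimately show ?thesis
    using p exhaust_4[of a] exhaust_4[of i] by (cases q) auto
qed

lemma tangent_bound: "p \<in> square \<Longrightarrow> \<bar>tangent q p a $ i\<bar> \<le> 1"
  by (simp add: tangent_def uni_bound)

lemma chord_decomp:
  assumes "p \<in> square" "p' \<in> square"
  obtains c :: "nat \<Rightarrow> real" where "chord q p p' a = c 1 *\<^sub>R tangent q p 1 + c 2 *\<^sub>R tangent q p 2 + c 3 *\<^sub>R tangent q p 3"
    "\<bar>c 1\<bar> + \<bar>c 2\<bar> + \<bar>c 3\<bar> \<le> (4::real)"
proof -
  define dr where "dr = fst p' - fst p"
  define ds where "ds = snd p' - snd p"
  have d: "\<bar>dr\<bar> \<le> 2" "\<bar>ds\<bar> \<le> 2" using assms by (auto simp: dr_def ds_def mem_Times_iff)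
  define c where "c = (\<lambda>i::nat. if a = 1 then (if i = 1 then 1 else if i = 2 then dr / 2 else ds / 2)
    else if a = 2 then (case q of Split \<Rightarrow> (if i = 1 then 0 else if i = 2 then dr else - ds)
       | Lorentz \<Rightarrow> (if i = 1 then 0 else if i = 2 then - ds else dr)) else 0)"
  show thesis
  proof (rule that[of c])
    show "\<bar>c 1\<bar> + \<bar>c 2\<bar> + \<bar>c 3\<bar> \<le> 4" using d by (auto simp: c_def split: form.split)
    show "chord q p p' a = c 1 *\<^sub>R tangent q p 1 + c 2 *\<^sub>R tangent q p 2 + c 3 *\<^sub>R tangent q p 3"
      by (auto simp: c_def chord_def tangent_def Let_def dr_def ds_def split: form.split)
  qed
qed

lemma chord_bound:
  assumes "p \<in> square" "p' \<in> square"
  shows "\<bar>chord q p p' a $ i\<bar> \<le> 4"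
proof -
  obtain c where c: "chord q p p' a = c (1::nat) *\<^sub>R tangent q p 1 + c 2 *\<^sub>R tangent q p 2 + c 3 *\<^sub>R tangent q p 3"
    "\<bar>c 1\<bar> + \<bar>c 2\<bar> + \<bar>c 3\<bar> \<le> (4::real)"
    using chord_decomp[OF assms, of q a] by metis
  have t: "\<bar>c k * tangent q p b $ i\<bar> \<le> \<bar>c k\<bar>" for k b
    using mult_left_mono[OF tangent_bound[OF assms(1), of q b i], of "\<bar>c k\<bar>"] by (simp add: abs_mult)
  have "chord q p p' a $ i = c 1 * tangent q p 1 $ i + c 2 * tangent q p 2 $ i + c 3 * tangent q p 3 $ i"
    by (simp add: c(1))
  then show ?thesis using t[of 1 1] t[of 2 2] t[of 3 3] c(2) by linarith
qed

lemma form_val_chord_bound: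
  assumes "p \<in> square" "p' \<in> square"
    and \<beta>: "\<And>a b. \<bar>form_val q (tangent q p a) (tangent q p b) x\<bar> \<le> \<beta>"
  shows "\<bar>form_val q (chord q p p' a) (chord q p p' b) x\<bar> \<le> 16 * \<beta>"
proof -
  let ?t = "tangent q p"
  have comb: "\<bar>c1 * y1 + c2 * y2 + c3 * y3\<bar> \<le> 4 * \<gamma>"
    if "\<bar>y1\<bar> \<le> \<gamma>" "\<bar>y2\<bar> \<le> \<gamma>" "\<bar>y3\<bar> \<le> \<gamma>" "\<bar>c1\<bar> + \<bar>c2\<bar> + \<bar>c3\<bar> \<le> 4" for c1 c2 c3 y1 y2 y3 \<gamma> :: real
  proof -
    have "\<bar>c1 * y1 + c2 * y2 + c3 * y3\<bar> \<le> \<bar>c1\<bar> * \<bar>y1\<bar> + \<bar>c2\<bar> * \<bar>y2\<bar> + \<bar>c3\<bar> * \<bar>y3\<bar>"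
      by (simp add: abs_mult[symmetric])
    also have "\<dots> \<le> \<bar>c1\<bar> * \<gamma> + \<bar>c2\<bar> * \<gamma> + \<bar>c3\<bar> * \<gamma>"
      using that by (intro add_mono mult_left_mono) auto
    also have "\<dots> = (\<bar>c1\<bar> + \<bar>c2\<bar> + \<bar>c3\<bar>) * \<gamma>" by (simp add: algebra_simps)
    also have "\<dots> \<le> 4 * \<gamma>" using that by (intro mult_right_mono) auto
    finally show ?thesis .
  qed
  obtain c where c: "chord q p p' a = c (1::nat) *\<^sub>R ?t 1 + c 2 *\<^sub>R ?t 2 + c 3 *\<^sub>R ?t 3"
    "\<bar>c 1\<bar> + \<bar>c 2\<bar> + \<bar>c 3\<bar> \<le> (4::real)"
    using chord_decomp[OF assms(1,2), of q a] by metis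
  obtain d where d: "chord q p p' b = d (1::nat) *\<^sub>R ?t 1 + d 2 *\<^sub>R ?t 2 + d 3 *\<^sub>R ?t 3"
    "\<bar>d 1\<bar> + \<bar>d 2\<bar> + \<bar>d 3\<bar> \<le> (4::real)"
    using chord_decomp[OF assms(1,2), of q b] by metis
  have 1: "\<bar>form_val q (?t k) (chord q p p' b) x\<bar> \<le> 4 * \<beta>" for k
    unfolding d(1) form_val_linear by (intro comb \<beta> d(2))
  have "\<bar>form_val q (chord q p p' a) (chord q p p' b) x\<bar> \<le> 4 * (4 * \<beta>)"
    by (subst c(1), unfold form_val_linear, intro comb 1 c(2))
  then show ?thesis by simp
qed

lemma is_poly_diff:
  assumes "is_poly D" "is_poly E" shows "is_poly (\<lambda>p. D p - E p)"
  using is_poly_add[OF assms(1) is_poly_mult[OF is_poly_const[of "-1"] assms(2)]] by simp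

lemma is_poly_divide: "is_poly D \<Longrightarrow> is_poly (\<lambda>p. D p / c)"
  using is_poly_mult[OF _ is_poly_const[of "1 / c"]] by simp

lemmas is_poly_intros = is_poly_add is_poly_diff is_poly_mult is_poly_divide is_poly_const is_poly_coords

lemma is_poly_uni: "is_poly (\<lambda>p. uni q (fst (p k)) (snd (p k)) $ a $ i)"
proof -
  have half: "is_poly (\<lambda>p. ((fst (p k))\<^sup>2 + (snd (p k))\<^sup>2) / 2)"
    unfolding power2_eq_square by (intro is_poly_intros)
  have prod: "is_poly (\<lambda>p. snd (p k) * fst (p k))" by (intro is_poly_intros)
  note leaves = half prod is_poly_const is_poly_coords
  show ?thesis
    using exhaust_4[of a] exhaust_4[of i]
    by (cases q; elim disjE) (simp_all add: leaves)
qed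

lemma is_poly_tangent: "is_poly (\<lambda>p. tangent q (p k) a $ i)"
  by (cases "a = 4") (simp_all add: tangent_def is_poly_const is_poly_uni)

lemma is_poly_chord: "is_poly (\<lambda>p. chord q (p k) (p l) a $ i)"
proof -
  let ?u = "\<lambda>p. uni q (fst (p k)) (snd (p k))"
  let ?v = "\<lambda>q p b. uni q (fst (p k)) (snd (p k)) $ b $ i"
  let ?dr = "\<lambda>p. fst (p l) - fst (p k)" and ?ds = "\<lambda>p. snd (p l) - snd (p k)"
  have "is_poly (\<lambda>p. ?u p $ 1 $ i + ?dr p / 2 * ?u p $ 2 $ i + ?ds p / 2 * ?u p $ 3 $ i)"
    "is_poly (\<lambda>p. ?dr p * ?v Split p 2 - ?ds p * ?v Split p 3)"
    "is_poly (\<lambda>p. ?dr p * ?v Lorentz p 3 - ?ds p * ?v Lorentz p 2)"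
    by (intro is_poly_intros is_poly_uni)+
  note polys = this
  have "(\<lambda>p. chord q (p k) (p l) 1 $ i) = (\<lambda>p. ?u p $ 1 $ i + ?dr p / 2 * ?u p $ 2 $ i + ?ds p / 2 * ?u p $ 3 $ i)"
    "(\<lambda>p. chord Split (p k) (p l) 2 $ i) = (\<lambda>p. ?dr p * ?v Split p 2 - ?ds p * ?v Split p 3)"
    "(\<lambda>p. chord Lorentz (p k) (p l) 2 $ i) = (\<lambda>p. ?dr p * ?v Lorentz p 3 - ?ds p * ?v Lorentz p 2)"
    "a \<noteq> 1 \<Longrightarrow> a \<noteq> 2 \<Longrightarrow> (\<lambda>p. chord q (p k) (p l) a $ i) = (\<lambda>p. 0)"
    by (simp_all add: chord_def Let_def fun_eq_iff del: uni.simps)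
  note eqs = this
  consider "a = 1" | "a = 2" | "a \<noteq> 1" "a \<noteq> 2" by blast
  then show ?thesis
  proof cases
    case 1
    show ?thesis unfolding 1 eqs(1) by (rule polys(1))
  next
    case 2
    show ?thesis
    proof (cases q)
      case Split
      show ?thesis unfolding Split 2 eqs(2) by (rule polys(2))
    next
      case Lorentz
      show ?thesis unfolding Lorentz 2 eqs(3) by (rule polys(3))
    qed
  next
    case 3
    show ?thesis unfolding eqs(4)[OF 3] by (rule is_poly_const)
  qed
qed

section \<open>The projection as restriction to a hyperplane\<close>

lemmas form_mat_simps = form_mat_Split form_mat_Lorentz

lemma uni_zero: "uni q 0 0 = mat 1"
  by (cases q) (simp_all add: vec_eq_iff forall_4 mat_def)

lemma matrix_inv_uni: "matrix_inv (uni q r s) ** uni q r s = mat 1" "uni q r s ** matrix_inv (uni q r s) = mat 1"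
proof -
  have "uni q r s ** uni q (-r) (-s) = mat 1 \<and> uni q (-r) (-s) ** uni q r s = mat 1"
    by (simp add: uni_mult uni_zero)
  then have ex: "\<exists>B. uni q r s ** B = mat 1 \<and> B ** uni q r s = mat 1" by blast
  from someI_ex[OF ex]
  show "matrix_inv (uni q r s) ** uni q r s = mat 1" "uni q r s ** matrix_inv (uni q r s) = mat 1"
    by (auto simp: matrix_inv_def)
qed

lemma uni_form: "uni q r s ** form_mat q ** transpose (uni q r s) = form_mat q"
  by (cases q) (simp_all add: form_mat_simps transpose_def vec_eq_iff forall_4 matrix_matrix_mult_def sum_4
      power2_eq_square algebra_simps)

text \<open>As \<open>u\<close> preserves the form, conjugation of \<open>x\<close> by \<open>u\<close> becomes the congruence \<open>u ** y ** transpose u\<close> of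
  the bilinear form \<open>y = x ** form_mat q\<close>.\<close>

lemma Ad_uni_form:
  "Ad (uni q r s) x ** form_mat q = uni q r s ** (x ** form_mat q) ** transpose (uni q r s)"
proof -
  let ?u = "uni q r s" and ?Q = "form_mat q"
  have "matrix_inv ?u ** ?Q = matrix_inv ?u ** (?u ** ?Q ** transpose ?u)" by (simp add: uni_form)
  also have "\<dots> = matrix_inv ?u ** ?u ** (?Q ** transpose ?u)" by (simp add: matrix_mul_assoc)
  finally have "matrix_inv ?u ** ?Q = ?Q ** transpose ?u" by (simp add: matrix_inv_uni)
  then have "?u ** x ** (matrix_inv ?u ** ?Q) = ?u ** x ** (?Q ** transpose ?u)" by simp
  then show ?thesis by (simp only: Ad_def matrix_mul_assoc)
qed

lemma Ad_uni_form_val: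
  "(Ad (uni q r s) x ** form_mat q) $ a $ b = form_val q (uni q r s $ a) (uni q r s $ b) x"
proof -
  have "(U ** Y ** transpose U) $ a $ b = U $ a \<bullet> (Y *v U $ b)" for U Y :: "real^4^4"
    by (simp add: matrix_matrix_mult_def transpose_def inner_vec_def matrix_vector_mult_def sum_4 algebra_simps)
  then show ?thesis by (simp add: Ad_uni_form form_val_def)
qed

lemma Ad_uni_rep:
  assumes "x \<in> rep q" shows "Ad (uni q r s) x \<in> rep q"
proof -
  let ?u = "uni q r s"
  have transpose_conj: "transpose (U ** Y ** transpose U) = U ** transpose Y ** transpose U" for U Y :: "real^4^4"
    by (simp add: matrix_transpose_mul transpose_transpose matrix_mul_assoc)
  have "trace (Ad ?u x) = trace (matrix_inv ?u ** (?u ** x))"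
    unfolding Ad_def by (rule trace_mul_sym)
  also have "\<dots> = trace x" by (simp add: matrix_mul_assoc matrix_inv_uni)
  finally show ?thesis
    using assms transpose_conj[of "uni q r s" "x ** form_mat q"] by (simp add: rep_iff Ad_uni_form)
qed

definition trunc :: "real^4^4 \<Rightarrow> real^4^4" where
  "trunc z = (\<chi> i j. if diag_elt $ i $ i < diag_elt $ j $ j then 0 else z $ i $ j)"

definition weight_part :: "real \<Rightarrow> real^4^4 \<Rightarrow> real^4^4" where
  "weight_part k z = (\<chi> i j. if diag_elt $ i $ i - diag_elt $ j $ j = k then z $ i $ j else 0)"

lemma form_mat_weight: "form_mat q $ l $ j = 0 \<or> diag_elt $ l $ l = - diag_elt $ j $ j"
  using exhaust_4[of l] exhaust_4[of j]
  by (cases q; elim disjE) (simp_all add: form_mat_simps diag_elt_def)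

text \<open>Multiplication by the matrix of the form turns the entry \<open>(i, j)\<close> of weight \<open>d i - d j\<close> into an
  entry of weight \<open>d i + d j\<close>, a condition symmetric in \<open>i\<close> and \<open>j\<close>. So the parts of a given weight of a
  symmetric form are symmetric.\<close>

lemma weight_part_rep:
  assumes "z \<in> rep q"
  shows "weight_part k z \<in> rep q"
proof -
  let ?Q = "form_mat q" and ?d = "\<lambda>i. diag_elt $ i $ i"
  have "trace (weight_part k z) = (if k = 0 then trace z else 0)"
    by (simp add: trace_def weight_part_def)
  moreover have "(weight_part k z ** ?Q) $ i $ j = (if ?d i + ?d j = k then (z ** ?Q) $ i $ j else 0)" for i j
  proof -
    have "weight_part k z $ i $ l * ?Q $ l $ j = (if ?d i + ?d j = k then z $ i $ l * ?Q $ l $ j else 0)" for l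
      using form_mat_weight[of q l j] by (auto simp: weight_part_def)
    then show ?thesis by (simp add: matrix_matrix_mult_def)
  qed
  moreover have "(z ** ?Q) $ i $ j = (z ** ?Q) $ j $ i" for i j
  proof -
    have "transpose (z ** ?Q) $ j $ i = (z ** ?Q) $ j $ i" using assms by (simp only: rep_iff)
    then show ?thesis by (simp add: transpose_def)
  qed
  ultimately show ?thesis
    using assms by (simp add: rep_iff transpose_def vec_eq_iff add.commute)
qed

lemma diag_commutator: "(diag_elt ** x - x ** diag_elt) $ i $ j = (diag_elt $ i $ i - diag_elt $ j $ j) * x $ i $ j"
  using exhaust_4[of i] exhaust_4[of j]
  by (auto simp: diag_elt_def matrix_matrix_mult_def sum_4)

lemma weight_part_weight_space:
  assumes "z \<in> rep q"
  shows "weight_part k z \<in> weight_space q k"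
  unfolding weight_space_def using weight_part_rep[OF assms]
  by (auto simp: vec_eq_iff diag_commutator weight_part_def simp del: vector_minus_component)

lemma trunc_eq: "trunc z = weight_part 0 z + weight_part 1 z + weight_part 2 z"
  by (simp add: trunc_def weight_part_def vec_eq_iff forall_4 diag_elt_def)

text \<open>Different weight spaces live on disjoint sets of matrix entries, so they are orthogonal, and the
  projection deletes the entries of negative weight.\<close>

lemma orth_proj_eq_trunc:
  assumes "z \<in> rep q"
  shows "orth_proj (weight_filt q 0) z = trunc z"
proof -
  let ?W = "weight_filt q 0"
  have "weight_part k z \<in> ?W" if "k \<in> {0, 1, 2}" for k
    unfolding weight_filt_def
    using weight_part_weight_space[OF assms] that by (intro span_base UN_I[of k]) auto
  then have "trunc z \<in> ?W"
    unfolding trunc_eq by (simp add: weight_filt_def span_add)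
  moreover have "z - trunc z \<in> ?W\<^sup>\<bottom>"
  proof -
    have "orthogonal w (z - trunc z)" if "w \<in> ?W" for w
      using that unfolding weight_filt_def
    proof (induction rule: span_induct)
      case base
      show ?case by (simp add: subspace_def orthogonal_def inner_add_left)
    next
      case (step w)
      then obtain k where k: "k \<ge> 0" "diag_elt ** w - w ** diag_elt = k *\<^sub>R w"
        by (auto simp: weight_space_def)
      have "w $ i $ j * (z - trunc z) $ i $ j = 0" for i j
      proof (cases "diag_elt $ i $ i < diag_elt $ j $ j")
        case True
        have "(diag_elt $ i $ i - diag_elt $ j $ j) * w $ i $ j = k * w $ i $ j"
          using arg_cong[OF k(2), of "\<lambda>m. m $ i $ j"] diag_commutator[of w i j]
          by (simp del: vector_minus_component)
        then have "(k - (diag_elt $ i $ i - diag_elt $ j $ j)) * w $ i $ j = 0" by (simp add: algebra_simps)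
        then show ?thesis using True k(1) by simp
      qed (simp add: trunc_def)
      then show ?case
        unfolding orthogonal_def inner_vec_def inner_real_def by (intro sum.neutral ballI)
    qed
    then show ?thesis by (simp add: orthogonal_comp_def)
  qed
  moreover have "subspace ?W" by (simp add: weight_filt_def)
  ultimately show ?thesis
    unfolding orth_proj_def by (intro the1_equality orth_proj_unique conjI)
qed

text \<open>The key translation: up to a change of coordinates, \<open>proj_u q 0 u x\<close> is the restriction of the
  bilinear form \<open>x ** form_mat q\<close> to the tangent hyperplane spanned by the first three rows of \<open>u\<close>.\<close>

lemma proj_form_val:
  assumes "x \<in> rep q" "a \<noteq> 4" "b \<noteq> 4"
  shows "(proj_u q 0 (uni q (fst p) (snd p)) x ** form_mat q) $ a $ b = form_val q (tangent q p a) (tangent q p b) x"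
proof -
  have "(trunc z ** form_mat q) $ a $ b = (z ** form_mat q) $ a $ b" for z
    using exhaust_4[of a] exhaust_4[of b] assms(2,3)
    by (cases q) (auto simp: trunc_def diag_elt_def form_mat_simps matrix_matrix_mult_def sum_4)
  then show ?thesis
    using assms by (simp add: proj_u_def orth_proj_eq_trunc Ad_uni_rep Ad_uni_form_val tangent_def)
qed

lemma form_val_tangent_diff:
  assumes "x \<in> rep q" "x' \<in> rep q"
    and close: "\<And>i j. \<bar>proj_u q 0 (uni q (fst p) (snd p)) x $ i $ j - proj_u q 0 (uni q (fst p) (snd p)) x' $ i $ j\<bar> \<le> \<beta>"
  shows "\<bar>form_val q (tangent q p a) (tangent q p b) (x - x')\<bar> \<le> \<beta>"
proof (cases "a = 4 \<or> b = 4")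
  case True
  then show ?thesis using close[of 1 1] by (auto simp: tangent_def form_val_def)
next
  case False
  let ?P = "\<lambda>x. proj_u q 0 (uni q (fst p) (snd p)) x"
  have le: "\<bar>(z ** form_mat q) $ a $ b\<bar> \<le> \<beta>" if "\<And>i j. \<bar>z $ i $ j\<bar> \<le> \<beta>" for z :: "real^4^4"
    using that[of a 1] that[of a 2] that[of a 3] that[of a 4] exhaust_4[of b]
    by (cases q) (auto simp: form_mat_simps matrix_matrix_mult_def sum_4)
  have "form_val q (tangent q p a) (tangent q p b) (x - x') = ((?P x - ?P x') ** form_mat q) $ a $ b"
    using False by (simp add: form_val_linear proj_form_val assms matrix_diff_rdistrib)
  then show ?thesis using le[of "?P x - ?P x'"] close by simp
qed

section \<open>A configuration of six points in general position\<close>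

text \<open>Large for six points such that an element of \<open>rep q\<close> can be recovered both from its restrictions to
  the two hyperplanes of each of the pairs (0,1), (2,3), (4,5), and from its restrictions to the
  three planes of these pairs.\<close>

definition config_det :: "form \<Rightarrow> (nat \<Rightarrow> real \<times> real) \<Rightarrow> real" where
  "config_det q p = frame_det q 3 (\<lambda>j. chord q (p (2 * j)) (p (2 * j + 1))) *
     (\<Prod>j<3. frame_det q 2 (\<lambda>k. tangent q (p (2 * j + k))))"

text \<open>Six points that are in general position for both forms. Indices are reduced modulo 6 only to
  make this a total function with values in the square.\<close>

definition witness :: "nat \<Rightarrow> real \<times> real" where
  "witness k = [(-1,-1), (0,0), (-1,0), (0,1), (-1,1), (0,-1)] ! (k mod 6)"

lemma is_poly_config_det: "is_poly (config_det q)"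
  unfolding config_det_def
  by (intro is_poly_mult is_poly_prod is_poly_frame_det is_poly_chord is_poly_tangent)

lemma witness_square: "witness k \<in> square"
proof -
  have "k mod 6 < 6" by simp
  then have "k mod 6 \<in> {0, 1, 2, 3, 4, 5}" by auto
  then show ?thesis by (auto simp: witness_def)
qed

lemma form_val_expand: "form_val q v w x = (\<Sum>i\<in>UNIV. \<Sum>j\<in>UNIV. v $ i * w $ j * (x ** form_mat q) $ i $ j)"
  by (simp add: form_val_def inner_vec_def matrix_vector_mult_def sum_distrib_left mult_ac)

lemma rep_form_relations:
  assumes "x \<in> rep q"
  defines "y \<equiv> \<lambda>i j. (x ** form_mat q) $ i $ j"
  shows "y i j = y j i" and "case q of Split \<Rightarrow> y 2 3 = y 1 4 | Lorentz \<Rightarrow> y 2 2 + y 3 3 = 2 * y 1 4"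
proof -
  have sym: "y i j = y j i" for i j
  proof -
    have "transpose (x ** form_mat q) $ j $ i = (x ** form_mat q) $ j $ i" using assms by (simp only: rep_iff)
    then show ?thesis by (simp add: transpose_def y_def)
  qed
  then show "y i j = y j i" .
  have "x $ 1 $ 1 + x $ 2 $ 2 + x $ 3 $ 3 + x $ 4 $ 4 = 0"
    using assms by (simp add: rep_iff trace_def sum_4)
  then show "case q of Split \<Rightarrow> y 2 3 = y 1 4 | Lorentz \<Rightarrow> y 2 2 + y 3 3 = 2 * y 1 4"
    using sym[of 4 1] sym[of 3 2]
    by (cases q) (simp_all add: y_def form_mat_simps matrix_matrix_mult_def sum_4)
qed

lemma form_zero_imp_zero:
  assumes "x ** form_mat q = 0" shows "x = 0"
proof -
  have "x ** form_mat q ** matrix_inv (form_mat q) = 0" using assms by simp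
  moreover have "form_mat q ** matrix_inv (form_mat q) = mat 1"
    using someI_ex[OF invertible_form_mat[unfolded invertible_def], of q] by (auto simp: matrix_inv_def)
  ultimately show ?thesis by (simp flip: matrix_mul_assoc)
qed

lemma tangent_simps:
  "tangent q (r, s) 1 = uni q r s $ 1" "tangent q (r, s) 2 = uni q r s $ 2" "tangent q (r, s) 3 = uni q r s $ 3"
  by (simp_all add: tangent_def)

lemma witness_simps:
  "witness 0 = (-1,-1)" "witness 1 = (0,0)" "witness 2 = (-1,0)" "witness 3 = (0,1)" "witness 4 = (-1,1)" "witness 5 = (0,-1)"
  by (simp_all add: witness_def)

text \<open>For two points \<open>p\<close>, \<open>p'\<close>, the restrictions to both tangent hyperplanes determine \<open>y\<close> up to a multiple
  of the product of the two linear forms that define these hyperplanes, and this product violates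
  the trace relation. Here this is linear algebra with explicit numbers.\<close>

lemma witness_pair:
  assumes "j < 3" shows "frame_det q 2 (\<lambda>k. tangent q (witness (2 * j + k))) \<noteq> 0"
proof (rule frame_det_nonzero)
  fix x assume x: "x \<in> rep q"
    and zero: "\<And>k a b. k < 2 \<Longrightarrow>
      form_val q (tangent q (witness (2 * j + k)) a) (tangent q (witness (2 * j + k)) b) x = 0"
  define y where "y i j = (x ** form_mat q) $ i $ j" for i j
  have y: "y 2 1 = y 1 2" "y 3 1 = y 1 3" "y 4 1 = y 1 4" "y 3 2 = y 2 3" "y 4 2 = y 2 4" "y 4 3 = y 3 4"
    "case q of Split \<Rightarrow> y 2 3 = y 1 4 | Lorentz \<Rightarrow> y 2 2 + y 3 3 = 2 * y 1 4"
    unfolding y_def by (rule rep_form_relations[OF x])+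
  have val: "form_val q v w x = (\<Sum>i\<in>UNIV. \<Sum>j\<in>UNIV. v $ i * w $ j * y i j)" for v w
    by (simp add: form_val_expand y_def)
  note [simp] = tangent_simps witness_simps[simplified] sum_4 y(1-6)
  have "j = 0 \<or> j = 1 \<or> j = 2" using assms by auto
  then consider "j = 0" "q = Split" | "j = 0" "q = Lorentz" | "j = 1" "q = Split" | "j = 1" "q = Lorentz" | "j = 2" "q = Split" | "j = 2" "q = Lorentz" by (cases q) auto
  then have "y 1 1 = 0 \<and> y 1 2 = 0 \<and> y 1 3 = 0 \<and> y 1 4 = 0 \<and> y 2 2 = 0 \<and> y 2 3 = 0 \<and> y 2 4 = 0 \<and> y 3 3 = 0 \<and> y 3 4 = 0 \<and> y 4 4 = 0"
  proof cases
    case 1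
    note z = zero[unfolded val, unfolded 1]
    show ?thesis
      using y(7)[unfolded 1, simplified]
        z[of 0 1 1, simplified] z[of 0 1 2, simplified] z[of 0 1 3, simplified] z[of 0 2 2, simplified] z[of 0 2 3, simplified] z[of 0 3 3, simplified]
        z[of 1 1 1, simplified] z[of 1 1 2, simplified] z[of 1 1 3, simplified] z[of 1 2 2, simplified] z[of 1 2 3, simplified] z[of 1 3 3, simplified]
      by argo
  next
    case 2
    note z = zero[unfolded val, unfolded 2]
    show ?thesis
      using y(7)[unfolded 2, simplified]
        z[of 0 1 1, simplified] z[of 0 1 2, simplified] z[of 0 1 3, simplified] z[of 0 2 2, simplified] z[of 0 2 3, simplified] z[of 0 3 3, simplified]
        z[of 1 1 1, simplified] z[of 1 1 2, simplified] z[of 1 1 3, simplified] z[of 1 2 2, simplified] z[of 1 2 3, simplified] z[of 1 3 3, simplified]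
      by argo
  next
    case 3
    note z = zero[unfolded val, unfolded 3]
    show ?thesis
      using y(7)[unfolded 3, simplified]
        z[of 0 1 1, simplified] z[of 0 1 2, simplified] z[of 0 1 3, simplified] z[of 0 2 2, simplified] z[of 0 2 3, simplified] z[of 0 3 3, simplified]
        z[of 1 1 1, simplified] z[of 1 1 2, simplified] z[of 1 1 3, simplified] z[of 1 2 2, simplified] z[of 1 2 3, simplified] z[of 1 3 3, simplified]
      by argo
  next
    case 4
    note z = zero[unfolded val, unfolded 4]
    show ?thesis
      using y(7)[unfolded 4, simplified]
        z[of 0 1 1, simplified] z[of 0 1 2, simplified] z[of 0 1 3, simplified] z[of 0 2 2, simplified] z[of 0 2 3, simplified] z[of 0 3 3, simplified]
        z[of 1 1 1, simplified] z[of 1 1 2, simplified] z[of 1 1 3, simplified] z[of 1 2 2, simplified] z[of 1 2 3, simplified] z[of 1 3 3, simplified]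
      by argo
  next
    case 5
    note z = zero[unfolded val, unfolded 5]
    show ?thesis
      using y(7)[unfolded 5, simplified]
        z[of 0 1 1, simplified] z[of 0 1 2, simplified] z[of 0 1 3, simplified] z[of 0 2 2, simplified] z[of 0 2 3, simplified] z[of 0 3 3, simplified]
        z[of 1 1 1, simplified] z[of 1 1 2, simplified] z[of 1 1 3, simplified] z[of 1 2 2, simplified] z[of 1 2 3, simplified] z[of 1 3 3, simplified]
      by argo
  next
    case 6
    note z = zero[unfolded val, unfolded 6]
    show ?thesis
      using y(7)[unfolded 6, simplified]
        z[of 0 1 1, simplified] z[of 0 1 2, simplified] z[of 0 1 3, simplified] z[of 0 2 2, simplified] z[of 0 2 3, simplified] z[of 0 3 3, simplified]
        z[of 1 1 1, simplified] z[of 1 1 2, simplified] z[of 1 1 3, simplified] z[of 1 2 2, simplified] z[of 1 2 3, simplified] z[of 1 3 3, simplified]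
      by argo
  qed
  then have "\<forall>a b. y a b = 0" using y(1-6) by (simp add: forall_4)
  then show "x = 0"
    by (intro form_zero_imp_zero[of x q]) (simp add: y_def vec_eq_iff)
qed

text \<open>A quadratic form on four-space that vanishes on three planes in general position defines the
  quadric surface through three skew lines, which is unique. So the restrictions determine \<open>y\<close> up to a
  multiple of one quadratic form, and this one violates the trace relation. For the chosen points
  these are ten linear equations in ten unknowns.\<close>

lemma witness_triple: "frame_det q 3 (\<lambda>j. chord q (witness (2 * j)) (witness (2 * j + 1))) \<noteq> 0"
proof (rule frame_det_nonzero)
  fix x assume x: "x \<in> rep q"
    and zero: "\<And>j a b. j < 3 \<Longrightarrow> form_val q (chord q (witness (2 * j)) (witness (2 * j + 1)) a)
      (chord q (witness (2 * j)) (witness (2 * j + 1)) b) x = 0"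
  define y where "y i j = (x ** form_mat q) $ i $ j" for i j
  have y: "y 2 1 = y 1 2" "y 3 1 = y 1 3" "y 4 1 = y 1 4" "y 3 2 = y 2 3" "y 4 2 = y 2 4" "y 4 3 = y 3 4"
    "case q of Split \<Rightarrow> y 2 3 = y 1 4 | Lorentz \<Rightarrow> y 2 2 + y 3 3 = 2 * y 1 4"
    unfolding y_def by (rule rep_form_relations[OF x])+
  have val: "form_val q v w x = (\<Sum>i\<in>UNIV. \<Sum>j\<in>UNIV. v $ i * w $ j * y i j)" for v w
    by (simp add: form_val_expand y_def)
  note [simp] = chord_def Let_def witness_simps[simplified] sum_4 y(1-6)
  have "y 1 1 = 0 \<and> y 1 2 = 0 \<and> y 1 3 = 0 \<and> y 1 4 = 0 \<and> y 2 2 = 0 \<and> y 2 3 = 0 \<and> y 2 4 = 0 \<and> y 3 3 = 0 \<and> y 3 4 = 0 \<and> y 4 4 = 0"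
  proof (cases q)
    case Split
    note z = zero[unfolded val, unfolded Split]
    show ?thesis
      using y(7)[unfolded Split, simplified]
        z[of 0 1 1, simplified] z[of 0 1 2, simplified] z[of 0 2 2, simplified]
        z[of 1 1 1, simplified] z[of 1 1 2, simplified] z[of 1 2 2, simplified]
        z[of 2 1 1, simplified] z[of 2 1 2, simplified] z[of 2 2 2, simplified]
      by argo
  next
    case Lorentz
    note z = zero[unfolded val, unfolded Lorentz]
    show ?thesis
      using y(7)[unfolded Lorentz, simplified]
        z[of 0 1 1, simplified] z[of 0 1 2, simplified] z[of 0 2 2, simplified]
        z[of 1 1 1, simplified] z[of 1 1 2, simplified] z[of 1 2 2, simplified]
        z[of 2 1 1, simplified] z[of 2 1 2, simplified] z[of 2 2 2, simplified]
      by argo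
  qed
  then have "\<forall>a b. y a b = 0" using y(1-6) by (simp add: forall_4)
  then show "x = 0"
    by (intro form_zero_imp_zero[of x q]) (simp add: y_def vec_eq_iff)
qed

section \<open>Counting cells\<close>

text \<open>Rounding to the grid of mesh \<open>\<delta>\<close>. Numbers of occupied cells replace covering numbers, from which
  they differ by bounded factors.\<close>

definition cells :: "real \<Rightarrow> ('k \<Rightarrow> real) \<Rightarrow> 'k \<Rightarrow> int" where
  "cells \<delta> v = (\<lambda>k. \<lfloor>v k / \<delta>\<rfloor>)"

definition mcell :: "real \<Rightarrow> real^4^4 \<Rightarrow> 4 \<times> 4 \<Rightarrow> int" where
  "mcell \<delta> x = cells \<delta> (\<lambda>ij. x $ fst ij $ snd ij)"

lemma cells_eq_close:
  assumes "\<delta> > 0" "cells \<delta> v = cells \<delta> w" shows "\<bar>v k - w k\<bar> \<le> \<delta>"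
proof -
  have "\<lfloor>v k / \<delta>\<rfloor> = \<lfloor>w k / \<delta>\<rfloor>" using fun_cong[OF assms(2), of k] by (simp add: cells_def)
  then have "\<bar>v k / \<delta> - w k / \<delta>\<bar> < 1" by linarith
  then have "\<bar>v k / \<delta> - w k / \<delta>\<bar> * \<delta> \<le> 1 * \<delta>" using assms(1) by (intro mult_right_mono) auto
  moreover have "\<bar>v k / \<delta> - w k / \<delta>\<bar> * \<delta> = \<bar>v k - w k\<bar>"
    using assms(1) by (simp add: abs_mult_pos[symmetric] field_simps)
  ultimately show ?thesis by simp
qed

lemma mcell_eq_close:
  assumes "\<delta> > 0" "mcell \<delta> x = mcell \<delta> y" shows "\<bar>x $ i $ j - y $ i $ j\<bar> \<le> \<delta>"
  using cells_eq_close[OF assms(1) assms(2)[unfolded mcell_def], of "(i, j)"] by simp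

lemma card_cells:
  fixes v :: "'c \<Rightarrow> 'k::finite \<Rightarrow> real"
  assumes "\<delta> > 0" "R \<ge> 0" and close: "\<And>c c' k. c \<in> J \<Longrightarrow> c' \<in> J \<Longrightarrow> \<bar>v c k - v c' k\<bar> \<le> R * \<delta>"
  shows "finite ((\<lambda>c. cells \<delta> (v c)) ` J)"
    and "real (card ((\<lambda>c. cells \<delta> (v c)) ` J)) \<le> (2 * R + 3) ^ CARD('k)"
proof -
  have "finite ((\<lambda>c. cells \<delta> (v c)) ` J) \<and> real (card ((\<lambda>c. cells \<delta> (v c)) ` J)) \<le> (2 * R + 3) ^ CARD('k)"
  proof (cases "J = {}")
    case False
    then obtain c0 where c0: "c0 \<in> J" by blast
    define m where "m = \<lceil>R\<rceil>"
    have m: "m \<ge> 0" "real_of_int m \<le> R + 1" "R \<le> m" using \<open>R \<ge> 0\<close> unfolding m_def by linarith+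
    define W where "W = Pi\<^sub>E (UNIV :: 'k set) (\<lambda>k. {\<lfloor>v c0 k / \<delta>\<rfloor> - m..\<lfloor>v c0 k / \<delta>\<rfloor> + m})"
    have sub: "(\<lambda>c. cells \<delta> (v c)) ` J \<subseteq> W"
    proof (intro image_subsetI, unfold W_def, intro PiE_I)
      fix c k assume "c \<in> J"
      have "\<bar>v c k / \<delta> - v c0 k / \<delta>\<bar> = \<bar>v c k - v c0 k\<bar> / \<delta>"
        using assms(1) by (simp add: abs_divide flip: diff_divide_distrib)
      also have "\<dots> \<le> m" using order_trans[OF close[OF \<open>c \<in> J\<close> c0, of k] mult_right_mono[OF m(3)]] assms(1)
        by (simp add: pos_divide_le_eq)
      finally show "cells \<delta> (v c) k \<in> {\<lfloor>v c0 k / \<delta>\<rfloor> - m..\<lfloor>v c0 k / \<delta>\<rfloor> + m}"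
        unfolding cells_def atLeastAtMost_iff by linarith
    qed simp
    have "finite W" unfolding W_def by (intro finite_PiE) auto
    moreover have "card W = nat (2 * m + 1) ^ CARD('k)"
      unfolding W_def by (subst card_PiE) (auto simp: prod_constant)
    moreover have "real (nat (2 * m + 1) ^ CARD('k)) \<le> (2 * R + 3) ^ CARD('k)"
      using m by simp
    ultimately show ?thesis
      using sub finite_subset[OF sub] card_mono[OF \<open>finite W\<close> sub] by (auto intro: order_trans[OF of_nat_mono])
  qed (use assms in simp)
  then show "finite ((\<lambda>c. cells \<delta> (v c)) ` J)"
    "real (card ((\<lambda>c. cells \<delta> (v c)) ` J)) \<le> (2 * R + 3) ^ CARD('k)" by auto
qed

lemma abs_entry_le_infnorm: "\<bar>x $ i $ j\<bar> \<le> infnorm x" for x :: "real^4^4"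
proof -
  have "axis i (axis j 1) \<in> (Basis :: (real^4^4) set)" by (auto simp: Basis_vec_def)
  from Basis_le_infnorm[OF this, of x] show ?thesis by (simp add: inner_axis)
qed

lemma infnorm_le_entries: "(\<And>i j. \<bar>x $ i $ j\<bar> \<le> r) \<Longrightarrow> infnorm x \<le> r" for x :: "real^4^4"
  unfolding infnorm_Max by (subst Max_le_iff) (auto simp: Basis_vec_def inner_axis)

lemma covering_number_le_cells:
  assumes "\<delta> > 0" "finite (mcell \<delta> ` A)"
  shows "covering_number \<delta> A \<le> card (mcell \<delta> ` A)"
proof -
  define rep where "rep c = (SOME x. x \<in> A \<and> mcell \<delta> x = c)" for c
  have rep: "rep (mcell \<delta> x) \<in> A \<and> mcell \<delta> (rep (mcell \<delta> x)) = mcell \<delta> x" if "x \<in> A" for x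
    unfolding rep_def by (rule someI[of _ x]) (use that in auto)
  let ?C = "rep ` mcell \<delta> ` A"
  have "A \<subseteq> (\<Union>c\<in>?C. {x. infnorm (x - c) \<le> \<delta>})"
  proof
    fix x assume "x \<in> A"
    have "infnorm (x - rep (mcell \<delta> x)) \<le> \<delta>"
      using mcell_eq_close[OF assms(1), of x "rep (mcell \<delta> x)"] rep[OF \<open>x \<in> A\<close>]
      by (intro infnorm_le_entries) simp
    then show "x \<in> (\<Union>c\<in>?C. {x. infnorm (x - c) \<le> \<delta>})" using \<open>x \<in> A\<close> by blast
  qed
  then have "covering_number \<delta> A \<le> card ?C"
    unfolding covering_number_def using assms(2) by (intro Least_le exI[of _ ?C]) auto
  also have "\<dots> \<le> card (mcell \<delta> ` A)" using assms(2) by (rule card_image_le)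
  finally show ?thesis .
qed

text \<open>Two points of a ball of radius \<open>\<delta>\<close> differ by at most \<open>2 * \<delta>\<close> in every entry, so each ball meets at
  most \<open>7 ^ 16\<close> cells.\<close>

lemma cells_le_covering_number:
  assumes "\<delta> > 0" "bounded A"
  shows "finite (mcell \<delta> ` A)" "real (card (mcell \<delta> ` A)) \<le> 7 ^ 16 * real (covering_number \<delta> A)"
proof -
  obtain C where C: "finite C" "card C = covering_number \<delta> A" "A \<subseteq> (\<Union>c\<in>C. {x. infnorm (x - c) \<le> \<delta>})"
    using covering_number_attained[OF assms(2,1)] by blast
  define J where "J c = {x \<in> A. infnorm (x - c) \<le> \<delta>}" for c
  have "\<bar>x $ fst k $ snd k - y $ fst k $ snd k\<bar> \<le> 2 * \<delta>" if "x \<in> J c" "y \<in> J c" for x y c k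
  proof -
    have "\<bar>z $ fst k $ snd k - c $ fst k $ snd k\<bar> \<le> \<delta>" if "z \<in> J c" for z
      using that abs_entry_le_infnorm[of "z - c" "fst k" "snd k"] by (simp add: J_def)
    from this[OF that(1)] this[OF that(2)] show ?thesis by linarith
  qed
  from card_cells[of \<delta> 2 "J _" "\<lambda>x k. x $ fst k $ snd k", OF assms(1) _ this]
  have J: "finite (mcell \<delta> ` J c)" "real (card (mcell \<delta> ` J c)) \<le> 7 ^ 16" for c
    by (simp_all add: mcell_def)
  have A: "mcell \<delta> ` A = (\<Union>c\<in>C. mcell \<delta> ` J c)" using C(3) unfolding J_def by blast
  show "finite (mcell \<delta> ` A)" unfolding A using C(1) J(1) by blast
  have "real (card (mcell \<delta> ` A)) \<le> (\<Sum>c\<in>C. real (card (mcell \<delta> ` J c)))"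
    unfolding A of_nat_sum[symmetric] by (intro of_nat_mono card_UN_le C(1))
  also have "\<dots> \<le> (\<Sum>c\<in>C. 7 ^ 16)" by (intro sum_mono J(2))
  finally show "real (card (mcell \<delta> ` A)) \<le> 7 ^ 16 * real (covering_number \<delta> A)" by (simp add: C(2))
qed

lemma bounded_proj_image:
  assumes "bounded X" "X \<subseteq> rep q"
  shows "bounded (proj_u q 0 (uni q r s) ` X)"
proof -
  have "linear (\<lambda>x. trunc (Ad (uni q r s) x))"
    by (rule linearI)
      (simp_all add: trunc_def Ad_def vec_eq_iff matrix_matrix_mult_def sum_4 algebra_simps)
  then have "bounded ((\<lambda>x. trunc (Ad (uni q r s) x)) ` X)"
    using assms(1) by (intro bounded_linear_image) (auto simp: linear_conv_bounded_linear)
  moreover have "proj_u q 0 (uni q r s) x = trunc (Ad (uni q r s) x)" if "x \<in> X" for x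
    using that assms(2) by (auto simp: proj_u_def orth_proj_eq_trunc Ad_uni_rep)
  ultimately show ?thesis by (simp cong: image_cong)
qed

lemma rep_diff: "x \<in> rep q \<Longrightarrow> y \<in> rep q \<Longrightarrow> x - y \<in> rep q"
  by (simp add: rep_iff trace_def matrix_diff_rdistrib transpose_def vec_eq_iff sum_subtractf)

lemma abs_form_val_chord_commute:
  "\<bar>form_val q (chord q p' p a) (chord q p' p b) x\<bar> = \<bar>form_val q (chord q p p' a) (chord q p p' b) x\<bar>"
proof -
  have minus: "form_val q (- v) w x = - form_val q v w x" "form_val q v (- w) x = - form_val q v w x" for v w
    using form_val_linear(3)[of q "-1" v w x] form_val_linear(4)[of q v "-1" w x] by simp_all
  show ?thesis
    unfolding chord_commute[of q p' p a] chord_commute[of q p' p b] by (simp add: minus)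
qed

text \<open>Dominates \<open>\<kappa> * (2 * R + 3)\<close> for the three radii \<open>R\<close> that occur in the next lemma: \<open>33 * frame_const 2 / \<kappa>\<close>,
  \<open>frame_const 3 / \<kappa>\<close> and \<open>528\<close>.\<close>

definition count_const :: real where
  "count_const = 66 * frame_const 2 + 2 * frame_const 3 + 1059"

lemma frame_const_nonneg: "frame_const m \<ge> 0"
  unfolding frame_const_def by (intro mult_nonneg_nonneg zero_le_power) auto

text \<open>The Brascamp-Lieb type inequality at scale \<open>\<delta>\<close>. The cells \<open>c\<close> common to the six sets have a
  representative in each set, and all of them agree with \<open>x c\<close> up to \<open>\<delta>\<close>. So the rounded projections
  play the part of \<open>a\<close> and \<open>b\<close> in \<open>card_power4_le\<close>, and the rounded restrictions to the three planes
  that of \<open>g\<close>; the determinants bound the fibres.\<close>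

lemma projection_count:
  fixes p :: "nat \<Rightarrow> real \<times> real" and X :: "nat \<Rightarrow> (real^4^4) set"
  assumes "\<delta> > 0" and \<kappa>: "0 < \<kappa>" "\<kappa> \<le> 1"
    and p: "\<And>i. i < 6 \<Longrightarrow> p i \<in> square" and X: "\<And>i. i < 6 \<Longrightarrow> X i \<subseteq> rep q" "\<And>i. i < 6 \<Longrightarrow> bounded (X i)"
    and triple: "\<kappa> \<le> \<bar>frame_det q 3 (\<lambda>j. chord q (p (2 * j)) (p (2 * j + 1)))\<bar>"
    and pair: "\<And>j. j < 3 \<Longrightarrow> \<kappa> \<le> \<bar>frame_det q 2 (\<lambda>k. tangent q (p (2 * j + k)))\<bar>"
  defines "P \<equiv> \<lambda>i. proj_u q 0 (uni q (fst (p i)) (snd (p i)))"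
  shows "real (card (\<Inter>i<6. mcell \<delta> ` X i)) ^ 4 \<le> (count_const / \<kappa>) ^ 160 *
    (\<Prod>j<3. real (card (mcell \<delta> ` P (2 * j) ` X (2 * j))) * real (card (mcell \<delta> ` P (2 * j + 1) ` X (2 * j + 1))))"
proof (cases "(\<Inter>i<6. mcell \<delta> ` X i) = {}")
  case True
  have "(0::real) ^ 4 \<le> (count_const / \<kappa>) ^ 160 *
    (\<Prod>j<3. real (card (mcell \<delta> ` P (2 * j) ` X (2 * j))) * real (card (mcell \<delta> ` P (2 * j + 1) ` X (2 * j + 1))))"
    using \<kappa> frame_const_nonneg[of 2] frame_const_nonneg[of 3]
    by (simp add: count_const_def) (intro mult_nonneg_nonneg prod_nonneg zero_le_power divide_nonneg_pos; simp)
  then show ?thesis by (simp only: True card.empty of_nat_0)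
next
  case False
  define I where "I = (\<Inter>i<6. mcell \<delta> ` X i)"
  define \<xi> where "\<xi> i c = (SOME x. x \<in> X i \<and> mcell \<delta> x = c)" for i c
  have \<xi>: "\<xi> i c \<in> X i" "mcell \<delta> (\<xi> i c) = c" if "c \<in> I" "i < 6" for i c
  proof -
    have "\<exists>x. x \<in> X i \<and> mcell \<delta> x = c" using that by (auto simp: I_def)
    from someI_ex[OF this] show "\<xi> i c \<in> X i" "mcell \<delta> (\<xi> i c) = c" by (auto simp: \<xi>_def)
  qed
  define x where "x c = \<xi> 0 c" for c
  define F where "F i c = mcell \<delta> (P i (\<xi> i c))" for i c
  define t where "t i = tangent q (p i)" for i
  define h where "h j = chord q (p (2 * j)) (p (2 * j + 1))" for j
  define g where "g j c = cells \<delta> (\<lambda>ab. form_val q (h j (fst ab)) (h j (snd ab)) (x c))" for j c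
  define K where "K = (count_const / \<kappa>) ^ 16"
  have K: "(2 * R + 3) ^ 16 \<le> K" if "0 \<le> R" "2 * R \<le> (66 * frame_const 2 + 2 * frame_const 3 + 1056) / \<kappa>" for R
  proof -
    have "2 * R + 3 \<le> (66 * frame_const 2 + 2 * frame_const 3 + 1056) / \<kappa> + 3 / \<kappa>"
      using that \<kappa> by (intro add_mono) (auto simp: field_simps)
    also have "\<dots> = count_const / \<kappa>" by (simp add: count_const_def add_divide_distrib)
    finally show ?thesis unfolding K_def using that by (intro power_mono) auto
  qed
  have fin: "finite I"
  proof (rule finite_subset)
    show "I \<subseteq> mcell \<delta> ` X 0" by (auto simp: I_def)
    show "finite (mcell \<delta> ` X 0)" by (rule cells_le_covering_number(1)[OF \<open>\<delta> > 0\<close> X(2)]) simp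
  qed
  have xX: "x c \<in> rep q" "mcell \<delta> (x c) = c" if "c \<in> I" for c
    using \<xi>[OF that, of 0] X(1)[of 0] by (auto simp: x_def)
  \<comment> \<open>33 = 1 + 2 * 16: the projections agree up to \<open>\<delta>\<close> by rounding, and each replacement of \<open>\<xi> i\<close> by \<open>x\<close> costs \<open>16 * \<delta>\<close>.\<close>
  have tangent_close: "\<bar>form_val q (t i a) (t i b) (x c - x c')\<bar> \<le> 33 * \<delta>"
    if "c \<in> I" "c' \<in> I" "i < 6" "F i c = F i c'" for i a b c c'
  proof -
    have near: "\<bar>form_val q (t i a) (t i b) (\<xi> i c - x c)\<bar> \<le> 16 * \<delta>" if "c \<in> I" for c
    proof (rule form_val_bound)
      show "\<bar>(\<xi> i c - x c) $ k $ l\<bar> \<le> \<delta>" for k l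
        using mcell_eq_close[OF \<open>\<delta> > 0\<close>, of "\<xi> i c" "x c" k l] \<xi>(2)[OF that \<open>i < 6\<close>] xX(2)[OF that] by simp
    qed (simp_all add: t_def tangent_bound p \<open>i < 6\<close>)
    have "\<bar>form_val q (t i a) (t i b) (\<xi> i c - \<xi> i c')\<bar> \<le> \<delta>"
      unfolding t_def
    proof (rule form_val_tangent_diff)
      show "\<bar>proj_u q 0 (uni q (fst (p i)) (snd (p i))) (\<xi> i c) $ k $ l -
          proj_u q 0 (uni q (fst (p i)) (snd (p i))) (\<xi> i c') $ k $ l\<bar> \<le> \<delta>" for k l
        using mcell_eq_close[OF \<open>\<delta> > 0\<close>, of "P i (\<xi> i c)" "P i (\<xi> i c')" k l] that(4)
        by (simp add: F_def P_def)
    qed (use \<xi>(1) X(1) that in blast)+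
    then show ?thesis
      using near[OF that(1)] near[OF that(2)] by (simp add: form_val_linear)
  qed
  have card_fibre: "real (card J) \<le> K"
    if J: "J \<subseteq> I" and "R \<ge> 0" "2 * R \<le> (66 * frame_const 2 + 2 * frame_const 3 + 1056) / \<kappa>"
      and close: "\<And>c c' k l. c \<in> J \<Longrightarrow> c' \<in> J \<Longrightarrow> \<bar>(x c - x c') $ k $ l\<bar> \<le> R * \<delta>" for J R
  proof -
    have "(\<lambda>c. cells \<delta> (\<lambda>ij. x c $ fst ij $ snd ij)) ` J = J"
      using J xX(2) by (force simp: mcell_def)
    then show ?thesis
      using card_cells(2)[OF \<open>\<delta> > 0\<close> \<open>R \<ge> 0\<close>, of J "\<lambda>c ij. x c $ fst ij $ snd ij"] close K[OF that(2,3)] by simp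
  qed
  have divide_bound: "\<bar>z $ k $ l\<bar> \<le> frame_const m * s / \<kappa> * \<delta>"
    if "z \<in> rep q" "\<kappa> \<le> \<bar>frame_det q m G\<bar>" "\<And>k a i. k < m \<Longrightarrow> \<bar>G k a $ i\<bar> \<le> 4" "s > 0"
      "\<And>k a b. k < m \<Longrightarrow> \<bar>form_val q (G k a) (G k b) z\<bar> \<le> s * \<delta>" for z k l m s G
  proof -
    have "\<bar>z $ k $ l\<bar> * \<kappa> \<le> \<bar>z $ k $ l\<bar> * \<bar>frame_det q m G\<bar>"
      using that(2) by (intro mult_left_mono) auto
    also have "\<dots> \<le> frame_const m * (s * \<delta>)"
      using that \<open>\<delta> > 0\<close> by (intro frame_bounds(2)) auto
    finally show ?thesis using \<kappa> by (simp add: field_simps)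
  qed
  have "real (card I) ^ 4 \<le> K ^ 10 * (\<Prod>j<3. real (card (F (2 * j) ` I)) * real (card (F (2 * j + 1) ` I)))"
  proof (rule card_power4_le[where g = g])
    show "finite I" "I \<noteq> {}" using fin False by (auto simp: I_def)
    have "K \<ge> (2 * 0 + 3) ^ 16"
      using \<kappa> frame_const_nonneg[of 2] frame_const_nonneg[of 3] by (intro K) auto
    then show "K > 0" by simp
    fix c assume c: "c \<in> I"
    fix j :: nat assume j: "j < 3"
    show "real (card {c' \<in> I. F (2 * j) c' = F (2 * j) c \<and> F (2 * j + 1) c' = F (2 * j + 1) c}) \<le> K"
    proof (rule card_fibre)
      show "2 * (frame_const 2 * 33 / \<kappa>) \<le> (66 * frame_const 2 + 2 * frame_const 3 + 1056) / \<kappa>"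
        using \<kappa> frame_const_nonneg[of 3] by (simp add: divide_simps)
      fix c1 c2 k l
      assume c12: "c1 \<in> {c' \<in> I. F (2 * j) c' = F (2 * j) c \<and> F (2 * j + 1) c' = F (2 * j + 1) c}"
        "c2 \<in> {c' \<in> I. F (2 * j) c' = F (2 * j) c \<and> F (2 * j + 1) c' = F (2 * j + 1) c}"
      show "\<bar>(x c1 - x c2) $ k $ l\<bar> \<le> frame_const 2 * 33 / \<kappa> * \<delta>"
      proof (rule divide_bound)
        show "x c1 - x c2 \<in> rep q" using c12 xX by (auto intro: rep_diff)
        show "\<kappa> \<le> \<bar>frame_det q 2 (\<lambda>k. tangent q (p (2 * j + k)))\<bar>" by (rule pair[OF j])
        fix k' a b i assume k': "k' < (2::nat)"
        have "\<bar>tangent q (p (2 * j + k')) a $ i\<bar> \<le> 1" using j k' by (intro tangent_bound p) simp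
        then show "\<bar>tangent q (p (2 * j + k')) a $ i\<bar> \<le> 4" by simp
        have "F (2 * j + k') c1 = F (2 * j + k') c2" using c12 k' by (auto simp: less_2_cases_iff)
        then show "\<bar>form_val q (tangent q (p (2 * j + k')) a) (tangent q (p (2 * j + k')) b) (x c1 - x c2)\<bar> \<le> 33 * \<delta>"
          using c12 j k' tangent_close[of c1 c2 "2 * j + k'" a b] by (simp add: t_def)
      qed simp
    qed (use \<kappa> frame_const_nonneg[of 2] in auto)
    have g_bound: "real (card (g j ` {c' \<in> I. F i c' = F i c})) \<le> K"
      if i: "i = 2 * j \<or> i = 2 * j + 1" for i
    proof -
      have "\<bar>form_val q (h j (fst k)) (h j (snd k)) (x c1) - form_val q (h j (fst k)) (h j (snd k)) (x c2)\<bar> \<le> 528 * \<delta>"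
        if c12: "c1 \<in> {c' \<in> I. F i c' = F i c}" "c2 \<in> {c' \<in> I. F i c' = F i c}" for c1 c2 k
      proof -
        have sq: "p (2 * j) \<in> square" "p (2 * j + 1) \<in> square" using p j by auto
        have tc: "\<bar>form_val q (t i a) (t i b) (x c1 - x c2)\<bar> \<le> 33 * \<delta>" for a b
          using i j c12 by (intro tangent_close) auto
        have "\<bar>form_val q (h j (fst k)) (h j (snd k)) (x c1 - x c2)\<bar> \<le> 16 * (33 * \<delta>)"
          using i
        proof
          assume "i = 2 * j"
          then show ?thesis using tc unfolding h_def t_def by (intro form_val_chord_bound sq) auto
        next
          assume "i = 2 * j + 1"
          then show ?thesis using tc unfolding h_def t_def
            by (subst abs_form_val_chord_commute, intro form_val_chord_bound sq) auto
        qed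
        then show ?thesis by (simp add: form_val_linear)
      qed
      then have "real (card (g j ` {c' \<in> I. F i c' = F i c})) \<le> (2 * 528 + 3) ^ CARD(4 \<times> 4)"
        unfolding g_def by (intro card_cells(2) \<open>\<delta> > 0\<close>) auto
      also have "(2 * 528 + 3) ^ CARD(4 \<times> 4) = (2 * 528 + 3 :: real) ^ 16" by simp
      also have "\<dots> \<le> K"
      proof (rule K)
        have "1056 \<le> 1056 / \<kappa>" using \<kappa> by (simp add: field_simps)
        also have "\<dots> \<le> (66 * frame_const 2 + 2 * frame_const 3 + 1056) / \<kappa>"
          using \<kappa> frame_const_nonneg[of 2] frame_const_nonneg[of 3] by (intro divide_right_mono) auto
        finally show "2 * 528 \<le> (66 * frame_const 2 + 2 * frame_const 3 + 1056) / \<kappa>" by simp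
      qed simp
      finally show ?thesis .
    qed
    show "real (card (g j ` {c' \<in> I. F (2 * j) c' = F (2 * j) c})) \<le> K"
      "real (card (g j ` {c' \<in> I. F (2 * j + 1) c' = F (2 * j + 1) c})) \<le> K"
      by (intro g_bound; simp)+
  next
    fix c assume c: "c \<in> I"
    show "real (card {c' \<in> I. \<forall>j<3. g j c' = g j c}) \<le> K"
    proof (rule card_fibre)
      show "2 * (frame_const 3 * 1 / \<kappa>) \<le> (66 * frame_const 2 + 2 * frame_const 3 + 1056) / \<kappa>"
        using \<kappa> frame_const_nonneg[of 2] by (simp add: divide_simps)
      fix c1 c2 k l
      assume c12: "c1 \<in> {c' \<in> I. \<forall>j<3. g j c' = g j c}" "c2 \<in> {c' \<in> I. \<forall>j<3. g j c' = g j c}"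
      show "\<bar>(x c1 - x c2) $ k $ l\<bar> \<le> frame_const 3 * 1 / \<kappa> * \<delta>"
      proof (rule divide_bound)
        show "x c1 - x c2 \<in> rep q" using c12 xX by (auto intro: rep_diff)
        show "\<kappa> \<le> \<bar>frame_det q 3 h\<bar>" using triple by (simp add: h_def[abs_def])
        fix j a b i assume j: "j < (3::nat)"
        show "\<bar>h j a $ i\<bar> \<le> 4" unfolding h_def using j by (intro chord_bound p) auto
        have "g j c1 = g j c2" using c12 j by auto
        then show "\<bar>form_val q (h j a) (h j b) (x c1 - x c2)\<bar> \<le> 1 * \<delta>"
          using cells_eq_close[OF \<open>\<delta> > 0\<close>, of _ _ "(a, b)"] unfolding g_def by (fastforce simp: form_val_linear)
      qed simp
    qed (use \<kappa> frame_const_nonneg[of 3] in auto)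
  qed
  also have "K ^ 10 = (count_const / \<kappa>) ^ 160" by (simp add: K_def flip: power_mult)
  also have "(count_const / \<kappa>) ^ 160 * (\<Prod>j<3. real (card (F (2 * j) ` I)) * real (card (F (2 * j + 1) ` I)))
    \<le> (count_const / \<kappa>) ^ 160 *
    (\<Prod>j<3. real (card (mcell \<delta> ` P (2 * j) ` X (2 * j))) * real (card (mcell \<delta> ` P (2 * j + 1) ` X (2 * j + 1))))"
  proof (intro mult_left_mono prod_mono conjI mult_mono of_nat_mono)
    have "card (F i ` I) \<le> card (mcell \<delta> ` P i ` X i)" if "i < 6" for i
    proof (rule card_mono)
      show "finite (mcell \<delta> ` P i ` X i)"
        unfolding P_def using X that by (intro cells_le_covering_number(1)[OF \<open>\<delta> > 0\<close>] bounded_proj_image)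
      show "F i ` I \<subseteq> mcell \<delta> ` P i ` X i" using \<xi>(1) that by (auto simp: F_def)
    qed
    then show "card (F (2 * j) ` I) \<le> card (mcell \<delta> ` P (2 * j) ` X (2 * j))"
      "card (F (2 * j + 1) ` I) \<le> card (mcell \<delta> ` P (2 * j + 1) ` X (2 * j + 1))" if "j \<in> {..<3}" for j
      using that by auto
  qed (use \<kappa> frame_const_nonneg[of 2] frame_const_nonneg[of 3] in \<open>auto simp: count_const_def\<close>)
  finally show ?thesis by (simp only: I_def)
qed

section \<open>The exceptional set\<close>

lemma outer_measure_le_plane:
  assumes B: "B \<in> sets borel" and E: "E \<subseteq> uni_ball q" "\<And>r s. uni q r s \<in> E \<Longrightarrow> (r, s) \<in> B"
  shows "outer_measure_of (haar_U q) E \<le> emeasure lborel B / 4"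
proof -
  let ?R = "restrict_space borel (uni_group q)"
  define Y where "Y = {x \<in> uni_group q. (x$1$2, x$1$3) \<in> B}"
  have "(\<lambda>x :: real^4^4. (x$1$2, x$1$3)) \<in> ?R \<rightarrow>\<^sub>M borel"
    by (intro measurable_restrict_space1 measurable_coords)
  from measurable_sets[OF this B] have Y: "Y \<in> sets ?R"
    by (simp add: Y_def space_restrict_space vimage_def Int_def conj_commute)
  have "E \<subseteq> Y" using E by (auto simp: Y_def uni_ball_def uni_group_def)
  moreover have "Y \<in> sets (haar_U q)" using Y by (simp add: haar_U_eq haar_coord_def)
  ultimately have "outer_measure_of (haar_U q) E \<le> emeasure (haar_U q) Y"
    unfolding outer_measure_of_def by (intro INF_lower) auto
  also have "\<dots> = emeasure lborel {p. uni q (fst p) (snd p) \<in> Y} / 4"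
    using emeasure_haar_coord[OF Y] by (simp add: haar_U_eq)
  also have "{p. uni q (fst p) (snd p) \<in> Y} = B" by (auto simp: Y_def uni_group_def)
  finally show ?thesis .
qed

lemma config_det_witness: "config_det q witness \<noteq> 0"
  using witness_triple witness_pair by (simp add: config_det_def prod_zero_iff)

text \<open>Since no factor of \<open>config_det\<close> exceeds \<open>b\<close>, a lower bound for the product bounds each factor.\<close>

lemma config_det_factors:
  fixes b :: real
  assumes p: "\<And>i. i < 6 \<Longrightarrow> p i \<in> square" and b: "1 \<le> b" "frame_const 2 \<le> b" "frame_const 3 \<le> b"
    and "\<kappa> * b ^ 3 \<le> \<bar>config_det q p\<bar>"
  shows "\<kappa> \<le> \<bar>frame_det q 3 (\<lambda>j. chord q (p (2 * j)) (p (2 * j + 1)))\<bar>"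
    and "\<And>j. j < 3 \<Longrightarrow> \<kappa> \<le> \<bar>frame_det q 2 (\<lambda>k. tangent q (p (2 * j + k)))\<bar>"
proof -
  let ?T = "\<bar>frame_det q 3 (\<lambda>j. chord q (p (2 * j)) (p (2 * j + 1)))\<bar>"
  let ?P = "\<lambda>j. \<bar>frame_det q 2 (\<lambda>k. tangent q (p (2 * j + k)))\<bar>"
  have T: "?T \<le> b"
  proof (rule order_trans[OF frame_bounds(1) b(3)])
    show "\<bar>chord q (p (2 * j)) (p (2 * j + 1)) a $ i\<bar> \<le> 4" if "j < 3" for j a i
      using that by (intro chord_bound p) auto
  qed
  have P: "?P j \<le> b" if "j < 3" for j
  proof (rule order_trans[OF frame_bounds(1) b(2)])
    fix k a i assume "k < (2::nat)"
    then have "\<bar>tangent q (p (2 * j + k)) a $ i\<bar> \<le> 1" using that by (intro tangent_bound p) auto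
    then show "\<bar>tangent q (p (2 * j + k)) a $ i\<bar> \<le> 4" by simp
  qed
  have D: "\<bar>config_det q p\<bar> = ?T * (?P 0 * ?P 1 * ?P 2)"
    by (simp add: config_det_def abs_mult numeral_3_eq_3 numeral_2_eq_2 lessThan_Suc mult_ac)
  have cube: "\<kappa> \<le> z" if "\<bar>config_det q p\<bar> = z * (z1 * z2 * z3)" "0 \<le> z" "0 \<le> z1" "z1 \<le> b" "0 \<le> z2" "z2 \<le> b" "0 \<le> z3" "z3 \<le> b"
    for z z1 z2 z3
  proof -
    have "z1 * z2 * z3 \<le> b * b * b" using that b(1) by (intro mult_mono mult_nonneg_nonneg) auto
    then have "z * (z1 * z2 * z3) \<le> z * b ^ 3"
      using that(2) by (simp add: power3_eq_cube mult_left_mono)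
    then have "\<kappa> * b ^ 3 \<le> z * b ^ 3" using assms(5) that(1) by linarith
    then show ?thesis using b(1) by (simp add: mult_le_cancel_right)
  qed
  define T where "T = ?T"
  define P0 where "P0 = ?P 0"
  define P1 where "P1 = ?P 1"
  define P2 where "P2 = ?P 2"
  have D': "\<bar>config_det q p\<bar> = T * (P0 * P1 * P2)" unfolding D T_def P0_def P1_def P2_def ..
  have nn: "0 \<le> T" "0 \<le> P0" "0 \<le> P1" "0 \<le> P2" by (simp_all add: T_def P0_def P1_def P2_def)
  have le: "T \<le> b" "P0 \<le> b" "P1 \<le> b" "P2 \<le> b"
    unfolding T_def P0_def P1_def P2_def by (rule T P; simp)+
  have "\<kappa> \<le> T" using D' nn le by (intro cube[of T P0 P1 P2]) auto
  then show "\<kappa> \<le> ?T" by (simp only: T_def)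
  have "\<kappa> \<le> P0" using D' nn le by (intro cube[of P0 T P1 P2]) (auto simp: mult_ac)
  moreover have "\<kappa> \<le> P1" using D' nn le by (intro cube[of P1 T P0 P2]) (auto simp: mult_ac)
  moreover have "\<kappa> \<le> P2" using D' nn le by (intro cube[of P2 T P0 P1]) (auto simp: mult_ac)
  ultimately have "\<kappa> \<le> ?P 0" "\<kappa> \<le> ?P 1" "\<kappa> \<le> ?P 2" by (simp_all only: P0_def P1_def P2_def)
  then show "\<kappa> \<le> ?P j" if "j < 3" for j
    using that by (auto simp: less_Suc_eq numeral_3_eq_3 numeral_2_eq_2)
qed

lemma bounded_rep_ball: "bounded (rep_ball q)"
  unfolding bounded_iff
proof (intro exI ballI)
  fix x assume "x \<in> rep_ball q"
  then have "sqrt DIM(real^4^4) * infnorm x \<le> sqrt DIM(real^4^4) * 1"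
    by (intro mult_left_mono) (auto simp: rep_ball_def)
  then show "norm x \<le> sqrt DIM(real^4^4)" using norm_le_infnorm[of x] by linarith
qed

text \<open>The exceptional set with \<open>t\<close> in place of \<open>\<delta> powr \<epsilon>\<close>. The estimate below is uniform in \<open>\<delta>\<close> once \<open>t\<close> is small, so
  the scale and the loss can be treated as independent parameters.\<close>

definition exc_set :: "form \<Rightarrow> nat \<Rightarrow> real \<Rightarrow> real \<Rightarrow> (real^4^4) set \<Rightarrow> (real^4^4) set" where
  "exc_set q M t \<delta> A = {u \<in> uni_ball q. \<exists>A'\<subseteq>A.
     real (covering_number \<delta> A') \<ge> t * real (covering_number \<delta> A) \<and>
     real (covering_number \<delta> (proj_u q 0 u ` A')) < t ^ M * real (covering_number \<delta> A) powr (6/9)}"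

text \<open>The choices are \<open>N \<approx> t ^ (-2)\<close> points, so that \<open>N * t / 7 ^ 16 \<ge> 12\<close> in \<open>common_elements\<close>, and \<open>\<eta> = t ^ 12\<close>, so
  that the sublevel sets avoided in \<open>generic_list\<close>, at most \<open>6 * N ^ 5 \<le> 192 * t ^ (-10)\<close> many of measure at most
  \<open>8 * n * \<eta>\<close>, have total measure at most \<open>t\<close>.\<close>

lemma generic_exceptional_tuple:
  assumes n: "multi_poly n (config_det q)" and t: "0 < t" "1536 * real n * t \<le> 1" "12 * 7 ^ 16 * t \<le> 1"
    and "\<delta> > 0" and A: "A \<subseteq> rep_ball q" "A \<noteq> {}" and big: "outer_measure_of (haar_U q) (exc_set q M t \<delta> A) > ennreal t"
  obtains p :: "nat \<Rightarrow> real \<times> real" and X :: "nat \<Rightarrow> (real^4^4) set" where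
    "\<And>i. i < 6 \<Longrightarrow> p i \<in> square \<and> X i \<subseteq> A \<and>
      real (covering_number \<delta> (proj_u q 0 (uni q (fst (p i)) (snd (p i))) ` X i))
        < t ^ M * real (covering_number \<delta> A) powr (6/9)"
    "\<bar>config_det q witness\<bar> / (2 * 25 ^ n) ^ 6 * t ^ (144 * n) \<le> \<bar>config_det q p\<bar>"
    "t ^ 13 * real (covering_number \<delta> A) \<le> 128 * 7 ^ 16 * real (card (\<Inter>i<6. mcell \<delta> ` X i))"
proof -
  define E where "E = {z \<in> square. uni q (fst z) (snd z) \<in> exc_set q M t \<delta> A}"
  have E_square: "E \<subseteq> square" by (auto simp: E_def)
  define N where "N = nat \<lceil>1 / t\<^sup>2\<rceil>"
  define \<eta> where "\<eta> = t ^ 12"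
  have t1: "t \<le> 1" using t by simp
  have bA: "bounded A" by (rule bounded_subset[OF bounded_rep_ball A(1)])
  have N: "1 / t\<^sup>2 \<le> real N" "real N \<le> 2 / t\<^sup>2" "1 \<le> real N"
  proof -
    have "1 \<le> 1 / t\<^sup>2" using t t1 by (simp add: power_le_one)
    then show "1 / t\<^sup>2 \<le> real N" "real N \<le> 2 / t\<^sup>2" "1 \<le> real N" unfolding N_def by linarith+
  qed
  have "\<exists>L. length L = N \<and> set L \<subseteq> E \<and> (\<forall>qs. subseq qs L \<and> length qs \<le> Suc 5 \<longrightarrow>
     \<bar>config_det q witness\<bar> * (1 / (2 * ((5 / \<eta>) ^ n)\<^sup>2)) ^ length qs \<le> \<bar>config_det q (overwrite witness qs)\<bar>)"
  proof (rule generic_list[OF n])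
    show "witness i \<in> square" for i by (rule witness_square)
    show "0 < \<eta>" "\<eta> \<le> 1" using t t1 by (simp_all add: \<eta>_def power_le_one)
    show "config_det q witness \<noteq> 0" by (rule config_det_witness)
    show "E \<subseteq> square" by (rule E_square)
    fix B assume B: "B \<in> sets borel" "E \<subseteq> B"
    have "outer_measure_of (haar_U q) (exc_set q M t \<delta> A) \<le> emeasure lborel B / 4"
    proof (rule outer_measure_le_plane[OF B(1)])
      show "exc_set q M t \<delta> A \<subseteq> uni_ball q" by (auto simp: exc_set_def)
      show "(r, s) \<in> B" if "uni q r s \<in> exc_set q M t \<delta> A" for r s
      proof -
        have "uni q r s \<in> uni_ball q" using that by (simp add: exc_set_def)
        then have "(r, s) \<in> square" by (auto simp: uni_ball_def abs_le_iff)
        then have "(r, s) \<in> E" using that by (simp add: E_def)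
        then show ?thesis using B(2) by blast
      qed
    qed
    then have "ennreal t < emeasure lborel B / 4" using big by (rule order.strict_trans2[rotated])
    also have "\<dots> \<le> emeasure lborel B * 4 / 4"
      using mult_left_mono[of 1 4 "emeasure lborel B"] by (intro divide_right_mono_ennreal) simp
    also have "\<dots> = emeasure lborel B" by (simp add: ennreal_mult_divide_eq)
    finally have "ennreal t < emeasure lborel B" .
    moreover have "real (\<Sum>i\<le>5. N ^ i) * (8 * real n * \<eta>) \<le> t"
    proof -
      have "real (\<Sum>i\<le>5. N ^ i) = (\<Sum>i\<le>5. real N ^ i)" by simp
      also have "\<dots> \<le> (\<Sum>i\<le>(5::nat). real N ^ 5)"
        using N(3) by (intro sum_mono power_increasing) auto
      also have "\<dots> \<le> 6 * (2 / t\<^sup>2) ^ 5" using N by (simp add: power_mono)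
      finally have "real (\<Sum>i\<le>5. N ^ i) * (8 * real n * \<eta>) \<le> 6 * (2 / t\<^sup>2) ^ 5 * (8 * real n * \<eta>)"
        using t by (intro mult_right_mono) (auto simp: \<eta>_def)
      also have "\<dots> = (1536 * real n * t) * t"
      proof -
        have "(2 / t\<^sup>2) ^ 5 = 32 / t ^ 10" by (simp add: power_divide flip: power_mult)
        moreover have "t ^ 12 = t ^ 10 * t * t" by (simp add: mult.assoc flip: power2_eq_square power_add)
        ultimately show ?thesis using t by (simp add: \<eta>_def)
      qed
      also have "\<dots> \<le> 1 * t" using t by (intro mult_right_mono) auto
      finally show ?thesis by simp
    qed
    ultimately show "ennreal (real (\<Sum>i\<le>5. N ^ i) * (8 * real n * \<eta>)) < emeasure lborel B"
      using ennreal_leI order.strict_trans1 by blast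
  qed
  then obtain L where L: "length L = N" "set L \<subseteq> E" and gen0: "\<And>qs. subseq qs L \<Longrightarrow> length qs \<le> Suc 5 \<Longrightarrow>
     \<bar>config_det q witness\<bar> * (1 / (2 * ((5 / \<eta>) ^ n)\<^sup>2)) ^ length qs \<le> \<bar>config_det q (overwrite witness qs)\<bar>"
    by blast
  have gen: "\<bar>config_det q witness\<bar> * (1 / (2 * ((5 / \<eta>) ^ n)\<^sup>2)) ^ 6 \<le> \<bar>config_det q (overwrite witness qs)\<bar>"
    if "subseq qs L" "length qs = 6" for qs
    using gen0[OF that(1)] that(2) by simp
  let ?P = "\<lambda>z. proj_u q 0 (uni q (fst z) (snd z))"
  let ?a = "real (covering_number \<delta> A)"
  have "\<exists>A'. A' \<subseteq> A \<and> t * ?a \<le> real (covering_number \<delta> A') \<and>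
      real (covering_number \<delta> (?P z ` A')) < t ^ M * ?a powr (6/9)" if "z \<in> E" for z
    using that by (auto simp: E_def exc_set_def)
  then obtain A' where A': "\<And>z. z \<in> E \<Longrightarrow> A' z \<subseteq> A" "\<And>z. z \<in> E \<Longrightarrow> t * ?a \<le> real (covering_number \<delta> (A' z))"
      "\<And>z. z \<in> E \<Longrightarrow> real (covering_number \<delta> (?P z ` A' z)) < t ^ M * ?a powr (6/9)"
    by metis
  define S where "S = mcell \<delta> ` A"
  have S: "finite S" "S \<noteq> {}" "real (card S) \<le> 7 ^ 16 * ?a" "?a \<le> real (card S)"
    using cells_le_covering_number[OF \<open>\<delta> > 0\<close> bA] covering_number_le_cells[OF \<open>\<delta> > 0\<close>, of A] A(2)
    by (auto simp: S_def)
  have "\<exists>qs. subseq qs L \<and> length qs = 6 \<and> t / 7 ^ 16 / 2 * card S \<le>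
      real (length L ^ 6) * card {c \<in> S. \<forall>z\<in>set qs. c \<in> mcell \<delta> ` A' z}"
  proof (rule common_elements[OF S(1,2)])
    show "t / 7 ^ 16 > 0" using t by simp
    have "2 * real 6 \<le> 1 / t\<^sup>2 * (t / 7 ^ 16)"
      using t by (simp add: power2_eq_square field_simps)
    also have "\<dots> \<le> real (length L) * (t / 7 ^ 16)"
      using N(1) t L(1) by (intro mult_right_mono) auto
    finally show "2 * real 6 \<le> real (length L) * (t / 7 ^ 16)" .
    fix z assume "z \<in> set L"
    then have z: "z \<in> E" using L(2) by blast
    have fin: "finite (mcell \<delta> ` A' z)" using A'(1)[OF z] S(1) by (auto simp: S_def intro: finite_subset[OF image_mono])
    have "t / 7 ^ 16 * card S \<le> t / 7 ^ 16 * (7 ^ 16 * ?a)" using S(3) t by (intro mult_left_mono) auto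
    also have "\<dots> = t * ?a" by simp
    also have "\<dots> \<le> real (covering_number \<delta> (A' z))" by (rule A'(2)[OF z])
    also have "\<dots> \<le> real (card (mcell \<delta> ` A' z))"
      by (intro of_nat_mono covering_number_le_cells[OF \<open>\<delta> > 0\<close> fin])
    finally show "mcell \<delta> ` A' z \<subseteq> S \<and> t / 7 ^ 16 * card S \<le> card (mcell \<delta> ` A' z)"
      using A'(1)[OF z] by (auto simp: S_def)
  qed simp
  then obtain qs where qs: "subseq qs L" "length qs = 6"
      "t / 7 ^ 16 / 2 * card S \<le> real (N ^ 6) * card {c \<in> S. \<forall>z\<in>set qs. c \<in> mcell \<delta> ` A' z}"
    using L(1) by blast
  define p where "p = overwrite witness qs"
  have p: "p i \<in> set qs" if "i < 6" for i
  proof -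
    have "rev qs ! i \<in> set (rev qs)" using that qs(2) by (intro nth_mem) simp
    then show ?thesis using that qs(2) by (simp add: p_def overwrite_def)
  qed
  have "set qs \<subseteq> set L" using qs(1) by (auto dest: list_emb_set)
  then have pE: "p i \<in> E" if "i < 6" for i
    using p[OF that] L(2) by blast
  show thesis
  proof (rule that[of p "\<lambda>i. A' (p i)"])
    fix i :: nat assume "i < 6"
    then have "p i \<in> E" by (rule pE)
    then show "p i \<in> square \<and> A' (p i) \<subseteq> A \<and>
        real (covering_number \<delta> (?P (p i) ` A' (p i))) < t ^ M * ?a powr (6/9)"
      using A'(1,3)[OF \<open>p i \<in> E\<close>] E_square by blast
  next
    have "(5 / \<eta>)\<^sup>2 = 25 / t ^ 24" by (simp add: \<eta>_def power_divide flip: power_mult)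
    moreover have "((5 / \<eta>) ^ n)\<^sup>2 = ((5 / \<eta>)\<^sup>2) ^ n" by (simp add: mult.commute flip: power_mult)
    ultimately have "((5 / \<eta>) ^ n)\<^sup>2 = 25 ^ n / t ^ (24 * n)" by (simp add: power_divide flip: power_mult)
    then have inv: "1 / (2 * ((5 / \<eta>) ^ n)\<^sup>2) = t ^ (24 * n) / (2 * 25 ^ n)" by simp
    have "\<bar>config_det q witness\<bar> / (2 * 25 ^ n) ^ 6 * t ^ (144 * n) =
        \<bar>config_det q witness\<bar> * (1 / (2 * ((5 / \<eta>) ^ n)\<^sup>2)) ^ 6"
    proof -
      have "(t ^ (24 * n)) ^ 6 = t ^ (144 * n)" by (simp flip: power_mult)
      then show ?thesis unfolding inv power_divide[of _ _ 6] by simp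
    qed
    also have "\<dots> \<le> \<bar>config_det q p\<bar>" unfolding p_def by (rule gen[OF qs(1,2)])
    finally show "\<bar>config_det q witness\<bar> / (2 * 25 ^ n) ^ 6 * t ^ (144 * n) \<le> \<bar>config_det q p\<bar>" .
  next
    let ?I = "\<Inter>i<6. mcell \<delta> ` A' (p i)"
    let ?J = "{c \<in> S. \<forall>z\<in>set qs. c \<in> mcell \<delta> ` A' z}"
    have "?I \<subseteq> mcell \<delta> ` A' (p 0)" by auto
    also have "\<dots> \<subseteq> S" unfolding S_def by (intro image_mono A'(1) pE) simp
    finally have "?I \<subseteq> S" .
    then have "card ?J \<le> card ?I" using p S(1) by (intro card_mono finite_subset[of ?I S]) auto
    define c :: real where "c = 7 ^ 16"
    have c: "c > 0" by (simp add: c_def)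
    have "t ^ 13 * ?a \<le> t ^ 13 * card S" using S(4) t by (intro mult_left_mono) auto
    also have "\<dots> = 2 * c * t ^ 12 * (t / c / 2 * card S)"
    proof -
      have "t ^ 13 = t ^ 12 * t" by (simp flip: power_Suc2)
      then show ?thesis using c by simp
    qed
    also have "\<dots> \<le> 2 * c * t ^ 12 * (real (N ^ 6) * card ?J)"
      using qs(3)[folded c_def] t c by (intro mult_left_mono) auto
    also have "\<dots> \<le> 2 * c * t ^ 12 * ((2 / t\<^sup>2) ^ 6 * card ?I)"
    proof (intro mult_left_mono mult_mono)
      show "real (N ^ 6) \<le> (2 / t\<^sup>2) ^ 6" using power_mono[OF N(2), of 6] by simp
    qed (use t c \<open>card ?J \<le> card ?I\<close> in auto)
    also have "(2 / t\<^sup>2) ^ 6 = 64 / t ^ 12" by (simp add: power_divide flip: power_mult)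
    also have "2 * c * t ^ 12 * (64 / t ^ 12 * real (card ?I)) = 128 * 7 ^ 16 * real (card ?I)"
      using t unfolding c_def[symmetric] by simp
    finally show "t ^ 13 * ?a \<le> 128 * 7 ^ 16 * real (card ?I)" .
  qed
qed

lemma covering_number_empty: "covering_number \<delta> {} = 0"
  unfolding covering_number_def by (rule Least_eq_0) (auto intro!: exI[of _ "{}"])

text \<open>For six points as in \<open>generic_exceptional_tuple\<close>, \<open>projection_count\<close> and the smallness of the six
  projections give \<open>t ^ 52 \<le> C * t ^ (6 * M - 23040 * n)\<close>; the power of \<open>card_power4_le\<close> makes the covering number
  of \<open>A\<close> cancel. The exponent 52 comes from the fourth power of \<open>t ^ 13\<close>, and \<open>23040 * n = 160 * (144 * n)\<close> from
  the determinant. The choice of \<open>M\<close> turns the right-hand side into \<open>C * t ^ 54\<close>, which is too small.\<close>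

lemma exc_set_measure:
  "\<exists>M. \<exists>t\<^sub>0>0. \<forall>t \<delta> A. 0 < t \<longrightarrow> t < t\<^sub>0 \<longrightarrow> 0 < \<delta> \<longrightarrow> A \<subseteq> rep_ball q \<longrightarrow>
     outer_measure_of (haar_U q) (exc_set q M t \<delta> A) \<le> ennreal t"
proof -
  obtain n where n: "multi_poly n (config_det q)" using is_poly_config_det by (auto simp: is_poly_def)
  define b where "b = max 1 (max (frame_const 2) (frame_const 3))"
  define Z :: real where "Z = 7 ^ 16"
  define c where "c = min 1 (\<bar>config_det q witness\<bar> / (2 * 25 ^ n) ^ 6 / b ^ 3)"
  define C where "C = (128 * Z) ^ 4 * (count_const / c) ^ 160 * Z ^ 6"
  \<comment> \<open>Each summand of the denominator stands for one smallness condition on t.\<close>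
  define t0 where "t0 = 1 / (1536 * real n + 12 * Z + C + 1)"
  define M where "M = 3840 * n + 9"
  have b: "1 \<le> b" "frame_const 2 \<le> b" "frame_const 3 \<le> b" by (simp_all add: b_def)
  have Z: "Z > 0" by (simp add: Z_def)
  have c: "0 < c" "c \<le> 1" "c * b ^ 3 \<le> \<bar>config_det q witness\<bar> / (2 * 25 ^ n) ^ 6"
  proof -
    let ?d = "\<bar>config_det q witness\<bar> / (2 * 25 ^ n) ^ 6"
    have "?d > 0" using config_det_witness[of q] by (intro divide_pos_pos) auto
    then have "?d / b ^ 3 > 0" using b(1) by (intro divide_pos_pos) auto
    then show "0 < c" unfolding c_def by (simp only: min_less_iff_conj zero_less_one)
    show "c \<le> 1" by (simp add: c_def)
    have "c \<le> ?d / b ^ 3" by (simp add: c_def)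
    then have "c * b ^ 3 \<le> ?d / b ^ 3 * b ^ 3" using b(1) by (intro mult_right_mono) auto
    then show "c * b ^ 3 \<le> ?d" using b(1) by simp
  qed
  have cc: "count_const > 0"
    using frame_const_nonneg[of 2] frame_const_nonneg[of 3] by (simp add: count_const_def)
  have C: "C > 0" using Z cc c by (simp add: C_def)
  have den: "1536 * real n + 12 * Z + C + 1 > 0" using Z C by (simp add: add_nonneg_pos)
  have "outer_measure_of (haar_U q) (exc_set q M t \<delta> A) \<le> ennreal t"
    if t: "0 < t" "t < t0" and "0 < \<delta>" and A: "A \<subseteq> rep_ball q" for t \<delta> A
  proof (rule ccontr)
    assume "\<not> ?thesis"
    then have big: "outer_measure_of (haar_U q) (exc_set q M t \<delta> A) > ennreal t" by simp
    have "t * (1536 * real n + 12 * Z + C + 1) < 1"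
      using t(2) den by (simp add: t0_def pos_less_divide_eq)
    then have sum: "1536 * real n * t + 12 * Z * t + C * t + t < 1" by (simp add: algebra_simps)
    have nonneg: "0 \<le> 1536 * real n * t" "0 < 12 * Z * t" "0 < C * t" using t Z C by auto
    have tn: "1536 * real n * t \<le> 1" and tZ: "12 * 7 ^ 16 * t \<le> 1" and tC: "C * t < 1" and t1: "t \<le> 1"
      using sum nonneg t(1) unfolding Z_def[symmetric] by linarith+
    have "A \<noteq> {}"
    proof
      assume "A = {}"
      then have "exc_set q M t \<delta> A = {}" by (auto simp: exc_set_def covering_number_empty)
      then show False using big outer_measure_le_plane[of "{}" "exc_set q M t \<delta> A" q] by simp
    qed
    obtain p :: "nat \<Rightarrow> real \<times> real" and X :: "nat \<Rightarrow> (real^4^4) set" where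
      pX: "\<And>i. i < 6 \<Longrightarrow> p i \<in> square \<and> X i \<subseteq> A \<and>
        real (covering_number \<delta> (proj_u q 0 (uni q (fst (p i)) (snd (p i))) ` X i))
          < t ^ M * real (covering_number \<delta> A) powr (6/9)"
      and det: "\<bar>config_det q witness\<bar> / (2 * 25 ^ n) ^ 6 * t ^ (144 * n) \<le> \<bar>config_det q p\<bar>"
      and count: "t ^ 13 * real (covering_number \<delta> A) \<le> 128 * 7 ^ 16 * real (card (\<Inter>i<6. mcell \<delta> ` X i))"
      using generic_exceptional_tuple[OF n t(1) tn tZ \<open>0 < \<delta>\<close> A \<open>A \<noteq> {}\<close> big] by metis
    define P where "P i = proj_u q 0 (uni q (fst (p i)) (snd (p i)))" for i
    define a where "a = real (covering_number \<delta> A)"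
    define m where "m = real (card (\<Inter>i<6. mcell \<delta> ` X i))"
    define \<kappa> where "\<kappa> = c * t ^ (144 * n)"
    have \<kappa>: "0 < \<kappa>" "\<kappa> \<le> 1"
      using c t(1) t1 by (auto simp: \<kappa>_def intro!: mult_le_one power_le_one)
    have "\<kappa> * b ^ 3 = c * b ^ 3 * t ^ (144 * n)" by (simp add: \<kappa>_def)
    also have "\<dots> \<le> \<bar>config_det q witness\<bar> / (2 * 25 ^ n) ^ 6 * t ^ (144 * n)"
      using c(3) t(1) by (intro mult_right_mono) auto
    finally have "\<kappa> * b ^ 3 \<le> \<bar>config_det q p\<bar>" using det by linarith
    note factors = config_det_factors[OF conjunct1[OF pX] b this]
    have XA: "X i \<subseteq> rep q" "bounded (X i)" if "i < 6" for i
    proof -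
      have "X i \<subseteq> rep_ball q" using pX[OF that] A by blast
      then show "X i \<subseteq> rep q" "bounded (X i)"
        using bounded_subset[OF bounded_rep_ball] by (auto simp: rep_ball_def)
    qed
    have "m ^ 4 \<le> (count_const / \<kappa>) ^ 160 *
      (\<Prod>j<3. real (card (mcell \<delta> ` P (2 * j) ` X (2 * j))) * real (card (mcell \<delta> ` P (2 * j + 1) ` X (2 * j + 1))))"
      unfolding m_def P_def using pX XA \<kappa> \<open>0 < \<delta>\<close> factors by (intro projection_count) auto
    also have "\<dots> \<le> (count_const / \<kappa>) ^ 160 * (\<Prod>j<(3::nat). (Z * (t ^ M * a powr (6/9))) * (Z * (t ^ M * a powr (6/9))))"
    proof (intro mult_left_mono prod_mono conjI mult_mono mult_nonneg_nonneg zero_le_power)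
      have le: "real (card (mcell \<delta> ` P i ` X i)) \<le> Z * (t ^ M * a powr (6/9))" if "i < 6" for i
      proof -
        have "bounded (P i ` X i)" unfolding P_def using XA[OF that] by (intro bounded_proj_image)
        then have "real (card (mcell \<delta> ` P i ` X i)) \<le> Z * real (covering_number \<delta> (P i ` X i))"
          unfolding Z_def by (rule cells_le_covering_number(2)[OF \<open>0 < \<delta>\<close>])
        also have "\<dots> \<le> Z * (t ^ M * a powr (6/9))"
          using pX[OF that] Z by (intro mult_left_mono) (auto simp: P_def a_def)
        finally show ?thesis .
      qed
      fix j :: nat assume "j \<in> {..<3}"
      then have "2 * j < 6" "2 * j + 1 < 6" by auto
      then show "real (card (mcell \<delta> ` P (2 * j) ` X (2 * j))) \<le> Z * (t ^ M * a powr (6/9))"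
        "real (card (mcell \<delta> ` P (2 * j + 1) ` X (2 * j + 1))) \<le> Z * (t ^ M * a powr (6/9))"
        by (blast intro: le)+
    qed (use Z t cc \<kappa> in auto)
    also have "(\<Prod>j<(3::nat). (Z * (t ^ M * a powr (6/9))) * (Z * (t ^ M * a powr (6/9)))) = Z ^ 6 * t ^ (6 * M) * a ^ 4"
    proof -
      have "(a powr (6/9)) ^ 6 = a ^ 4"
      proof (cases "a = 0")
        case False
        then have "a > 0" by (simp add: a_def)
        have "(a powr (6/9)) powr 6 = a powr 4" by (simp add: powr_powr)
        then show ?thesis using \<open>a > 0\<close> by simp
      qed simp
      moreover have "(t ^ M) ^ 6 = t ^ (6 * M)" by (simp add: mult.commute flip: power_mult)
      moreover have cube: "(\<Prod>j<(3::nat). y * y) = y ^ 6" for y :: real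
        by (simp add: power2_eq_square[symmetric] flip: power_mult)
      ultimately show ?thesis unfolding cube by (simp only: power_mult_distrib mult.assoc)
    qed
    finally have m: "m ^ 4 \<le> (count_const / \<kappa>) ^ 160 * (Z ^ 6 * t ^ (6 * M) * a ^ 4)" .
    have "a > 0"
    proof -
      have "bounded A" using bounded_subset[OF bounded_rep_ball A] .
      from cells_le_covering_number[OF \<open>0 < \<delta>\<close> this] have "card (mcell \<delta> ` A) > 0" "real (card (mcell \<delta> ` A)) \<le> Z * a"
        using \<open>A \<noteq> {}\<close> by (auto simp: card_gt_0_iff Z_def a_def)
      then have "0 < Z * a" by linarith
      then show ?thesis using Z by (simp add: zero_less_mult_iff)
    qed
    have "(t ^ 13 * a) ^ 4 \<le> (128 * Z * m) ^ 4"
      using count t(1) \<open>a > 0\<close> by (intro power_mono) (auto simp: Z_def a_def m_def)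
    also have "\<dots> = (128 * Z) ^ 4 * m ^ 4" by (simp only: power_mult_distrib)
    also have "\<dots> \<le> (128 * Z) ^ 4 * ((count_const / \<kappa>) ^ 160 * (Z ^ 6 * t ^ (6 * M) * a ^ 4))"
      using m Z by (intro mult_left_mono) auto
    also have "(count_const / \<kappa>) ^ 160 = (count_const / c) ^ 160 / t ^ (23040 * n)"
    proof -
      have "count_const / \<kappa> = count_const / c / t ^ (144 * n)" by (simp add: \<kappa>_def)
      moreover have "(t ^ (144 * n)) ^ 160 = t ^ (23040 * n)" by (simp flip: power_mult)
      ultimately show ?thesis by (simp only: power_divide)
    qed
    also have "(128 * Z) ^ 4 * ((count_const / c) ^ 160 / t ^ (23040 * n) * (Z ^ 6 * t ^ (6 * M) * a ^ 4))
        = C * (t ^ (6 * M) / t ^ (23040 * n)) * a ^ 4"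
      by (simp add: C_def)
    also have "t ^ (6 * M) / t ^ (23040 * n) = t ^ 54"
    proof -
      have "6 * M = 54 + 23040 * n" by (simp add: M_def)
      then show ?thesis using t(1) by (simp only: power_add) simp
    qed
    also have "(t ^ 13 * a) ^ 4 = t ^ 52 * a ^ 4" by (simp add: power_mult_distrib flip: power_mult)
    finally have "t ^ 52 \<le> C * t ^ 54" using \<open>a > 0\<close> by simp
    also have "\<dots> = t ^ 52 * (C * t * t)" by (simp add: mult_ac flip: power_Suc2 power_Suc)
    finally have "1 \<le> C * t * t" using t(1) by simp
    also have "\<dots> \<le> C * t * 1" using nonneg t1 by (intro mult_left_mono) auto
    finally show False using tC by simp
  qed
  moreover have "t0 > 0" using den by (simp add: t0_def)
  ultimately show ?thesis by blast
qed

theorem theorem12p2: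
  fixes q :: form
  shows "\<exists>M::real. \<exists>\<epsilon>\<^sub>0>0. \<forall>\<epsilon>. 0 < \<epsilon> \<and> \<epsilon> < \<epsilon>\<^sub>0 \<longrightarrow>
    (\<exists>\<delta>\<^sub>0>0. \<forall>\<delta>. 0 < \<delta> \<and> \<delta> < \<delta>\<^sub>0 \<longrightarrow>
      (\<forall>A. A \<subseteq> rep_ball q \<longrightarrow>
        outer_measure_of (haar_U q) (exceptional_set q M \<epsilon> \<delta> A) \<le> ennreal (\<delta> powr \<epsilon>)))"
proof -
  obtain M t0 where t0: "t0 > 0" and small: "\<And>t \<delta> A. 0 < t \<Longrightarrow> t < t0 \<Longrightarrow> 0 < \<delta> \<Longrightarrow> A \<subseteq> rep_ball q \<Longrightarrow>
     outer_measure_of (haar_U q) (exc_set q M t \<delta> A) \<le> ennreal t"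
    using exc_set_measure[of q] by blast
  show ?thesis
  proof (rule exI[of _ "real M"], rule exI[of _ 1], intro conjI allI impI)
    fix \<epsilon> :: real assume \<epsilon>: "0 < \<epsilon> \<and> \<epsilon> < 1"
    show "\<exists>\<delta>\<^sub>0>0. \<forall>\<delta>. 0 < \<delta> \<and> \<delta> < \<delta>\<^sub>0 \<longrightarrow> (\<forall>A. A \<subseteq> rep_ball q \<longrightarrow>
        outer_measure_of (haar_U q) (exceptional_set q (real M) \<epsilon> \<delta> A) \<le> ennreal (\<delta> powr \<epsilon>))"
    proof (rule exI[of _ "t0 powr (1 / \<epsilon>)"], intro conjI allI impI)
      show "t0 powr (1 / \<epsilon>) > 0" using t0 by simp
      fix \<delta> A assume \<delta>: "0 < \<delta> \<and> \<delta> < t0 powr (1 / \<epsilon>)" and A: "A \<subseteq> rep_ball q"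
      have "\<delta> powr \<epsilon> < (t0 powr (1 / \<epsilon>)) powr \<epsilon>" using \<delta> \<epsilon> by (intro powr_less_mono2) auto
      also have "\<dots> = t0" using t0 \<epsilon> by (simp add: powr_powr)
      finally have "\<delta> powr \<epsilon> < t0" .
      moreover have "exceptional_set q (real M) \<epsilon> \<delta> A = exc_set q M (\<delta> powr \<epsilon>) \<delta> A"
        using \<delta> by (simp add: exceptional_set_def exc_set_def powr_power mult.commute)
      ultimately show "outer_measure_of (haar_U q) (exceptional_set q (real M) \<epsilon> \<delta> A) \<le> ennreal (\<delta> powr \<epsilon>)"
        using small[of "\<delta> powr \<epsilon>" \<delta> A] \<delta> A by simp
    qed
  qed simp
qed

end
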